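(* Let $d\ge 1$ and $2\le m<s$. Let $p$ be the integral kernel associated with the operator $A=\operatorname{div}(Q\nabla\,\cdot)-V$ on $\mathbb{R}^d$ with $Q(x)=e^{|x|^m}I$ and $V(x)=e^{|x|^s}$. Let $\frac m2+1\le\beta\le m$, $\varepsilon>0$, $\alpha>\frac{2\beta+m-2}{2m}$ and $k>d+2$. Then there is a constant $C>0$, independent of $t,x,y$, such that $$p(t,x,y)\le C\,t^{1-\frac k2}\exp\!\left(Ckt^{-\alpha}\right)\exp\!\left(-\frac{\varepsilon}{2}t^\alpha\int_0^{|x|_*}e^{\frac{\tau^\beta}{2}}\,d\tau\right)\exp\!\left(-\frac{\varepsilon}{2}t^\alpha\int_0^{|y|_*}e^{\frac{\tau^\beta}{2}}\,d\tau\right)$$ for all $t\in(0,1)$ and $x,y\in\mathbb{R}^d$.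
   Context: $x\mapsto|x|_*$ denotes any (fixed) nonnegative $C^2$-function on $\mathbb{R}^d$ which coincides with $|x|$ for $|x|\ge 1$. Kernel: the minimal semigroup $T(\cdot)$ associated with $A$ on $C_b(\mathbb{R}^d)$ is given by $T(t)f(x)=\lim_{n\to\infty}u_n(t,x)$, where $u_n$ is the classical solution of $\partial_tu_n=Au_n$ in $(0,\infty)\times B_n$ with $u_n=0$ on $(0,\infty)\times\partial B_n$ and $u_n(0,\cdot)=f$ on $B_n$ ($B_n$ the open ball of radius $n$ centered at $0$). It has the form $T(t)f(x)=\int_{\mathbb{R}^d}p(t,x,y)f(y)\,dy$ for $t>0$, $x\in\mathbb{R}^d$, $f\in C_b(\mathbb{R}^d)$, with a positive kernel $p$; this $p$ is the integral kernel associated with $A$. *)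

theory Defs
  imports "HOL-Analysis.Analysis"
begin

definition grad :: "(real^'n \<Rightarrow> real) \<Rightarrow> real^'n \<Rightarrow> real^'n" where
  "grad f x = (\<chi> i. frechet_derivative f (at x) (axis i 1))"

definition divergence :: "(real^'n \<Rightarrow> real^'n) \<Rightarrow> real^'n \<Rightarrow> real" where
  "divergence F x = (\<Sum>i\<in>UNIV. frechet_derivative F (at x) (axis i 1) $ i)"

definition hessian :: "(real^'n \<Rightarrow> real) \<Rightarrow> real^'n \<Rightarrow> real^'n^'n" where
  "hessian f x = jacobian (grad f) (at x)"

text \<open>The class \<open>C\<^sup>2(U)\<close>, for open \<open>U\<close>.\<close>

definition C2_on :: "(real^'n) set \<Rightarrow> (real^'n \<Rightarrow> real) \<Rightarrow> bool" where
  "C2_on U f \<longleftrightarrow>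
     (\<forall>x\<in>U. f differentiable (at x) \<and> grad f differentiable (at x)) \<and>
     continuous_on U (hessian f)"

text \<open>The class \<open>C\<^sup>1\<^sup>,\<^sup>2((0,\<infinity>) \<times> U)\<close>, for open \<open>U\<close>: \<open>u\<close>, its time derivative and its
  spatial derivatives up to order two exist and are jointly continuous.\<close>

definition C12_on :: "(real^'n) set \<Rightarrow> (real \<Rightarrow> real^'n \<Rightarrow> real) \<Rightarrow> bool" where
  "C12_on U u \<longleftrightarrow>
     (\<forall>t>0. \<forall>x\<in>U. (\<lambda>s. u s x) differentiable (at t) \<and>
        u t differentiable (at x) \<and> grad (u t) differentiable (at x)) \<and>
     continuous_on ({0<..} \<times> U) (\<lambda>(t, x). u t x) \<and>
     continuous_on ({0<..} \<times> U) (\<lambda>(t, x). deriv (\<lambda>s. u s x) t) \<and>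
     continuous_on ({0<..} \<times> U) (\<lambda>(t, x). grad (u t) x) \<and>
     continuous_on ({0<..} \<times> U) (\<lambda>(t, x). hessian (u t) x)"

definition elliptic_op ::
  "(real^'n \<Rightarrow> real^'n^'n) \<Rightarrow> (real^'n \<Rightarrow> real) \<Rightarrow> (real^'n \<Rightarrow> real) \<Rightarrow> real^'n \<Rightarrow> real" where
  "elliptic_op Q V f x = divergence (\<lambda>z. Q z *v grad f z) x - V x * f x"

text \<open>\<open>u\<close> is the classical solution of the Cauchy--Dirichlet problem for \<open>A\<close> on the ball
  \<open>B\<^sub>n\<close> with initial datum \<open>f\<close>.  As \<open>f\<close> need not vanish on the sphere, continuity is not
  required at the corner \<open>{0} \<times> \<partial>B\<^sub>n\<close>; boundedness is what makes the solution unique there.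
  The values of \<open>u t x\<close> for negative \<open>t\<close>, outside the closed ball and at the corner are
  irrelevant.\<close>

definition dirichlet_solution ::
  "((real^'n \<Rightarrow> real) \<Rightarrow> real^'n \<Rightarrow> real) \<Rightarrow> nat \<Rightarrow> (real^'n \<Rightarrow> real) \<Rightarrow>
     (real \<Rightarrow> real^'n \<Rightarrow> real) \<Rightarrow> bool" where
  "dirichlet_solution A n f u \<longleftrightarrow>
     C12_on (ball 0 (real n)) u \<and>
     continuous_on ({0..} \<times> cball 0 (real n) - {0} \<times> sphere 0 (real n)) (\<lambda>(t, x). u t x) \<and>
     bounded ((\<lambda>(t, x). u t x) ` ({0<..} \<times> ball 0 (real n))) \<and>
     (\<forall>t>0. \<forall>x\<in>ball 0 (real n). ((\<lambda>s. u s x) has_real_derivative A (u t) x) (at t)) \<and>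
     (\<forall>t>0. \<forall>x\<in>sphere 0 (real n). u t x = 0) \<and>
     (\<forall>x\<in>ball 0 (real n). u 0 x = f x)"

text \<open>Only the values \<open>T t f x\<close> with \<open>t > 0\<close> and \<open>f\<close> bounded and continuous are constrained
  (and determined) by this predicate.\<close>

definition minimal_semigroup ::
  "((real^'n \<Rightarrow> real) \<Rightarrow> real^'n \<Rightarrow> real) \<Rightarrow> (real \<Rightarrow> (real^'n \<Rightarrow> real) \<Rightarrow> real^'n \<Rightarrow> real) \<Rightarrow> bool"
  where
  "minimal_semigroup A T \<longleftrightarrow>
     (\<forall>f\<in>bcontfun. \<exists>u. (\<forall>n\<ge>1. dirichlet_solution A n f (u n)) \<and>
        (\<forall>t>0. \<forall>x. (\<lambda>n. u n t x) \<longlonglongrightarrow> T t f x))"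

text \<open>The integral representation determines \<open>p t x\<close> only up to a Lebesgue null set; as
  usual, \<open>p t x\<close> denotes the continuous representative, which makes \<open>p\<close> unique (for \<open>t > 0\<close>)
  and pointwise bounds meaningful.\<close>

definition integral_kernel ::
  "((real^'n \<Rightarrow> real) \<Rightarrow> real^'n \<Rightarrow> real) \<Rightarrow> (real \<Rightarrow> real^'n \<Rightarrow> real^'n \<Rightarrow> real) \<Rightarrow> bool" where
  "integral_kernel A p \<longleftrightarrow>
     (\<forall>t>0. \<forall>x y. 0 < p t x y) \<and>
     (\<forall>t>0. \<forall>x. continuous_on UNIV (p t x)) \<and>
     (\<exists>T. minimal_semigroup A T \<and>
        (\<forall>t>0. \<forall>x. \<forall>f\<in>bcontfun.
           has_bochner_integral lborel (\<lambda>y. p t x y * f y) (T t f x)))"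

text \<open>The admissible choices of the function \<open>x \<mapsto> |x|\<^sub>*\<close>.\<close>

definition smoothed_norm :: "(real^'n \<Rightarrow> real) \<Rightarrow> bool" where
  "smoothed_norm \<nu> \<longleftrightarrow>
     (\<forall>x. 0 \<le> \<nu> x) \<and> C2_on UNIV \<nu> \<and> (\<forall>x. 1 \<le> norm x \<longrightarrow> \<nu> x = norm x)"

end

(* Write A = div(q grad .) - V with q = exp(|x|^m) and V = exp(|x|^s), fix m < sigma < s, and put
   phi(t,x) = exp(K t - eta t^alpha exp((1+|x|^2)^(sigma/2))).  The hypotheses force alpha > 1, and
   since V dominates every expression built from q and exp((1+|x|^2)^(sigma/2)), phi satisfies
   d/dt phi >= A phi on 0 < t < 1 for large K, with phi(0,.) = 1.

   Let u be the solution on a ball with datum f >= 0, and let G be a C^2 convex cutoff vanishing near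
   0, so that G(u) is a compactly supported subsolution of the (formally self-adjoint) equation.
   On [0,t/3], pairing G(u) with the time reversal of phi bounds its integral at time t/3 by that of
   f phi(t/3,.).  On [t/3,2t/3], Nash's inequality (q >= 1) applied to the powers G(u)^(2^j) bounds
   sup u by C t^(-d/2) times this integral.  On [2t/3,t], comparison with a multiple of phi brings in
   the factor phi(t/3,x).  Exhausting by balls and concentrating f at y yields
   p(t,x,y) <= C t^(-d/2) phi(t/3,x) phi(t/3,y), which is stronger than the claim because
   exp((1+|x|^2)^(sigma/2)) outgrows the integrals of exp(tau^beta/2) for beta <= m. *)

theory Submission
  imports Defs
begin

section \<open>Gradients, divergences and Jacobians\<close>

text \<open>The datum need not vanish on the sphere, so a Dirichlet solution \<open>u\<close> is
  merely bounded near the corner of its space-time cylinder, and its derivatives are not controlled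
  up to the sphere. Hence integration by parts is done with G(u) only: on compact time intervals in
  t > 0, \<open>u\<close> is at most \<delta> in a layer along the sphere, so G(u) has compact
  support. Time 0 is reached by dominated convergence, and \<delta> tends to 0 at the end. Iterating
  over the powers 2^j leads from L^1 to the supremum directly, in every dimension. The comparison in
  the last stage is a case of the same smoothing bound: arbitrarily small mass forces G to vanish.
  The growth of the coefficients enters only through phi. Its time derivative brings t^(\<alpha> -
  1) times the weight, which is where \<alpha> >= 1 matters; its second derivatives bring q times
  the square of the derivative of the weight. Both are at most the exponential of a multiple of 1 +
  |x|^\<sigma>, which V absorbs because \<sigma> < s.\<close>

lemma has_derivative_grad:
  assumes "f differentiable (at x)"
  shows "(f has_derivative (\<lambda>h. grad f x \<bullet> h)) (at x)"
proof -
  let ?F = "frechet_derivative f (at x)"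
  have f: "(f has_derivative ?F) (at x)"
    using assms frechet_derivative_works by blast
  then have lin: "linear ?F" by (rule has_derivative_linear)
  have "?F h = grad f x \<bullet> h" for h
  proof -
    have "?F h = ?F (\<Sum>i\<in>UNIV. h $ i *s axis i 1)" by (simp add: basis_expansion)
    also have "\<dots> = (\<Sum>i\<in>UNIV. h $ i * ?F (axis i 1))"
      by (simp add: linear_sum[OF lin] scalar_mult_eq_scaleR linear_cmul[OF lin])
    finally show ?thesis by (simp add: grad_def inner_vec_def mult.commute)
  qed
  then have "?F = (\<lambda>h. grad f x \<bullet> h)" by auto
  with f show ?thesis by simp
qed

lemma grad_eqI:
  assumes "(f has_derivative (\<lambda>h. g \<bullet> h)) (at x)"
  shows "grad f x = g"
proof -
  have "frechet_derivative f (at x) = (\<lambda>h. g \<bullet> h)"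
    using frechet_derivative_at[OF assms] by simp
  then show ?thesis by (simp add: grad_def inner_axis vec_eq_iff)
qed

lemma divergence_eq:
  "(F has_derivative F') (at x) \<Longrightarrow> divergence F x = (\<Sum>i\<in>UNIV. F' (axis i 1) $ i)"
  unfolding divergence_def using frechet_derivative_at by metis

lemma jacobian_eq:
  "(F has_derivative F') (at x) \<Longrightarrow> jacobian F (at x) = (\<chi> i j. F' (axis j 1) $ i)"
  unfolding jacobian_def matrix_def using frechet_derivative_at by metis

lemma divergence_jacobian: "divergence F x = (\<Sum>i\<in>UNIV. jacobian F (at x) $ i $ i)"
  by (simp add: divergence_def jacobian_def matrix_def)

lemma grad_scale_comp:
  assumes "f differentiable (at x)" "(G has_real_derivative G') (at (f x))"
  shows "(\<lambda>z. G (f z)) differentiable (at x)" "grad (\<lambda>z. G (f z)) x = G' *\<^sub>R grad f x"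
proof -
  have "((\<lambda>z. G (f z)) has_derivative (\<lambda>h. (grad f x \<bullet> h) * G')) (at x)"
    using has_derivative_compose[OF has_derivative_grad[OF assms(1)], of G "\<lambda>h. h * G'"] assms(2)
    by (simp add: has_field_derivative_def mult_commute_abs)
  then have *: "((\<lambda>z. G (f z)) has_derivative (\<lambda>h. (G' *\<^sub>R grad f x) \<bullet> h)) (at x)"
    by (simp add: mult.commute)
  from grad_eqI[OF *] * show "(\<lambda>z. G (f z)) differentiable (at x)"
    "grad (\<lambda>z. G (f z)) x = G' *\<^sub>R grad f x"
    by (auto simp: differentiable_def)
qed

lemma grad_mult:
  assumes "f differentiable (at x)" "g differentiable (at x)"
  shows "grad (\<lambda>z. f z * g z) x = f x *\<^sub>R grad g x + g x *\<^sub>R grad f x"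
  by (rule grad_eqI, rule has_derivative_eq_rhs,
      rule has_derivative_mult[OF has_derivative_grad[OF assms(1)] has_derivative_grad[OF assms(2)]])
     (auto simp: inner_add_left)

lemma grad_diff:
  assumes "f differentiable (at x)" "g differentiable (at x)"
  shows "grad (\<lambda>z. f z - g z) x = grad f x - grad g x"
  by (rule grad_eqI, rule has_derivative_eq_rhs,
      rule has_derivative_diff[OF has_derivative_grad[OF assms(1)] has_derivative_grad[OF assms(2)]])
     (auto simp: inner_diff_left)

lemma grad_cmult:
  assumes "f differentiable (at x)"
  shows "grad (\<lambda>z. c * f z) x = c *\<^sub>R grad f x"
  by (rule grad_eqI, rule has_derivative_eq_rhs,
      rule has_derivative_mult_right[OF has_derivative_grad[OF assms(1)]])
     auto

lemma has_derivative_scaleR_grad: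
  assumes "g differentiable (at x)" "X differentiable (at x)"
  shows "((\<lambda>z. g z *\<^sub>R X z) has_derivative
    (\<lambda>h. g x *\<^sub>R frechet_derivative X (at x) h + (grad g x \<bullet> h) *\<^sub>R X x)) (at x)"
  using has_derivative_scaleR[OF has_derivative_grad[OF assms(1)]] assms(2) frechet_derivative_works
  by blast

lemma divergence_scaleR:
  assumes "g differentiable (at x)" "X differentiable (at x)"
  shows "divergence (\<lambda>z. g z *\<^sub>R X z) x = g x * divergence X x + grad g x \<bullet> X x"
  unfolding divergence_eq[OF has_derivative_scaleR_grad[OF assms]]
  by (simp add: divergence_def sum.distrib sum_distrib_left inner_axis inner_vec_def[of _ "X x"])

lemma divergence_diff:
  assumes "X differentiable (at x)" "Y differentiable (at x)"
  shows "divergence (\<lambda>z. X z - Y z) x = divergence X x - divergence Y x"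
  using divergence_eq[OF has_derivative_diff[of X _ _ Y]] assms
  by (auto simp: divergence_def sum_subtractf frechet_derivative_works)

lemma jacobian_scaleR:
  assumes "g differentiable (at x)" "X differentiable (at x)"
  shows "jacobian (\<lambda>z. g z *\<^sub>R X z) (at x)
    = (\<chi> i j. g x * jacobian X (at x) $ i $ j + grad g x $ j * X x $ i)"
  unfolding jacobian_eq[OF has_derivative_scaleR_grad[OF assms]]
  by (simp add: vec_eq_iff jacobian_def matrix_def inner_axis)

lemma jacobian_diff:
  assumes "X differentiable (at x)" "Y differentiable (at x)"
  shows "jacobian (\<lambda>z. X z - Y z) (at x) = jacobian X (at x) - jacobian Y (at x)"
  using jacobian_eq[OF has_derivative_diff[of X _ _ Y]] assms
  by (auto simp: jacobian_def matrix_def vec_eq_iff frechet_derivative_works)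

lemma continuous_on_vec_iff:
  "continuous_on S (\<lambda>x. f x :: 'b::topological_space^'n) \<longleftrightarrow> (\<forall>i. continuous_on S (\<lambda>x. f x $ i))"
proof
  assume "\<forall>i. continuous_on S (\<lambda>x. f x $ i)"
  then have "continuous_on S (\<lambda>x. \<chi> i. f x $ i)" by (intro continuous_on_vec_lambda) auto
  then show "continuous_on S f" by simp
qed (auto intro: continuous_on_component)

lemma continuous_on_jacobian_scaleR:
  assumes "\<And>x. x \<in> S \<Longrightarrow> g differentiable (at x)" "\<And>x. x \<in> S \<Longrightarrow> X differentiable (at x)"
    "continuous_on S (grad g)" "continuous_on S (\<lambda>x. jacobian X (at x))"
  shows "continuous_on S (\<lambda>x. jacobian (\<lambda>z. g z *\<^sub>R X z) (at x))"
proof -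
  have [continuous_intros]: "continuous_on S g" "continuous_on S X"
    using assms(1,2) differentiable_imp_continuous_within continuous_at_imp_continuous_on by blast+
  have "continuous_on S (\<lambda>x. \<chi> i j. g x * jacobian X (at x) $ i $ j + grad g x $ j * X x $ i)"
    using assms(3,4) by (intro continuous_intros) auto
  then show ?thesis
    by (rule continuous_on_eq) (simp add: jacobian_scaleR assms)
qed

section \<open>Integrals of compactly supported functions\<close>

text \<open>Since \<open>\<rho> < n\<close>, the relatively open pieces over the ball and over the
  complement of the closed \<rho>-ball cover everything, and the extension is zero on the second.
  Joint continuity in time and space is kept because differentiation under the integral sign will
  need it.\<close>

lemma continuous_on_zero_extension:
  fixes g :: "'b::topological_space \<times> 'a::real_normed_vector \<Rightarrow> 'c::real_normed_vector"
  assumes "continuous_on (S \<times> ball 0 n) g" "\<rho> < n"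
    and z: "\<And>t x. t \<in> S \<Longrightarrow> x \<in> ball 0 n \<Longrightarrow> \<rho> \<le> norm x \<Longrightarrow> g (t, x) = 0"
  shows "continuous_on (S \<times> UNIV) (\<lambda>p. if snd p \<in> ball 0 n then g p else 0)"
proof -
  let ?f = "\<lambda>p. if snd p \<in> ball 0 n then g p else 0"
  have "continuous_on (S \<times> ball 0 n) ?f"
    by (rule continuous_on_eq[OF assms(1)]) auto
  moreover have "continuous_on (S \<times> - cball 0 \<rho>) ?f"
    by (rule continuous_on_eq[of _ "\<lambda>_. 0"]) (auto simp: z)
  ultimately have "continuous_on (S \<times> ball 0 n \<union> S \<times> - cball 0 \<rho>) ?f"
  proof (rule continuous_on_Un_local_open[rotated 2])
    have U: "S \<times> ball 0 n \<union> S \<times> - cball 0 \<rho> = S \<times> UNIV" using assms(2) by auto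
    show "openin (top_of_set (S \<times> ball 0 n \<union> S \<times> - cball 0 \<rho>)) (S \<times> ball (0::'a) n)"
      unfolding U by (intro openin_Times openin_subtopology_self) auto
    show "openin (top_of_set (S \<times> ball 0 n \<union> S \<times> - cball 0 \<rho>)) (S \<times> - cball (0::'a) \<rho>)"
      unfolding U by (intro openin_Times openin_subtopology_self) auto
  qed
  moreover have U: "S \<times> ball 0 n \<union> S \<times> - cball 0 \<rho> = S \<times> UNIV" using assms(2) by auto
  ultimately show ?thesis unfolding U by blast
qed

lemma continuous_on_zero_extension_space:
  fixes g :: "'a::real_normed_vector \<Rightarrow> 'c::real_normed_vector"
  assumes "continuous_on (ball 0 n) g" "\<rho> < n"
    and z: "\<And>x. x \<in> ball 0 n \<Longrightarrow> \<rho> \<le> norm x \<Longrightarrow> g x = 0"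
  shows "continuous_on UNIV (\<lambda>x. if x \<in> ball 0 n then g x else 0)"
proof -
  have "continuous_on ({0::real} \<times> ball 0 n) (\<lambda>p. g (snd p))"
    by (rule continuous_on_compose2[OF assms(1)]) (auto intro!: continuous_intros)
  from continuous_on_zero_extension[OF this assms(2)] z
  have c: "continuous_on ({0::real} \<times> UNIV) (\<lambda>p. if snd p \<in> ball 0 n then g (snd p) else 0)" by auto
  have "continuous_on UNIV (\<lambda>x. (\<lambda>p::real \<times> 'a. if snd p \<in> ball 0 n then g (snd p) else 0) (0, x))"
    by (rule continuous_on_compose2[OF c]) (auto intro!: continuous_intros)
  then show ?thesis by (simp only: snd_conv)
qed

lemma integrable_continuous_compact_support:
  fixes f :: "'a::euclidean_space \<Rightarrow> real"
  assumes "continuous_on UNIV f" "\<And>x. R \<le> norm x \<Longrightarrow> f x = 0"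
  shows "integrable lborel f"
proof -
  have "integrable lborel (\<lambda>x. indicator (cball 0 R) x *\<^sub>R f x)"
    by (rule borel_integrable_compact) (auto intro: continuous_on_subset assms)
  moreover have "(\<lambda>x. indicator (cball 0 R) x *\<^sub>R f x) = f"
    using assms(2) by (auto simp: indicator_def fun_eq_iff)
  ultimately show ?thesis by simp
qed

lemma bounded_continuous_compact_support:
  fixes f :: "'a::euclidean_space \<Rightarrow> real"
  assumes "continuous_on UNIV f" "\<And>x. R \<le> norm x \<Longrightarrow> f x = 0"
  obtains B where "0 \<le> B" "\<And>x. \<bar>f x\<bar> \<le> B"
proof -
  have "compact (f ` cball 0 R)"
    by (intro compact_continuous_image continuous_on_subset[OF assms(1)]) auto
  then obtain B where "\<forall>x\<in>cball 0 R. \<bar>f x\<bar> \<le> B"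
    by (auto dest!: compact_imp_bounded simp: bounded_iff)
  then have "\<bar>f x\<bar> \<le> max B 0" for x using assms(2)[of x] by (cases "norm x \<le> R") (auto simp: le_max_iff_disj)
  then show ?thesis using that[of "max B 0"] by auto
qed

lemma integral_lborel_translation:
  fixes f :: "'a::euclidean_space \<Rightarrow> real"
  assumes "f \<in> borel_measurable borel"
  shows "(\<integral>x. f (x + h) \<partial>lborel) = (\<integral>x. f x \<partial>lborel)"
proof -
  have "(\<integral>x. f x \<partial>lborel) = (\<integral>x. f x \<partial>distr lborel borel ((+) h))"
    by (simp only: lborel_distr_plus)
  also have "\<dots> = (\<integral>x. f (h + x) \<partial>lborel)"
    using assms by (subst integral_distr) auto
  finally show ?thesis by (simp add: add.commute)
qed

text \<open>The difference quotients of a compactly supported \<open>C\<^sup>1\<close> function along \<open>h\<close> converge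
  boundedly, so that translation invariance passes to directional derivatives.\<close>

lemma difference_quotients:
  fixes g :: "'a::euclidean_space \<Rightarrow> real"
  assumes der: "\<And>x. (g has_derivative g' x) (at x)" and cont: "continuous_on UNIV (\<lambda>x. g' x h)"
    and supp: "\<And>x. R \<le> norm x \<Longrightarrow> g x = 0"
  obtains B where "0 \<le> B"
    "\<And>k x. \<bar>real (Suc k) * (g (x + h /\<^sub>R real (Suc k)) - g x)\<bar> \<le> B * indicator (cball 0 (R + norm h)) x"
    "\<And>x. (\<lambda>k. real (Suc k) * (g (x + h /\<^sub>R real (Suc k)) - g x)) \<longlonglongrightarrow> g' x h"
    "\<And>x. R + 1 \<le> norm x \<Longrightarrow> g' x h = 0"
proof -
  \<comment> \<open>The margin 1 places \<open>x\<close> in the open set where \<open>g\<close>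
    vanishes identically; on the sphere of radius \<open>R\<close> itself \<open>g\<close> is known
    to vanish on one side only.\<close>
  have z: "g' x h = 0" if "R + 1 \<le> norm x" for x
  proof -
    have "(g has_derivative (\<lambda>_. 0)) (at x)"
    proof (rule has_derivative_transform_within_open)
      show "open (- cball (0::'a) R)" by auto
      show "((\<lambda>_. 0) has_derivative (\<lambda>_. 0)) (at x)" by simp
    qed (use that supp in auto)
    then show ?thesis using has_derivative_unique[OF der] by metis
  qed
  obtain B where B: "0 \<le> B" "\<And>x. \<bar>g' x h\<bar> \<le> B"
    by (rule bounded_continuous_compact_support[OF cont, of "R + 1"]) (auto intro: z)
  have mv: "\<exists>y. g (x + \<delta> *\<^sub>R h) - g x = \<delta> * g' y h" if "0 < \<delta>" for x \<delta>
  proof -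
    have "((\<lambda>t. g (x + t *\<^sub>R h)) has_real_derivative g' (x + t *\<^sub>R h) h) (at t)" for t
    proof -
      have "((\<lambda>t. g (x + t *\<^sub>R h)) has_derivative (\<lambda>s. g' (x + t *\<^sub>R h) (s *\<^sub>R h))) (at t)"
        by (rule has_derivative_compose[of "\<lambda>t. x + t *\<^sub>R h" _ _ _ g])
           (auto intro!: derivative_eq_intros der)
      then show ?thesis
        using linear_cmul[OF has_derivative_linear[OF der]]
        by (simp add: has_field_derivative_def mult_commute_abs)
    qed
    then have "\<exists>z>0. z < \<delta> \<and> g (x + \<delta> *\<^sub>R h) - g (x + 0 *\<^sub>R h) = (\<delta> - 0) * g' (x + z *\<^sub>R h) h"
      using MVT2[of 0 \<delta> "\<lambda>t. g (x + t *\<^sub>R h)" "\<lambda>t. g' (x + t *\<^sub>R h) h"] that by auto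
    then show ?thesis by auto
  qed
  show ?thesis
  proof (rule that[OF B(1)])
    fix k x
    let ?\<delta> = "inverse (real (Suc k))"
    obtain y where y: "g (x + ?\<delta> *\<^sub>R h) - g x = ?\<delta> * g' y h" using mv[of ?\<delta> x] by auto
    have bd: "\<bar>real (Suc k) * (g (x + h /\<^sub>R real (Suc k)) - g x)\<bar> \<le> B"
      unfolding y using B(2)[of y] by (simp add: field_simps del: of_nat_Suc)
    show "\<bar>real (Suc k) * (g (x + h /\<^sub>R real (Suc k)) - g x)\<bar> \<le> B * indicator (cball 0 (R + norm h)) x"
    proof (cases "norm x \<le> R + norm h")
      case True then show ?thesis using bd by auto
    next
      case False
      have "norm (?\<delta> *\<^sub>R h) \<le> norm h"
        by (simp add: divide_simps mult_le_cancel_left1)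
      moreover have "norm x \<le> norm (x + ?\<delta> *\<^sub>R h) + norm (?\<delta> *\<^sub>R h)"
        by (metis add_diff_cancel norm_triangle_ineq4)
      ultimately have "R \<le> norm (x + ?\<delta> *\<^sub>R h)" "R \<le> norm x"
        using False norm_ge_zero[of h] by linarith+
      then show ?thesis using supp B(1) by (auto simp: indicator_def)
    qed
  next
    fix x
    have "((\<lambda>s. g (x + s *\<^sub>R h)) has_derivative (\<lambda>s. g' (x + 0 *\<^sub>R h) (s *\<^sub>R h))) (at 0)"
      by (rule has_derivative_compose[of "\<lambda>t. x + t *\<^sub>R h" _ _ _ g])
           (auto intro!: derivative_eq_intros der)
    then have "((\<lambda>s. g (x + s *\<^sub>R h)) has_real_derivative g' x h) (at 0)"
      using linear_cmul[OF has_derivative_linear[OF der]]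
      by (simp add: has_field_derivative_def mult_commute_abs)
    then have lim: "((\<lambda>s. (g (x + s *\<^sub>R h) - g x) / s) \<longlongrightarrow> g' x h) (at 0)"
      by (simp add: has_field_derivative_iff)
    have "filterlim (\<lambda>k. inverse (real (Suc k))) (at 0) sequentially"
      using LIMSEQ_inverse_real_of_nat by (auto simp: filterlim_at)
    from filterlim_compose[OF lim this]
    show "(\<lambda>k. real (Suc k) * (g (x + h /\<^sub>R real (Suc k)) - g x)) \<longlonglongrightarrow> g' x h"
      by (simp add: divide_inverse mult.commute)
  qed (use z in auto)
qed

text \<open>Translation invariance makes the integral of every difference quotient zero, and the
  limit is taken by dominated convergence. This yields integration by parts in any direction without
  slicing space into lines.\<close>

lemma integral_directional_derivative_zero:
  fixes g :: "'a::euclidean_space \<Rightarrow> real"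
  assumes der: "\<And>x. (g has_derivative g' x) (at x)" and cont: "continuous_on UNIV (\<lambda>x. g' x h)"
    and supp: "\<And>x. R \<le> norm x \<Longrightarrow> g x = 0"
  shows "integrable lborel (\<lambda>x. g' x h)" "(\<integral>x. g' x h \<partial>lborel) = 0"
proof -
  obtain B where B: "0 \<le> B"
    "\<And>k x. \<bar>real (Suc k) * (g (x + h /\<^sub>R real (Suc k)) - g x)\<bar> \<le> B * indicator (cball 0 (R + norm h)) x"
    "\<And>x. (\<lambda>k. real (Suc k) * (g (x + h /\<^sub>R real (Suc k)) - g x)) \<longlonglongrightarrow> g' x h"
    "\<And>x. R + 1 \<le> norm x \<Longrightarrow> g' x h = 0"
    apply (rule difference_quotients[of g g' h R])
       apply (rule der)
      apply (rule cont)
     apply (erule supp)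
    subgoal premises p for B by (rule p(1)) (fact p)+
    done
  have gc: "continuous_on UNIV g"
    using der has_derivative_continuous continuous_at_imp_continuous_on by blast
  have gm: "g \<in> borel_measurable borel" using gc by (rule borel_measurable_continuous_onI)
  have int: "integrable lborel g" by (rule integrable_continuous_compact_support[OF gc supp])
  show "integrable lborel (\<lambda>x. g' x h)"
    by (rule integrable_continuous_compact_support[OF cont B(4)])
  have m': "(\<lambda>x. g' x h) \<in> borel_measurable borel" using cont by (rule borel_measurable_continuous_onI)
  have gsh: "integrable lborel (\<lambda>x. g (x + v))" for v
  proof (rule integrable_continuous_compact_support[where R = "R + norm v"])
    show "continuous_on UNIV (\<lambda>x. g (x + v))"
      by (rule continuous_on_compose2[OF gc]) (auto intro!: continuous_intros)
    show "g (x + v) = 0" if "R + norm v \<le> norm x" for x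
      using that norm_diff_ineq[of x v] by (intro supp) linarith
  qed
  have "(\<lambda>k. \<integral>x. real (Suc k) * (g (x + h /\<^sub>R real (Suc k)) - g x) \<partial>lborel) \<longlonglongrightarrow> (\<integral>x. g' x h \<partial>lborel)"
  proof (rule integral_dominated_convergence)
    show "integrable lborel (\<lambda>x. B * indicator (cball 0 (R + norm h)) x)"
      using emeasure_lborel_cball_finite by (intro integrable_mult_right integrable_real_indicator) auto
    show "AE x in lborel. (\<lambda>k. real (Suc k) * (g (x + h /\<^sub>R real (Suc k)) - g x)) \<longlonglongrightarrow> g' x h"
      using B(3) by auto
    show "\<And>k. AE x in lborel. norm (real (Suc k) * (g (x + h /\<^sub>R real (Suc k)) - g x)) \<le> B * indicator (cball 0 (R + norm h)) x"
      using B(2) by (intro AE_I2) (simp only: real_norm_def)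
    show "(\<lambda>x. real (Suc k) * (g (x + h /\<^sub>R real (Suc k)) - g x)) \<in> borel_measurable lborel" for k
    proof -
      have "(\<lambda>x. g (x + h /\<^sub>R real (Suc k))) \<in> borel_measurable borel"
        by (rule measurable_compose[OF _ gm]) simp
      then show ?thesis using gm by simp
    qed
  qed (use m' in auto)
  moreover have "(\<integral>x. real (Suc k) * (g (x + h /\<^sub>R real (Suc k)) - g x) \<partial>lborel) = 0" for k
    using integral_lborel_translation[OF gm, of "h /\<^sub>R real (Suc k)"] gsh int
    by (simp add: Bochner_Integration.integral_diff)
  ultimately have "(\<lambda>k::nat. 0) \<longlonglongrightarrow> (\<integral>x. g' x h \<partial>lborel)" by (simp only:)
  then show "(\<integral>x. g' x h \<partial>lborel) = 0"
    using LIMSEQ_unique tendsto_const by blast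
qed

text \<open>Because \<open>F\<close> vanishes in a layer inside the sphere, its components extended
  by zero are C^1 on the whole space. Nothing is known of \<open>F\<close> outside the ball, hence
  the conditional in the integrand.\<close>

lemma integral_divergence_zero:
  fixes F :: "real^'n \<Rightarrow> real^'n"
  assumes dF: "\<And>x. x \<in> ball 0 n \<Longrightarrow> F differentiable (at x)"
    and cF: "continuous_on (ball 0 n) (\<lambda>x. jacobian F (at x))"
    and z: "\<And>x. x \<in> ball 0 n \<Longrightarrow> \<rho> \<le> norm x \<Longrightarrow> F x = 0" and "\<rho> < n"
  shows "integrable lborel (\<lambda>x. if x \<in> ball 0 n then divergence F x else 0)"
    "(\<integral>x. (if x \<in> ball 0 n then divergence F x else 0) \<partial>lborel) = 0"
proof -
  \<comment> \<open>Points with norm at least \<open>\<rho>'\<close> have a neighbourhood on which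
    \<open>F\<close> is zero, so the derivative vanishes there too, still strictly inside the
    ball.\<close>
  define \<rho>' where "\<rho>' = (\<rho> + n) / 2"
  have \<rho>': "\<rho> < \<rho>'" "\<rho>' < n" using assms(4) by (auto simp: \<rho>'_def)
  let ?F = "\<lambda>i x. if x \<in> ball 0 n then F x $ i else 0"
  let ?D = "\<lambda>x. if x \<in> ball 0 n then frechet_derivative F (at x) else (\<lambda>_. 0)"
  have zD: "frechet_derivative F (at x) = (\<lambda>_. 0)" if x: "x \<in> ball 0 n" "\<rho>' \<le> norm x" for x
  proof -
    have "(F has_derivative (\<lambda>_. 0)) (at x)"
    proof (rule has_derivative_transform_within_open)
      show "open (ball 0 n - cball (0::real^'n) \<rho>)" by auto
      show "((\<lambda>_. 0) has_derivative (\<lambda>_. 0)) (at x)" by simp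
    qed (use x \<rho>' z in auto)
    then show ?thesis using frechet_derivative_at by metis
  qed
  have der: "(?F i has_derivative (\<lambda>h. ?D x h $ i)) (at x)" for i x
  proof (cases "x \<in> ball 0 n")
    case True
    have "((\<lambda>x. F x $ i) has_derivative (\<lambda>h. frechet_derivative F (at x) h $ i)) (at x)"
      using dF[OF True] unfolding frechet_derivative_works
      by (rule bounded_linear.has_derivative[OF bounded_linear_vec_nth])
    then have "(?F i has_derivative (\<lambda>h. frechet_derivative F (at x) h $ i)) (at x)"
      by (rule has_derivative_transform_within_open[where s = "ball 0 n"]) (use True in auto)
    then show ?thesis using True by simp
  next
    case False
    have "(?F i has_derivative (\<lambda>_. 0)) (at x)"
    proof (rule has_derivative_transform_within_open)
      show "open (- cball (0::real^'n) \<rho>)" by auto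
      show "((\<lambda>_. 0) has_derivative (\<lambda>_. 0)) (at x)" by simp
    qed (use False z \<rho>' in auto)
    then show ?thesis using False by simp
  qed
  have cont: "continuous_on UNIV (\<lambda>x. ?D x (axis i 1) $ i)" for i
  proof -
    have "continuous_on (ball 0 n) (\<lambda>x. frechet_derivative F (at x) (axis i 1) $ i)"
      using cF unfolding continuous_on_vec_iff jacobian_def matrix_def by simp
    from continuous_on_zero_extension_space[OF this \<rho>'(2)] zD
    have "continuous_on UNIV (\<lambda>x. if x \<in> ball 0 n then frechet_derivative F (at x) (axis i 1) $ i else 0)"
      by auto
    moreover have "(\<lambda>x. if x \<in> ball 0 n then frechet_derivative F (at x) (axis i 1) $ i else 0)
       = (\<lambda>x. ?D x (axis i 1) $ i)" by auto
    ultimately show ?thesis by (simp only:)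
  qed
  have supp: "?F i x = 0" if "\<rho> \<le> norm x" for i x using that z by auto
  note I = integral_directional_derivative_zero[where R = \<rho>, OF der cont supp]
  have eq: "(\<lambda>x. if x \<in> ball 0 n then divergence F x else 0) = (\<lambda>x. \<Sum>i\<in>UNIV. ?D x (axis i 1) $ i)"
    by (auto simp: divergence_def)
  show "integrable lborel (\<lambda>x. if x \<in> ball 0 n then divergence F x else 0)"
    unfolding eq using I(1) by (intro Bochner_Integration.integrable_sum) auto
  show "(\<integral>x. (if x \<in> ball 0 n then divergence F x else 0) \<partial>lborel) = 0"
    unfolding eq using I by (subst Bochner_Integration.integral_sum) auto
qed

section \<open>Nash's inequality\<close>

lemma integrable_square_increment:
  fixes g :: "'a::euclidean_space \<Rightarrow> real"
  assumes gc: "continuous_on UNIV g" and supp: "\<And>x. R \<le> norm x \<Longrightarrow> g x = 0"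
  shows "integrable lborel (\<lambda>x. (g (x + u) - g (x + v))\<^sup>2)"
proof (rule integrable_continuous_compact_support[where R = "R + norm u + norm v"])
  have "continuous_on UNIV (\<lambda>x. g (x + u))" for u
    by (rule continuous_on_compose2[OF gc]) (auto intro!: continuous_intros)
  then show "continuous_on UNIV (\<lambda>x. (g (x + u) - g (x + v))\<^sup>2)"
    by (intro continuous_intros)
  show "(g (x + u) - g (x + v))\<^sup>2 = 0" if "R + norm u + norm v \<le> norm x" for x
  proof -
    have "R \<le> norm (x + u)" "R \<le> norm (x + v)"
      using that norm_diff_ineq[of x u] norm_diff_ineq[of x v] norm_ge_zero[of u] norm_ge_zero[of v]
      by linarith+
    then show ?thesis using supp by simp
  qed
qed

text \<open>The increment along \<open>h\<close> is a telescoping sum of k + 1 increments along h/(k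
  + 1). By Cauchy-Schwarz and translation invariance its squared integral is at most that of the
  squared difference quotient, for every k; the quotients converge boundedly to the
  derivative.\<close>

lemma integral_square_increment_le:
  fixes g :: "'a::euclidean_space \<Rightarrow> real"
  assumes der: "\<And>x. (g has_derivative g' x) (at x)" and cont: "continuous_on UNIV (\<lambda>x. g' x h)"
    and supp: "\<And>x. R \<le> norm x \<Longrightarrow> g x = 0"
  shows "(\<integral>x. (g (x + h) - g x)\<^sup>2 \<partial>lborel) \<le> (\<integral>x. (g' x h)\<^sup>2 \<partial>lborel)"
proof -
  obtain B where B: "0 \<le> B"
    "\<And>k x. \<bar>real (Suc k) * (g (x + h /\<^sub>R real (Suc k)) - g x)\<bar> \<le> B * indicator (cball 0 (R + norm h)) x"
    "\<And>x. (\<lambda>k. real (Suc k) * (g (x + h /\<^sub>R real (Suc k)) - g x)) \<longlonglongrightarrow> g' x h"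
    "\<And>x. R + 1 \<le> norm x \<Longrightarrow> g' x h = 0"
    apply (rule difference_quotients[of g g' h R])
       apply (rule der)
      apply (rule cont)
     apply (erule supp)
    subgoal premises p for B by (rule p(1)) (fact p)+
    done
  have gc: "continuous_on UNIV g"
    using der has_derivative_continuous continuous_at_imp_continuous_on by blast
  have gm: "g \<in> borel_measurable borel" using gc by (rule borel_measurable_continuous_onI)
  have gm': "(\<lambda>x. g (x + v)) \<in> borel_measurable borel" for v
    by (rule measurable_compose[OF _ gm]) simp
  have int: "integrable lborel (\<lambda>x. (g (x + u) - g (x + v))\<^sup>2)" for u v
    by (rule integrable_square_increment[OF gc supp])
  let ?s = "\<lambda>k x. real (Suc k) * (g (x + h /\<^sub>R real (Suc k)) - g x)"
  have lim: "(\<lambda>k. \<integral>x. (?s k x)\<^sup>2 \<partial>lborel) \<longlonglongrightarrow> (\<integral>x. (g' x h)\<^sup>2 \<partial>lborel)"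
  proof (rule integral_dominated_convergence)
    show "integrable lborel (\<lambda>x. B\<^sup>2 * indicator (cball 0 (R + norm h)) x :: real)"
      using emeasure_lborel_cball_finite by (intro integrable_mult_right integrable_real_indicator) auto
    show "AE x in lborel. (\<lambda>k. (?s k x)\<^sup>2) \<longlonglongrightarrow> (g' x h)\<^sup>2"
      using B(3) by (intro AE_I2 tendsto_power)
    show "AE x in lborel. norm ((?s k x)\<^sup>2) \<le> B\<^sup>2 * indicator (cball 0 (R + norm h)) x" for k
    proof (rule AE_I2)
      fix x
      have "\<bar>?s k x\<bar>\<^sup>2 \<le> (B * indicator (cball 0 (R + norm h)) x)\<^sup>2"
        using B(2)[of k x] by (intro power_mono) auto
      then show "norm ((?s k x)\<^sup>2) \<le> B\<^sup>2 * indicator (cball 0 (R + norm h)) x"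
        by (auto simp: indicator_def split: if_splits)
    qed
    show "(\<lambda>x. (?s k x)\<^sup>2) \<in> borel_measurable lborel" for k
      using gm gm' by (intro borel_measurable_power borel_measurable_times borel_measurable_diff) auto
    show "(\<lambda>x. (g' x h)\<^sup>2) \<in> borel_measurable lborel"
      using borel_measurable_continuous_onI[OF cont] by simp
  qed
  have "(\<integral>x. (g (x + h) - g x)\<^sup>2 \<partial>lborel) \<le> (\<integral>x. (?s k x)\<^sup>2 \<partial>lborel)" for k
  proof -
    define N where "N = real (Suc k)"
    define \<delta> where "\<delta> = h /\<^sub>R N"
    have N: "N > 0" by (simp add: N_def)
    let ?a = "\<lambda>i x. g (x + (real i *\<^sub>R \<delta> + \<delta>)) - g (x + real i *\<^sub>R \<delta>)"
    have pw: "(g (x + h) - g x)\<^sup>2 \<le> N * (\<Sum>i<Suc k. (?a i x)\<^sup>2)" for x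
    proof -
      have "(\<Sum>i<Suc k. ?a i x) = (\<Sum>i<Suc k. g (x + real (Suc i) *\<^sub>R \<delta>) - g (x + real i *\<^sub>R \<delta>))"
        by (intro sum.cong refl) (simp add: algebra_simps)
      also have "\<dots> = g (x + real (Suc k) *\<^sub>R \<delta>) - g (x + real 0 *\<^sub>R \<delta>)"
        by (rule sum_lessThan_telescope)
      also have "\<dots> = g (x + h) - g x" using N unfolding \<delta>_def N_def[symmetric] by simp
      finally have e: "(\<Sum>i<Suc k. ?a i x) = g (x + h) - g x" .
      show ?thesis using sum_squared_le_sum_of_squares[of "\<lambda>i. ?a i x" "{..<Suc k}"] unfolding e
        by (simp add: N_def mult.commute)
    qed
    have tr: "(\<integral>x. (?a i x)\<^sup>2 \<partial>lborel) = (\<integral>x. (g (x + \<delta>) - g x)\<^sup>2 \<partial>lborel)" for i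
      using integral_lborel_translation[of "\<lambda>x. (g (x + \<delta>) - g x)\<^sup>2" "real i *\<^sub>R \<delta>"] gm gm'
      by (simp add: add.assoc)
    have "(\<integral>x. (g (x + h) - g x)\<^sup>2 \<partial>lborel) \<le> (\<integral>x. N * (\<Sum>i<Suc k. (?a i x)\<^sup>2) \<partial>lborel)"
      using int[of h 0] by (intro integral_mono pw integrable_mult_right Bochner_Integration.integrable_sum int) auto
    also have "\<dots> = N * (\<Sum>i<Suc k. (\<integral>x. (?a i x)\<^sup>2 \<partial>lborel))"
      using int by (subst integral_mult_right_zero, subst Bochner_Integration.integral_sum) auto
    \<comment> \<open>One factor \<open>N\<close> comes from Cauchy-Schwarz, the other counts the
      \<open>N\<close> summands, all equal by translation; together they turn the increment into a
      difference quotient.\<close>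
    also have "\<dots> = N * (N * (\<integral>x. (g (x + \<delta>) - g x)\<^sup>2 \<partial>lborel))"
      unfolding tr by (simp add: N_def)
    also have "\<dots> = (\<integral>x. (?s k x)\<^sup>2 \<partial>lborel)"
      unfolding N_def[symmetric] \<delta>_def[symmetric]
      by (simp add: power_mult_distrib power2_eq_square[of N] mult.assoc)
    finally show ?thesis .
  qed
  then show ?thesis using lim by (intro LIMSEQ_le_const) auto
qed

text \<open>The correlation \<open>\<integral> g x * g (x + h)\<close> differs from \<open>\<integral> g\<^sup>2\<close> by half the
  squared \<open>L\<^sup>2\<close> increment; averaging it over a cube of side \<open>r\<close> leaves at most
  \<open>r\<^sup>-\<^sup>d (\<integral> g)\<^sup>2\<close>.\<close>

lemma nash_inequality:
  fixes g :: "'a::euclidean_space \<Rightarrow> real" and r :: real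
  assumes der: "\<And>x. (g has_derivative (\<lambda>h. D x \<bullet> h)) (at x)" and cont: "continuous_on UNIV D"
    and supp: "\<And>x. R \<le> norm x \<Longrightarrow> g x = 0" and nonneg: "\<And>x. 0 \<le> g x" and "0 < r"
  shows "(\<integral>x. (g x)\<^sup>2 \<partial>lborel)
    \<le> DIM('a) * r\<^sup>2 / 2 * (\<integral>x. (norm (D x))\<^sup>2 \<partial>lborel) + (\<integral>x. g x \<partial>lborel)\<^sup>2 / r ^ DIM('a)"
proof -
  let ?d = "real DIM('a)"
  have gc: "continuous_on UNIV g"
    using der has_derivative_continuous continuous_at_imp_continuous_on by blast
  have gm[measurable]: "g \<in> borel_measurable borel" using gc by (rule borel_measurable_continuous_onI)
  have gh: "continuous_on UNIV (\<lambda>x. g (x + h))" for h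
    by (rule continuous_on_compose2[OF gc]) (auto intro!: continuous_intros)
  have g2: "integrable lborel (\<lambda>x. (g x)\<^sup>2)"
    by (rule integrable_continuous_compact_support[of _ R]) (auto intro!: continuous_intros gc simp: supp)
  have gi: "integrable lborel g"
    by (rule integrable_continuous_compact_support[OF gc supp])
  have Dz: "D x = 0" if "R + 1 \<le> norm x" for x
  proof -
    have "(g has_derivative (\<lambda>_. 0)) (at x)"
    proof (rule has_derivative_transform_within_open)
      show "open (- cball (0::'a) R)" by auto
      show "((\<lambda>_. 0) has_derivative (\<lambda>_. 0)) (at x)" by simp
    qed (use that supp in auto)
    then have "(\<lambda>h. D x \<bullet> h) = (\<lambda>_. 0)" by (rule has_derivative_unique[OF der])
    from fun_cong[OF this, of "D x"] show ?thesis by simp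
  qed
  have D2: "integrable lborel (\<lambda>x. (norm (D x))\<^sup>2)"
    by (rule integrable_continuous_compact_support[of _ "R + 1"])
       (auto intro!: continuous_intros cont simp: Dz)
  define I where "I = (\<integral>x. (norm (D x))\<^sup>2 \<partial>lborel)"
  define S where "S = (\<integral>x. (g x)\<^sup>2 \<partial>lborel)"
  \<comment> \<open>A lower bound for every correlation with shift in the cube of side
    \<open>r\<close>: there |h|^2 is at most d r^2, and half the squared increment is lost from
    \<open>S\<close>.\<close>
  define a where "a = S - ?d * r\<^sup>2 / 2 * I"
  have corr_int: "integrable lborel (\<lambda>x. g x * g (x + h))" for h
    by (rule integrable_continuous_compact_support[of _ R])
       (intro continuous_intros gc gh, simp add: supp)
  have corr: "a \<le> (\<integral>x. g x * g (x + h) \<partial>lborel)" if h: "h \<in> cbox 0 (r *\<^sub>R One)" for h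
  proof -
    have "(norm h)\<^sup>2 = (\<Sum>i\<in>Basis. (h \<bullet> i)\<^sup>2)"
      unfolding power2_norm_eq_inner by (subst euclidean_inner) (simp add: power2_eq_square)
    also have "\<dots> \<le> (\<Sum>i\<in>(Basis :: 'a set). r\<^sup>2)"
      using h by (intro sum_mono power_mono) (auto simp: mem_box inner_sum_left_Basis)
    finally have nh: "(norm h)\<^sup>2 \<le> ?d * r\<^sup>2" by simp
    have "(\<integral>x. (g (x + h) - g x)\<^sup>2 \<partial>lborel) \<le> (\<integral>x. (D x \<bullet> h)\<^sup>2 \<partial>lborel)"
      by (rule integral_square_increment_le[of g "\<lambda>x h. D x \<bullet> h", OF der _ supp])
         (auto intro!: continuous_intros cont)
    also have "\<dots> \<le> (\<integral>x. (norm h)\<^sup>2 * (norm (D x))\<^sup>2 \<partial>lborel)"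
    proof (rule integral_mono)
      show "integrable lborel (\<lambda>x. (D x \<bullet> h)\<^sup>2)"
        by (rule integrable_continuous_compact_support[of _ "R + 1"])
           (auto intro!: continuous_intros cont simp: Dz)
      show "integrable lborel (\<lambda>x. (norm h)\<^sup>2 * (norm (D x))\<^sup>2)" using D2 by simp
      have "\<bar>D x \<bullet> h\<bar>\<^sup>2 \<le> (norm (D x) * norm h)\<^sup>2" for x
        using Cauchy_Schwarz_ineq2 by (intro power_mono) auto
      then show "(D x \<bullet> h)\<^sup>2 \<le> (norm h)\<^sup>2 * (norm (D x))\<^sup>2" for x
        by (simp add: power_mult_distrib mult.commute)
    qed
    also have "\<dots> \<le> ?d * r\<^sup>2 * I"
      using nh by (simp add: I_def mult_right_mono)
    finally have inc: "(\<integral>x. (g (x + h) - g x)\<^sup>2 \<partial>lborel) \<le> ?d * r\<^sup>2 * I" .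
    have tr: "(\<integral>x. (g (x + h))\<^sup>2 \<partial>lborel) = S"
      using integral_lborel_translation[of "\<lambda>x. (g x)\<^sup>2" h] by (simp add: S_def)
    have t2: "integrable lborel (\<lambda>x. (g (x + h))\<^sup>2)"
    proof (rule integrable_continuous_compact_support[of _ "R + norm h"])
      show "continuous_on UNIV (\<lambda>x. (g (x + h))\<^sup>2)"
        by (intro continuous_intros gh)
      show "(g (x + h))\<^sup>2 = 0" if "R + norm h \<le> norm x" for x
      proof -
        have "R \<le> norm (x + h)" using that norm_diff_ineq[of x h] by linarith
        then show ?thesis using supp by simp
      qed
    qed
    have "(\<integral>x. (g (x + h) - g x)\<^sup>2 \<partial>lborel)
        = (\<integral>x. (g (x + h))\<^sup>2 + (g x)\<^sup>2 - 2 * (g x * g (x + h)) \<partial>lborel)"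
      by (intro Bochner_Integration.integral_cong refl) (simp add: power2_diff)
    also have "\<dots> = S + S - 2 * (\<integral>x. g x * g (x + h) \<partial>lborel)"
      using g2 t2 corr_int[of h] by (simp add: tr S_def)
    finally show ?thesis using inc by (simp add: a_def)
  qed
  have "r ^ DIM('a) * a \<le> (\<integral>x. g x \<partial>lborel)\<^sup>2"
  proof (cases "0 \<le> a")
    case True
    let ?Q = "cbox 0 (r *\<^sub>R One) :: 'a set"
    have vol: "emeasure lborel ?Q = ennreal (r ^ DIM('a))"
      using \<open>0 < r\<close> by (simp add: emeasure_lborel_cbox_eq inner_sum_left_Basis)
    have "ennreal (r ^ DIM('a) * a) = (\<integral>\<^sup>+h. ennreal a * indicator ?Q h \<partial>lborel)"
      using True \<open>0 < r\<close> by (simp add: nn_integral_cmult_indicator vol ennreal_mult' mult.commute)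
    \<comment> \<open>The average over the cube is enlarged to all shifts \<open>h\<close>, which
      \<open>nonneg\<close> permits; Fubini then factors the double integral into the square of the
      integral of \<open>g\<close>.\<close>
    also have "\<dots> \<le> (\<integral>\<^sup>+h. (\<integral>\<^sup>+x. ennreal (g x * g (x + h)) \<partial>lborel) \<partial>lborel)"
    proof (rule nn_integral_mono)
      fix h
      show "ennreal a * indicator ?Q h \<le> (\<integral>\<^sup>+x. ennreal (g x * g (x + h)) \<partial>lborel)"
      proof (cases "h \<in> ?Q")
        case True
        have "(\<integral>\<^sup>+x. ennreal (g x * g (x + h)) \<partial>lborel) = ennreal (\<integral>x. g x * g (x + h) \<partial>lborel)"
          by (rule nn_integral_eq_integral[OF corr_int]) (simp add: nonneg)
        then show ?thesis using corr[OF True] True by (simp add: ennreal_leI)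
      qed simp
    qed
    also have "\<dots> = (\<integral>\<^sup>+x. (\<integral>\<^sup>+h. ennreal (g x * g (x + h)) \<partial>lborel) \<partial>lborel)"
      by (rule lborel_pair.Fubini') measurable
    also have "\<dots> = (\<integral>\<^sup>+x. ennreal (g x) * ennreal (\<integral>x. g x \<partial>lborel) \<partial>lborel)"
    proof (rule nn_integral_cong)
      fix x
      have "(\<integral>\<^sup>+h. ennreal (g x * g (x + h)) \<partial>lborel) = (\<integral>\<^sup>+h. ennreal (g x) * ennreal (g (x + h)) \<partial>lborel)"
        by (simp add: ennreal_mult' nonneg)
      also have "\<dots> = ennreal (g x) * (\<integral>\<^sup>+h. ennreal (g (x + h)) \<partial>lborel)"
        by (rule nn_integral_cmult) measurable
      also have "(\<integral>\<^sup>+h. ennreal (g (x + h)) \<partial>lborel) = (\<integral>\<^sup>+h. ennreal (g h) \<partial>distr lborel borel ((+) x))"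
        by (subst nn_integral_distr) auto
      also have "\<dots> = (\<integral>\<^sup>+h. ennreal (g h) \<partial>lborel)" by (simp only: lborel_distr_plus)
      also have "\<dots> = ennreal (\<integral>x. g x \<partial>lborel)"
        by (rule nn_integral_eq_integral[OF gi]) (simp add: nonneg)
      finally show "(\<integral>\<^sup>+h. ennreal (g x * g (x + h)) \<partial>lborel) = ennreal (g x) * ennreal (\<integral>x. g x \<partial>lborel)" .
    qed
    also have "\<dots> = (\<integral>\<^sup>+x. ennreal (g x) \<partial>lborel) * ennreal (\<integral>x. g x \<partial>lborel)"
      by (rule nn_integral_multc) measurable
    also have "(\<integral>\<^sup>+x. ennreal (g x) \<partial>lborel) = ennreal (\<integral>x. g x \<partial>lborel)"
      by (rule nn_integral_eq_integral[OF gi]) (simp add: nonneg)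
    also have "ennreal (\<integral>x. g x \<partial>lborel) * ennreal (\<integral>x. g x \<partial>lborel) = ennreal ((\<integral>x. g x \<partial>lborel)\<^sup>2)"
      by (simp add: ennreal_mult' power2_eq_square integral_nonneg_AE nonneg)
    finally show ?thesis by (simp add: ennreal_le_iff)
  next
    case False
    then have "r ^ DIM('a) * a \<le> 0" using \<open>0 < r\<close> by (intro mult_nonneg_nonpos) auto
    then show ?thesis by (meson order_trans zero_le_power2)
  qed
  then have "a \<le> (\<integral>x. g x \<partial>lborel)\<^sup>2 / r ^ DIM('a)"
    using \<open>0 < r\<close> by (simp add: pos_le_divide_eq mult.commute)
  then show ?thesis by (simp add: a_def I_def S_def)
qed

section \<open>Convex cutoffs\<close>

text \<open>A convex truncation that kills values up to \<delta>, carried together with its two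
  derivatives. The sign of \<open>G2\<close> makes the dissipation nonnegative, and
  \<open>G r \<le> r * G1 r\<close> lets the potential term of the subsolution outweigh that of the
  weight in the energy balance.\<close>

definition cutoff :: "real \<Rightarrow> (real \<Rightarrow> real) \<Rightarrow> (real \<Rightarrow> real) \<Rightarrow> (real \<Rightarrow> real) \<Rightarrow> bool" where
  "cutoff \<delta> G G1 G2 \<longleftrightarrow>
     (\<forall>r. (G has_real_derivative G1 r) (at r) \<and> (G1 has_real_derivative G2 r) (at r)) \<and>
     continuous_on UNIV G2 \<and>
     (\<forall>r. 0 \<le> G r \<and> 0 \<le> G1 r \<and> 0 \<le> G2 r \<and> G r \<le> r * G1 r) \<and>
     (\<forall>r\<le>\<delta>. G r = 0 \<and> G1 r = 0 \<and> G2 r = 0)"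

lemma cutoffD:
  assumes "cutoff \<delta> G G1 G2"
  shows "(G has_real_derivative G1 r) (at r)" "(G1 has_real_derivative G2 r) (at r)"
    "continuous_on UNIV G2" "0 \<le> G r" "0 \<le> G1 r" "0 \<le> G2 r" "G r \<le> r * G1 r"
    "r \<le> \<delta> \<Longrightarrow> G r = 0" "r \<le> \<delta> \<Longrightarrow> G1 r = 0" "r \<le> \<delta> \<Longrightarrow> G2 r = 0"
  using assms unfolding cutoff_def by blast+

lemma cutoff_continuous:
  assumes "cutoff \<delta> G G1 G2"
  shows "continuous_on UNIV G" "continuous_on UNIV G1" "continuous_on UNIV G2"
  using cutoffD(1-3)[OF assms] DERIV_continuous_on by blast+

text \<open>Repeated squaring produces the powers 2^j. The summand \<open>2 * (G1 r)\<^sup>2\<close>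
  of the new second derivative is the useful one: multiplied by |grad w|^2 it is twice the squared
  gradient of G(w), as required by Nash's inequality.\<close>

lemma cutoff_square:
  assumes "cutoff \<delta> G G1 G2"
  shows "cutoff \<delta> (\<lambda>r. (G r)\<^sup>2) (\<lambda>r. 2 * G r * G1 r) (\<lambda>r. 2 * (G1 r)\<^sup>2 + 2 * G r * G2 r)"
proof -
  note D = cutoffD[OF assms] and C[continuous_intros] = cutoff_continuous[OF assms]
  have "(G r)\<^sup>2 \<le> r * (2 * G r * G1 r)" for r
  proof -
    have "G r * G r \<le> G r * (r * G1 r)" using D(4,7) by (intro mult_left_mono) auto
    moreover have "0 \<le> r * G1 r" using D(4,7)[of r] by linarith
    with D(4) have "0 \<le> G r * (r * G1 r)" by (rule mult_nonneg_nonneg)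
    ultimately show ?thesis by (simp add: power2_eq_square mult_ac)
  qed
  then show ?thesis
    unfolding cutoff_def using D
    by (auto intro!: derivative_eq_intros continuous_intros simp: power2_eq_square algebra_simps)
qed

lemma DERIV_zero_extension:
  assumes "\<And>r. d \<le> r \<Longrightarrow> (g has_real_derivative g' r) (at r)" "g d = 0" "g' d = 0"
  shows "((\<lambda>r. if r \<le> d then 0 else g r) has_real_derivative (if r \<le> d then 0 else g' r)) (at r)"
proof -
  have "((\<lambda>r. if r \<in> {..d} then 0 else g r) has_vector_derivative (if r \<in> {..d} then 0 else g' r))
      (at r within UNIV)"
  proof (rule has_vector_derivative_If_within_closures[where S = "{..d}" and T = "{d..}"])
    show "(g has_vector_derivative g' r) (at r within {d..} \<union> closure {..d} \<inter> closure {d..})"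
      if "r \<in> {d..} \<union> closure {..d} \<inter> closure {d..}"
      using assms(1)[of r] that
      by (auto intro!: has_vector_derivative_at_within has_field_derivative_at_within simp flip: has_real_derivative_iff_has_vector_derivative)
  qed (use assms in \<open>auto simp: closure_closed dest!: antisym\<close>)
  then show ?thesis by (simp add: has_real_derivative_iff_has_vector_derivative)
qed

text \<open>The triple zero at \<delta> gives C^2 gluing. Expanding, (r - \<delta>)^3 / r^2 = r - 3
  \<delta> + 3 \<delta>^2 / r - \<delta>^3 / r^2, so the function is squeezed between r - 3 \<delta>
  and the positive part of r, which it approximates as \<delta> tends to 0.\<close>

definition cubic_cutoff :: "real \<Rightarrow> real \<Rightarrow> real" where
  "cubic_cutoff \<delta> r = (if r \<le> \<delta> then 0 else (r - \<delta>) ^ 3 / r\<^sup>2)"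

lemma cutoff_cubic:
  assumes "0 < \<delta>"
  shows "cutoff \<delta> (cubic_cutoff \<delta>) (\<lambda>r. if r \<le> \<delta> then 0 else (r - \<delta>)\<^sup>2 * (r + 2 * \<delta>) / r ^ 3)
    (\<lambda>r. if r \<le> \<delta> then 0 else 6 * \<delta>\<^sup>2 * (r - \<delta>) / r ^ 4)"
proof -
  have 1: "((\<lambda>r. (r - \<delta>) ^ 3 / r\<^sup>2) has_real_derivative (r - \<delta>)\<^sup>2 * (r + 2 * \<delta>) / r ^ 3) (at r)"
    if "\<delta> \<le> r" for r
    using that assms
    by (auto intro!: derivative_eq_intros simp: divide_simps) algebra
  have 2: "((\<lambda>r. (r - \<delta>)\<^sup>2 * (r + 2 * \<delta>) / r ^ 3) has_real_derivative 6 * \<delta>\<^sup>2 * (r - \<delta>) / r ^ 4) (at r)"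
    if "\<delta> \<le> r" for r
    using that assms
    by (auto intro!: derivative_eq_intros simp: divide_simps) algebra
  have 3: "continuous_on UNIV (\<lambda>r. if r \<le> \<delta> then 0 else 6 * \<delta>\<^sup>2 * (r - \<delta>) / r ^ 4)"
  proof -
    have "continuous_on ({..\<delta>} \<union> {\<delta>..}) (\<lambda>r. if r \<le> \<delta> then 0 else 6 * \<delta>\<^sup>2 * (r - \<delta>) / r ^ 4)"
      using assms by (intro continuous_on_cases) (auto intro!: continuous_intros)
    moreover have "{..\<delta>} \<union> {\<delta>..} = UNIV" by auto
    ultimately show ?thesis by simp
  qed
  have 4: "(r - \<delta>) ^ 3 / r\<^sup>2 \<le> r * ((r - \<delta>)\<^sup>2 * (r + 2 * \<delta>) / r ^ 3)" if "\<delta> < r" for r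
  proof -
    have "(r - \<delta>) ^ 3 \<le> (r - \<delta>)\<^sup>2 * (r + 2 * \<delta>)"
      using that assms unfolding power3_eq_cube power2_eq_square
      by (intro mult_left_mono) (auto intro!: mult_nonneg_nonneg)
    then have "(r - \<delta>) ^ 3 / r\<^sup>2 \<le> (r - \<delta>)\<^sup>2 * (r + 2 * \<delta>) / r\<^sup>2"
      by (intro divide_right_mono) auto
    also have "\<dots> = r * ((r - \<delta>)\<^sup>2 * (r + 2 * \<delta>) / r ^ 3)"
      using that assms by (simp add: power2_eq_square power3_eq_cube)
    finally show ?thesis .
  qed
  show ?thesis
    unfolding cutoff_def cubic_cutoff_def
    using DERIV_zero_extension[of \<delta>, OF 1] DERIV_zero_extension[of \<delta>, OF 2] 3 4 assms by auto
qed

lemma cubic_cutoff_bounds: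
  assumes "0 < \<delta>"
  shows "cubic_cutoff \<delta> r \<le> max 0 r" "r - 3 * \<delta> \<le> cubic_cutoff \<delta> r"
proof -
  show "cubic_cutoff \<delta> r \<le> max 0 r"
  proof (cases "r \<le> \<delta>")
    case False
    then have "(r - \<delta>) ^ 3 \<le> r ^ 3" using assms by (intro power_mono) auto
    then show ?thesis using False assms
      by (auto simp: cubic_cutoff_def divide_simps power2_eq_square power3_eq_cube)
  qed (auto simp: cubic_cutoff_def)
  show "r - 3 * \<delta> \<le> cubic_cutoff \<delta> r"
  proof (cases "r \<le> \<delta>")
    case False
    have "\<delta> ^ 3 \<le> \<delta>\<^sup>2 * (3 * r)" using False assms
      unfolding power3_eq_cube power2_eq_square by (intro mult_left_mono) auto
    then have "(r - 3 * \<delta>) * r\<^sup>2 \<le> (r - \<delta>) ^ 3"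
      by (simp add: algebra_simps power2_eq_square power3_eq_cube)
    then show ?thesis using False assms by (auto simp: cubic_cutoff_def pos_le_divide_eq)
  qed (use assms in \<open>auto simp: cubic_cutoff_def\<close>)
qed

section \<open>Energy estimates\<close>

text \<open>\<open>C12_on\<close> fixes the time set to all t > 0, whereas the weights live on
  shifted or reversed bounded intervals.\<close>

definition C12_in :: "real set \<Rightarrow> (real^'n) set \<Rightarrow> (real \<Rightarrow> real^'n \<Rightarrow> real) \<Rightarrow> bool" where
  "C12_in T U u \<longleftrightarrow>
     (\<forall>t\<in>T. \<forall>x\<in>U. (\<lambda>s. u s x) differentiable (at t) \<and>
        u t differentiable (at x) \<and> grad (u t) differentiable (at x)) \<and>
     continuous_on (T \<times> U) (\<lambda>(t, x). u t x) \<and>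
     continuous_on (T \<times> U) (\<lambda>(t, x). deriv (\<lambda>s. u s x) t) \<and>
     continuous_on (T \<times> U) (\<lambda>(t, x). grad (u t) x) \<and>
     continuous_on (T \<times> U) (\<lambda>(t, x). hessian (u t) x)"

lemma C12_on_eq: "C12_on U u \<longleftrightarrow> C12_in {0<..} U u"
  by (simp add: C12_on_def C12_in_def Ball_def)

lemma C12_in_subset: "C12_in T U u \<Longrightarrow> T' \<subseteq> T \<Longrightarrow> U' \<subseteq> U \<Longrightarrow> C12_in T' U' u"
  unfolding C12_in_def by (meson Sigma_mono continuous_on_subset subsetD)

lemma C12_inD:
  assumes "C12_in T U u" "t \<in> T" "x \<in> U"
  shows "((\<lambda>s. u s x) has_real_derivative deriv (\<lambda>s. u s x) t) (at t)"
    "u t differentiable (at x)" "grad (u t) differentiable (at x)"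
  using assms unfolding C12_in_def by (auto simp: DERIV_deriv_iff_real_differentiable)

lemma C12_in_continuous:
  assumes "C12_in T U u"
  shows "continuous_on (T \<times> U) (\<lambda>p. u (fst p) (snd p))"
    "continuous_on (T \<times> U) (\<lambda>p. deriv (\<lambda>s. u s (snd p)) (fst p))"
    "continuous_on (T \<times> U) (\<lambda>p. grad (u (fst p)) (snd p))"
    "continuous_on (T \<times> U) (\<lambda>p. hessian (u (fst p)) (snd p))"
  using assms unfolding C12_in_def case_prod_unfold by auto

lemma continuous_on_slice:
  assumes "continuous_on (T \<times> U) (\<lambda>p. f (fst p) (snd p))" "t \<in> T"
  shows "continuous_on U (f t)"
proof -
  have "continuous_on U (\<lambda>x. (\<lambda>p. f (fst p) (snd p)) (t, x))"
    using assms(2) by (intro continuous_on_compose2[OF assms(1)]) (auto intro!: continuous_intros)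
  then show ?thesis by simp
qed

lemma C12_in_slice:
  assumes "C12_in T U u" "t \<in> T"
  shows "C2_on U (u t)"
  using C12_inD[OF assms] continuous_on_slice[OF C12_in_continuous(4)[OF assms(1)] assms(2)]
  by (auto simp: C2_on_def)

text \<open>The diffusion matrix is q times the identity. The bound \<open>1 \<le> q x\<close> lets
  the weighted Dirichlet integral control the plain one in Nash's inequality. The specific growth of
  q and V is left to the supersolution, so the kernel bound can be proved at this level of
  generality.\<close>

locale diffusion =
  fixes q V :: "real^'n \<Rightarrow> real"
  assumes q_diff: "q differentiable (at x)" and grad_q: "continuous_on UNIV (grad q)"
    and q_ge_1: "1 \<le> q x" and V_cont: "continuous_on UNIV V" and V_nonneg: "0 \<le> V x"
begin

definition flux :: "(real^'n \<Rightarrow> real) \<Rightarrow> real^'n \<Rightarrow> real^'n" where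
  "flux f x = q x *\<^sub>R grad f x"

definition op :: "(real^'n \<Rightarrow> real) \<Rightarrow> real^'n \<Rightarrow> real" where
  "op f x = divergence (flux f) x - V x * f x"

lemma q_cont: "continuous_on S q"
  using q_diff differentiable_imp_continuous_within continuous_at_imp_continuous_on by blast

lemma flux_differentiable: "grad f differentiable (at x) \<Longrightarrow> flux f differentiable (at x)"
  unfolding flux_def[abs_def] using has_derivative_scaleR_grad[OF q_diff] differentiable_def by blast

lemma divergence_flux:
  assumes "grad f differentiable (at x)"
  shows "divergence (flux f) x = q x * (\<Sum>i\<in>UNIV. hessian f x $ i $ i) + grad q x \<bullet> grad f x"
  unfolding flux_def[abs_def] using divergence_scaleR[OF q_diff assms]
  by (simp add: hessian_def divergence_jacobian)

text \<open>The two products each contribute the mixed term q G'(w) grad w . grad \<psi>, with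
  opposite signs; its cancellation expresses the formal self-adjointness of the operator.\<close>

lemma divergence_energy_field:
  assumes cut: "cutoff \<delta> G G1 G2"
    and "w differentiable (at x)" "grad w differentiable (at x)"
    and "\<psi> differentiable (at x)" "grad \<psi> differentiable (at x)"
  shows "divergence (\<lambda>z. (\<psi> z * G1 (w z)) *\<^sub>R flux w z - G (w z) *\<^sub>R flux \<psi> z) x
    = \<psi> x * G1 (w x) * divergence (flux w) x + q x * \<psi> x * G2 (w x) * (norm (grad w x))\<^sup>2
      - G (w x) * divergence (flux \<psi>) x"
proof -
  note D = cutoffD[OF cut]
  note f = flux_differentiable[OF assms(3)] flux_differentiable[OF assms(5)]
  note g = grad_scale_comp[OF assms(2) D(1)] grad_scale_comp[OF assms(2) D(2)]
  have m: "(\<lambda>z. \<psi> z * G1 (w z)) differentiable (at x)"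
    using assms(4) g(3) by (rule differentiable_mult)
  have d: "(\<lambda>z. (\<psi> z * G1 (w z)) *\<^sub>R flux w z) differentiable (at x)"
     "(\<lambda>z. G (w z) *\<^sub>R flux \<psi> z) differentiable (at x)"
    using has_derivative_scaleR_grad[OF m f(1)] has_derivative_scaleR_grad[OF g(1) f(2)]
    by (auto simp: differentiable_def)
  show ?thesis
    unfolding divergence_diff[OF d] divergence_scaleR[OF m f(1)] divergence_scaleR[OF g(1) f(2)]
      grad_mult[OF assms(4) g(3)] g(2,4)
    by (simp add: flux_def[of _ x] inner_add_left power2_norm_eq_inner algebra_simps inner_commute[of "grad \<psi> x"])
qed

text \<open>Near the sphere w is at most \<delta>, where both G and its derivative vanish, so the
  field of \<open>divergence_energy_field\<close> has compact support whatever \<psi> does at the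
  boundary.\<close>

lemma green_identity:
  assumes cut: "cutoff \<delta> G G1 G2" and w: "C2_on (ball 0 n) w" and \<psi>: "C2_on (ball 0 n) \<psi>"
    and z: "\<And>x. x \<in> ball 0 n \<Longrightarrow> \<rho> \<le> norm x \<Longrightarrow> w x \<le> \<delta>" and "\<rho> < n"
  defines "E \<equiv> \<lambda>x. if x \<in> ball 0 n then \<psi> x * G1 (w x) * divergence (flux w) x
      + q x * \<psi> x * G2 (w x) * (norm (grad w x))\<^sup>2 - G (w x) * divergence (flux \<psi>) x else 0"
  shows "integrable lborel E" "(\<integral>x. E x \<partial>lborel) = 0"
proof -
  note D = cutoffD[OF cut]
  let ?B = "ball 0 n :: (real^'n) set"
  let ?F = "\<lambda>z. (\<psi> z * G1 (w z)) *\<^sub>R flux w z - G (w z) *\<^sub>R flux \<psi> z"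
  have dw: "x \<in> ?B \<Longrightarrow> w differentiable (at x)" "x \<in> ?B \<Longrightarrow> grad w differentiable (at x)" for x
    using w by (auto simp: C2_on_def)
  have d\<psi>: "x \<in> ?B \<Longrightarrow> \<psi> differentiable (at x)" "x \<in> ?B \<Longrightarrow> grad \<psi> differentiable (at x)" for x
    using \<psi> by (auto simp: C2_on_def)
  have cd: "continuous_on ?B f" if "\<And>x. x \<in> ?B \<Longrightarrow> f differentiable (at x)"
    for f :: "real^'n \<Rightarrow> 'b::real_normed_vector"
    using that differentiable_imp_continuous_within continuous_at_imp_continuous_on by blast
  have cg: "continuous_on ?B w" "continuous_on ?B (grad w)" "continuous_on ?B \<psi>" "continuous_on ?B (grad \<psi>)"
    using cd dw d\<psi> cd by auto
  have cw: "continuous_on ?B (\<lambda>x. G (w x))" "continuous_on ?B (\<lambda>x. G1 (w x))" "continuous_on ?B (\<lambda>x. G2 (w x))"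
    using cutoff_continuous[OF cut] cg(1) continuous_on_compose2 by blast+
  have jf: "continuous_on ?B (\<lambda>x. jacobian (flux f) (at x))" if "C2_on ?B f" for f
    unfolding flux_def[abs_def]
    using that grad_q by (intro continuous_on_jacobian_scaleR q_diff)
      (auto simp: C2_on_def hessian_def intro: continuous_on_subset)
  note gs = grad_scale_comp[OF dw(1) D(1)] grad_scale_comp[OF dw(1) D(2)]
  have m: "(\<lambda>z. \<psi> z * G1 (w z)) differentiable (at x)" if "x \<in> ?B" for x
    using d\<psi>(1)[OF that] gs(3)[OF that] by (rule differentiable_mult)
  have df: "flux w differentiable (at x)" "flux \<psi> differentiable (at x)" if "x \<in> ?B" for x
    using flux_differentiable dw(2)[OF that] d\<psi>(2)[OF that] by auto
  have d1: "(\<lambda>z. (\<psi> z * G1 (w z)) *\<^sub>R flux w z) differentiable (at x)" if "x \<in> ?B" for x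
    using has_derivative_scaleR_grad[OF m[OF that] df(1)[OF that]] by (auto simp: differentiable_def)
  have d2: "(\<lambda>z. G (w z) *\<^sub>R flux \<psi> z) differentiable (at x)" if "x \<in> ?B" for x
    using has_derivative_scaleR_grad[OF gs(1)[OF that] df(2)[OF that]] by (auto simp: differentiable_def)
  have j1: "continuous_on ?B (\<lambda>x. jacobian (\<lambda>z. (\<psi> z * G1 (w z)) *\<^sub>R flux w z) (at x))"
  proof (rule continuous_on_jacobian_scaleR[OF m df(1) _ jf[OF w]])
    have "continuous_on ?B (\<lambda>x. \<psi> x *\<^sub>R (G2 (w x) *\<^sub>R grad w x) + G1 (w x) *\<^sub>R grad \<psi> x)"
      by (intro continuous_intros cg cw)
    then show "continuous_on ?B (grad (\<lambda>z. \<psi> z * G1 (w z)))"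
      by (rule continuous_on_eq) (simp add: grad_mult[OF d\<psi>(1) gs(3)] gs(4))
  qed auto
  have j2: "continuous_on ?B (\<lambda>x. jacobian (\<lambda>z. G (w z) *\<^sub>R flux \<psi> z) (at x))"
  proof (rule continuous_on_jacobian_scaleR[OF gs(1) df(2) _ jf[OF \<psi>]])
    have "continuous_on ?B (\<lambda>x. G1 (w x) *\<^sub>R grad w x)"
      by (intro continuous_intros cg cw)
    then show "continuous_on ?B (grad (\<lambda>z. G (w z)))"
      by (rule continuous_on_eq) (simp add: gs(2))
  qed auto
  have dF: "?F differentiable (at x)" if "x \<in> ?B" for x
    using differentiable_diff[OF d1[OF that] d2[OF that]] .
  have jF: "continuous_on ?B (\<lambda>x. jacobian ?F (at x))"
    by (rule continuous_on_eq[OF continuous_on_diff[OF j1 j2]]) (simp add: jacobian_diff d1 d2)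
  have zF: "?F x = 0" if "x \<in> ?B" "\<rho> \<le> norm x" for x
    using D(8,9)[OF z[OF that]] by simp
  have E: "E = (\<lambda>x. if x \<in> ?B then divergence ?F x else 0)"
    unfolding E_def using divergence_energy_field[OF cut dw(1,2) d\<psi>(1,2)] by auto
  show "integrable lborel E" "(\<integral>x. E x \<partial>lborel) = 0"
    unfolding E using integral_divergence_zero[of n ?F \<rho>, OF dF jF zF \<open>\<rho> < n\<close>] by blast+
qed

text \<open>Differentiating under the integral leaves G'(w) w_t \<psi> + G(w) \<psi>_t. The
  subsolution inequality for w and the backward supersolution inequality for \<psi> replace the time
  derivatives by the operator; Green's identity then removes the divergences and leaves minus the
  dissipation, while the potential terms have the good sign.\<close>

lemma energy_derivative:
  assumes cut: "cutoff \<delta> G G1 G2"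
    and w: "C12_in {a<..<b} (ball 0 n) w" and \<psi>: "C12_in {a<..<b} (ball 0 n) \<psi>"
    and sub: "\<And>t x. t \<in> {a<..<b} \<Longrightarrow> x \<in> ball 0 n \<Longrightarrow> deriv (\<lambda>s. w s x) t \<le> op (w t) x"
    and sup: "\<And>t x. t \<in> {a<..<b} \<Longrightarrow> x \<in> ball 0 n \<Longrightarrow> deriv (\<lambda>s. \<psi> s x) t + op (\<psi> t) x \<le> 0"
    and nonneg: "\<And>t x. t \<in> {a<..<b} \<Longrightarrow> x \<in> ball 0 n \<Longrightarrow> 0 \<le> \<psi> t x"
    and bdry: "\<And>t1 t2. a < t1 \<Longrightarrow> t1 \<le> t2 \<Longrightarrow> t2 < b \<Longrightarrow>
      \<exists>\<rho><n. \<forall>t\<in>{t1..t2}. \<forall>x\<in>ball 0 n. \<rho> \<le> norm x \<longrightarrow> w t x \<le> \<delta>"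
    and t: "t \<in> {a<..<b}"
  obtains D where
    "((\<lambda>s. \<integral>x. (if x \<in> ball 0 n then G (w s x) * \<psi> s x else 0) \<partial>lborel) has_real_derivative D) (at t)"
    "D \<le> - (\<integral>x. (if x \<in> ball 0 n then q x * \<psi> t x * G2 (w t x) * (norm (grad (w t) x))\<^sup>2 else 0) \<partial>lborel)"
proof -
  note D = cutoffD[OF cut]
  \<comment> \<open>A compact time interval around \<open>t\<close>: on it a single \<rho> serves
    all times, so the extended integrand is jointly continuous as the Leibniz rule requires.\<close>
  define t1 where "t1 = (a + t) / 2"
  define t2 where "t2 = (t + b) / 2"
  have T: "a < t1" "t1 < t" "t < t2" "t2 < b" using t by (auto simp: t1_def t2_def)
  let ?I = "{t1..t2}" and ?B = "ball 0 n :: (real^'n) set"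
  obtain \<rho> where \<rho>: "\<rho> < n" and z: "\<And>s x. s \<in> ?I \<Longrightarrow> x \<in> ?B \<Longrightarrow> \<rho> \<le> norm x \<Longrightarrow> w s x \<le> \<delta>"
    using bdry[of t1 t2] T by force
  have sub': "?I \<subseteq> {a<..<b}" and tI: "t \<in> ?I" using T by auto
  note w' = C12_in_subset[OF w sub' subset_refl] and \<psi>' = C12_in_subset[OF \<psi> sub' subset_refl]
  define f where "f = (\<lambda>s x. if x \<in> ?B then G (w s x) * \<psi> s x else 0)"
  define fx where "fx = (\<lambda>s x. if x \<in> ?B then
    G1 (w s x) * deriv (\<lambda>s. w s x) s * \<psi> s x + G (w s x) * deriv (\<lambda>s. \<psi> s x) s else 0)"
  define P where "P = (\<lambda>x. if x \<in> ?B then q x * \<psi> t x * G2 (w t x) * (norm (grad (w t) x))\<^sup>2 else 0)"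
  have cG: "continuous_on (?I \<times> ?B) (\<lambda>p. H (w (fst p) (snd p)))" if "continuous_on UNIV H" for H :: "real \<Rightarrow> real"
    by (rule continuous_on_compose2[OF that C12_in_continuous(1)[OF w']]) auto
  note ci = cG[OF cutoff_continuous(1)[OF cut]] cG[OF cutoff_continuous(2)[OF cut]]
    cG[OF cutoff_continuous(3)[OF cut]] C12_in_continuous[OF w'] C12_in_continuous[OF \<psi>']
  have "continuous_on (?I \<times> UNIV) (\<lambda>p. if snd p \<in> ?B then G (w (fst p) (snd p)) * \<psi> (fst p) (snd p) else 0)"
    by (rule continuous_on_zero_extension[OF _ \<rho>], intro continuous_intros ci) (simp add: D z)
  then have cf: "continuous_on (?I \<times> UNIV) (\<lambda>p. f (fst p) (snd p))"
    unfolding f_def .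
  have "continuous_on (?I \<times> UNIV) (\<lambda>p. if snd p \<in> ?B then
      G1 (w (fst p) (snd p)) * deriv (\<lambda>s. w s (snd p)) (fst p) * \<psi> (fst p) (snd p)
      + G (w (fst p) (snd p)) * deriv (\<lambda>s. \<psi> s (snd p)) (fst p) else 0)"
    by (rule continuous_on_zero_extension[OF _ \<rho>], intro continuous_intros ci) (simp add: D z)
  then have cfx: "continuous_on (?I \<times> UNIV) (\<lambda>p. fx (fst p) (snd p))"
    unfolding fx_def .
  \<comment> \<open>The Leibniz rule is stated for boxes; the integrands vanish outside the ball, so
    integrating over a box that contains it changes nothing.\<close>
  obtain c :: "real^'n" where c: "?B \<subseteq> cbox (-c) c"
    using bounded_subset_cbox_symmetric[OF bounded_ball] by blast
  have int: "integrable lborel g" "(\<integral>x. g x \<partial>lborel) = integral (cbox (-c) c) g"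
    if "continuous_on UNIV g" "\<And>x. x \<notin> ?B \<Longrightarrow> g x = 0" for g :: "real^'n \<Rightarrow> real"
  proof -
    show i: "integrable lborel g"
      by (rule integrable_continuous_compact_support[OF that(1), of n]) (simp add: that(2))
    have "g = (\<lambda>x. if x \<in> cbox (-c) c then g x else 0)"
    proof
      show "g x = (if x \<in> cbox (-c) c then g x else 0)" for x
        using that(2)[of x] c by (cases "x \<in> ?B") auto
    qed
    then show "(\<integral>x. g x \<partial>lborel) = integral (cbox (-c) c) g"
      using integral_lborel[OF i] by (metis integral_restrict_UNIV)
  qed
  have fs: "continuous_on UNIV (f s)" "continuous_on UNIV (fx s)" if "s \<in> ?I" for s
    using continuous_on_slice[OF cf that] continuous_on_slice[OF cfx that] by auto
  have f0: "f s x = 0" "fx s x = 0" if "x \<notin> ?B" for s x using that by (auto simp: f_def fx_def)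
  have der: "((\<lambda>s. f s x) has_real_derivative fx s x) (at s within ?I)" if "s \<in> ?I" for s x
  proof (cases "x \<in> ?B")
    case True
    note d = C12_inD(1)[OF w' that True] C12_inD(1)[OF \<psi>' that True]
    have "((\<lambda>s. G (w s x)) has_real_derivative G1 (w s x) * deriv (\<lambda>s. w s x) s) (at s)"
      using DERIV_chain2[OF D(1) d(1)] .
    from DERIV_mult[OF this d(2)] True show ?thesis
      by (simp add: f_def fx_def has_field_derivative_at_within algebra_simps)
  qed (simp add: f_def fx_def)
  have "((\<lambda>s. integral (cbox (-c) c) (f s)) has_real_derivative integral (cbox (-c) c) (fx t)) (at t within ?I)"
  proof (rule leibniz_rule_field_derivative)
    show "\<And>s. s \<in> ?I \<Longrightarrow> f s integrable_on cbox (-c) c"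
      using fs(1) integrable_continuous continuous_on_subset by blast
    have "continuous_on (?I \<times> cbox (-c) c) (\<lambda>p. fx (fst p) (snd p))"
      by (rule continuous_on_subset[OF cfx]) auto
    then show "continuous_on (?I \<times> cbox (-c) c) (\<lambda>(x, t). fx x t)" by (simp add: case_prod_unfold)
  qed (use der tI in auto)
  moreover have "at t within ?I = at t" using T by (intro at_within_interior) auto
  ultimately have 1: "((\<lambda>s. integral (cbox (-c) c) (f s)) has_real_derivative integral (cbox (-c) c) (fx t)) (at t)"
    by simp
  have 2: "((\<lambda>s. \<integral>x. f s x \<partial>lborel) has_real_derivative (\<integral>x. fx t x \<partial>lborel)) (at t)"
  proof (rule has_field_derivative_transform_within_open)
    have "(\<integral>x. fx t x \<partial>lborel) = integral (cbox (-c) c) (fx t)" by (intro int(2) fs(2) tI f0(2))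
    with 1 show "((\<lambda>s. integral (cbox (-c) c) (f s)) has_real_derivative (\<integral>x. fx t x \<partial>lborel)) (at t)" by simp
    show "open {t1<..<t2}" "t \<in> {t1<..<t2}" using T by auto
    show "integral (cbox (-c) c) (f s) = (\<integral>x. f s x \<partial>lborel)" if "s \<in> {t1<..<t2}" for s
      using that by (intro int(2)[symmetric] fs f0) auto
  qed
  let ?E = "\<lambda>x. if x \<in> ?B then \<psi> t x * G1 (w t x) * divergence (flux (w t)) x
      + q x * \<psi> t x * G2 (w t x) * (norm (grad (w t) x))\<^sup>2 - G (w t x) * divergence (flux (\<psi> t)) x else 0"
  note E = green_identity[OF cut C12_in_slice[OF w t] C12_in_slice[OF \<psi> t] z[OF tI] \<rho>]
  have E1: "integrable lborel ?E" by (rule E(1))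
  have E2: "(\<integral>x. ?E x \<partial>lborel) = 0" by (rule E(2))
  have cP: "continuous_on UNIV P" unfolding P_def
  proof (rule continuous_on_zero_extension_space[OF _ \<rho>])
    show "continuous_on ?B (\<lambda>x. q x * \<psi> t x * G2 (w t x) * (norm (grad (w t) x))\<^sup>2)"
      using ci(4,6)[THEN continuous_on_slice[OF _ tI]] ci(8)[THEN continuous_on_slice[OF _ tI]]
        continuous_on_slice[OF ci(3) tI]
      by (intro continuous_intros q_cont) auto
    show "q x * \<psi> t x * G2 (w t x) * (norm (grad (w t) x))\<^sup>2 = 0" if "x \<in> ?B" "\<rho> \<le> norm x" for x
      using D(10)[OF z[OF tI that]] by simp
  qed
  have iP: "integrable lborel P" by (rule int(1)[OF cP]) (simp add: P_def)
  have "(\<integral>x. fx t x \<partial>lborel) \<le> (\<integral>x. ?E x - P x \<partial>lborel)"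
  proof (rule integral_mono)
    show "integrable lborel (fx t)" by (rule int(1)[OF fs(2)[OF tI] f0(2)])
    show "integrable lborel (\<lambda>x. ?E x - P x)" using E1 iP by (rule Bochner_Integration.integrable_diff)
    show "fx t x \<le> ?E x - P x" for x
    proof (cases "x \<in> ?B")
      case True
      let ?w = "w t x" and ?p = "\<psi> t x"
      have "(G1 ?w * ?p) * deriv (\<lambda>s. w s x) t \<le> (G1 ?w * ?p) * op (w t) x"
        using sub[OF t True] D(5) nonneg[OF t True] by (intro mult_left_mono) auto
      moreover have "G ?w * deriv (\<lambda>s. \<psi> s x) t \<le> G ?w * (- op (\<psi> t) x)"
        using sup[OF t True] D(4) by (intro mult_left_mono) auto
      \<comment> \<open>What remains of the potential is V \<psi> (G(w) - w G'(w)), nonpositive by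
        the last inequality in \<open>cutoff\<close>.\<close>
      moreover have "(V x * ?p) * G ?w \<le> (V x * ?p) * (?w * G1 ?w)"
        using V_nonneg D(7) nonneg[OF t True] by (intro mult_left_mono) auto
      ultimately show ?thesis using True unfolding fx_def P_def op_def by (simp add: algebra_simps)
    qed (simp add: fx_def P_def)
  qed
  also have "\<dots> = - (\<integral>x. P x \<partial>lborel)" unfolding Bochner_Integration.integral_diff[OF E1 iP] E2 by simp
  finally show ?thesis using that 2 unfolding f_def P_def by blast
qed

end

section \<open>From \<open>L\<^sup>1\<close> to \<open>L\<^sup>\<infinity>\<close>\<close>

text \<open>Optimising the free length \<open>r\<close> turns the family of inequalities into -E' >=
  const * E^(1 + 2/d). Then E^(-2/d) grows at least linearly, and inverting this bounds
  \<open>E t1\<close> in terms of \<open>M\<close> and the elapsed time only.\<close>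

lemma nash_ode:
  fixes E E' :: "real \<Rightarrow> real" and d :: nat
  assumes "t0 < t1" "0 < d" "0 < M"
    and der: "\<And>t. t \<in> {t0..t1} \<Longrightarrow> (E has_real_derivative E' t) (at t)"
    and E0: "\<And>t. t \<in> {t0..t1} \<Longrightarrow> 0 \<le> E t" and E'0: "\<And>t. t \<in> {t0..t1} \<Longrightarrow> E' t \<le> 0"
    and nash: "\<And>t (r::real). t \<in> {t0..t1} \<Longrightarrow> 0 < r \<Longrightarrow> E t \<le> d * r\<^sup>2 / 4 * (- E' t) + M\<^sup>2 / r ^ d"
  shows "E t1 \<le> 2 * (d\<^sup>2 / (4 * (t1 - t0))) powr (d / 2) * M\<^sup>2"
proof (cases "E t1 = 0")
  case False
  \<comment> \<open>The guaranteed growth rate of E^(-2/d): one factor 2/d comes from the chain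
    rule, the other from -E' >= 2 E / (d r^2) with the \<open>r\<close> chosen below.\<close>
  define c where "c = 4 / d\<^sup>2 * (2 * M\<^sup>2) powr (- 2 / d)"
  have mono: "E t1 \<le> E t" if "t \<in> {t0..t1}" for t
    by (rule DERIV_nonpos_imp_nonincreasing[where f = E]) (use that der E'0 in force)+
  have pos: "0 < E t" if "t \<in> {t0..t1}" for t
    using mono[OF that] False E0[of t1] \<open>t0 < t1\<close> by auto
  have key: "c \<le> - (2 / d) * E t powr (- 2 / d - 1) * E' t" if t: "t \<in> {t0..t1}" for t
  proof -
    \<comment> \<open>This \<open>r\<close> satisfies r^d = 2 M^2 / E, which makes the last term of
      the Nash inequality exactly half of E, to be absorbed on the left.\<close>
    define r where "r = (2 * M\<^sup>2 / E t) powr (1 / d)"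
    have r: "0 < r" using pos[OF t] \<open>0 < M\<close> by (simp add: r_def)
    have X: "0 < 2 * M\<^sup>2 / E t" using pos[OF t] \<open>0 < M\<close> by simp
    have "r ^ d = r powr d" by (rule powr_realpow[OF r, symmetric])
    also have "\<dots> = (2 * M\<^sup>2 / E t) powr (1 / d * d)" unfolding r_def by (rule powr_powr)
    also have "\<dots> = 2 * M\<^sup>2 / E t" using X pos[OF t] \<open>0 < d\<close> by simp
    finally have "r ^ d = 2 * M\<^sup>2 / E t" .
    then have "M\<^sup>2 / r ^ d = E t / 2" using \<open>0 < M\<close> by (simp only:) simp
    then have "E t / 2 \<le> d * r\<^sup>2 / 4 * (- E' t)" using nash[OF t r] by linarith
    then have "2 * E t / (d * r\<^sup>2) \<le> - E' t" using r \<open>0 < d\<close> by (simp add: field_simps)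
    moreover have "r\<^sup>2 = (2 * M\<^sup>2) powr (2 / d) * E t powr (- 2 / d)"
    proof -
      have "r\<^sup>2 = r powr 2" using r by (rule powr_numeral[symmetric, OF less_imp_le])
      also have "\<dots> = (2 * M\<^sup>2 / E t) powr (1 / d * 2)" unfolding r_def by (rule powr_powr)
      also have "1 / real d * 2 = 2 / d" by simp
      also have "(2 * M\<^sup>2 / E t) powr (2 / d) = (2 * M\<^sup>2) powr (2 / d) / E t powr (2 / d)"
        by (rule powr_divide)
      also have "\<dots> = (2 * M\<^sup>2) powr (2 / d) * E t powr (- (2 / d))"
        by (simp only: powr_minus divide_inverse)
      finally show ?thesis by simp
    qed
    ultimately have *: "2 * E t / (d * ((2 * M\<^sup>2) powr (2 / d) * E t powr (- 2 / d))) \<le> - E' t" by simp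
    have p: "x powr (- 2 / d) = 1 / x powr (2 / d)" for x :: real
      using powr_minus_divide[of x "2 / d"] by simp
    have "c = (2 / d) * (1 / E t powr (2 / d) / E t) * (2 * E t / (d * ((2 * M\<^sup>2) powr (2 / d) * (1 / E t powr (2 / d)))))"
      unfolding c_def p using pos[OF t] \<open>0 < M\<close> \<open>0 < d\<close> by (simp add: power2_eq_square)
    also have "\<dots> = (2 / d) * E t powr (- 2 / d - 1) * (2 * E t / (d * ((2 * M\<^sup>2) powr (2 / d) * E t powr (- 2 / d))))"
      unfolding p powr_diff using pos[OF t] by simp
    also have "\<dots> \<le> (2 / d) * E t powr (- 2 / d - 1) * (- E' t)"
      by (rule mult_left_mono[OF *]) simp
    finally show ?thesis by simp
  qed
  have "(\<lambda>t. E t powr (- 2 / d) - c * t) t0 \<le> (\<lambda>t. E t powr (- 2 / d) - c * t) t1"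
  proof (rule DERIV_nonneg_imp_nondecreasing[where f = "\<lambda>t. E t powr (- 2 / d) - c * t"])
    fix t assume "t0 \<le> t" "t \<le> t1"
    then have t: "t \<in> {t0..t1}" by simp
    have "((\<lambda>t. E t powr (- 2 / d) - c * t) has_real_derivative
        (- 2 / d) * E t powr (- 2 / d - 1) * E' t - c) (at t)"
      by (intro DERIV_diff DERIV_cmult_Id DERIV_chain2[OF has_real_derivative_powr[OF pos[OF t]] der[OF t]])
    then show "\<exists>y. ((\<lambda>t. E t powr (- 2 / d) - c * t) has_real_derivative y) (at t) \<and> 0 \<le> y"
      using key[OF t] by (intro exI conjI) auto
  qed (use \<open>t0 < t1\<close> in simp)
  \<comment> \<open>The initial value E(t0)^(-2/d) is discarded as nonnegative; hence the bound does
    not depend on how large E was at the start.\<close>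
  then have "c * (t1 - t0) \<le> E t1 powr (- 2 / d)"
    using powr_ge_zero[of "E t0" "- 2 / d"] unfolding right_diff_distrib by linarith
  moreover have "0 < c * (t1 - t0)" using \<open>t0 < t1\<close> \<open>0 < d\<close> \<open>0 < M\<close> by (simp add: c_def)
  ultimately have "(E t1 powr (- 2 / d)) powr (- (d / 2)) \<le> (c * (t1 - t0)) powr (- (d / 2))"
    by (intro powr_mono2') auto
  then have "E t1 \<le> (c * (t1 - t0)) powr (- (d / 2))"
    unfolding powr_powr using \<open>0 < d\<close> pos[of t1] \<open>t0 < t1\<close> by simp
  also have "\<dots> = (4 * (t1 - t0) / d\<^sup>2 * (2 * M\<^sup>2) powr (- 2 / d)) powr (- (d / 2))"
    unfolding c_def by (rule arg_cong[of _ _ "\<lambda>x. x powr _"]) simp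
  also have "\<dots> = (4 * (t1 - t0) / d\<^sup>2) powr (- (d / 2)) * (2 * M\<^sup>2)"
    using \<open>0 < d\<close> by (subst powr_mult) (simp add: powr_powr)
  also have "(4 * (t1 - t0) / d\<^sup>2) powr (- (d / 2)) = (d\<^sup>2 / (4 * (t1 - t0))) powr (d / 2)"
    by (simp only: powr_minus inverse_powr[symmetric] inverse_divide)
  finally show ?thesis by simp
qed simp

text \<open>Here \<open>E j\<close> stands for the integral of v^(2^j), so the next integral is that
  of a square and \<open>E j\<close> plays the part of the L^1 norm. Halving the time steps makes
  the constants grow only geometrically in j, and after taking 2^j-th roots their product
  converges.\<close>

lemma nash_iteration:
  fixes E :: "nat \<Rightarrow> real \<Rightarrow> real" and E' :: "nat \<Rightarrow> real \<Rightarrow> real" and d :: nat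
  assumes "0 < T" "0 < d" "0 < M" and M: "E 0 t0 \<le> M"
    and der: "\<And>j t. t \<in> {t0..t0 + T} \<Longrightarrow> (E j has_real_derivative E' j t) (at t)"
    and E0: "\<And>j t. t \<in> {t0..t0 + T} \<Longrightarrow> 0 \<le> E j t"
    and E'0: "\<And>j t. t \<in> {t0..t0 + T} \<Longrightarrow> E' j t \<le> 0"
    and nash: "\<And>j t (r::real). t \<in> {t0..t0 + T} \<Longrightarrow> 0 < r \<Longrightarrow>
      E (Suc j) t \<le> d * r\<^sup>2 / 4 * (- E' (Suc j) t) + (E j t)\<^sup>2 / r ^ d"
  defines "A \<equiv> 2 * (d\<^sup>2 / (4 * T)) powr (d / 2)"
  shows "E j (t0 + T) \<le> (A * 2 ^ d * M) ^ 2 ^ j / A"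
proof -
  \<comment> \<open>Passing from j to j + 1 uses the time T / 2^(j + 1), so all steps fit into an
    interval of length T; each step multiplies the constant by one more factor \<kappa> =
    2^(d/2).\<close>
  define t where "t = (\<lambda>j::nat. t0 + T * (1 - 1 / 2 ^ j))"
  define \<kappa> where "\<kappa> = 2 powr (d / 2)"
  have A: "0 < A" using assms(1,2) by (simp add: A_def)
  have \<kappa>: "1 \<le> \<kappa>" by (simp add: \<kappa>_def ge_one_powr_ge_zero)
  have \<kappa>2: "\<kappa>\<^sup>2 = 2 ^ d"
  proof -
    have "\<kappa>\<^sup>2 = 2 powr (real 2 * (d / 2))" unfolding \<kappa>_def by (rule powr_power) simp
    also have "real 2 * (d / 2) = d" by simp
    also have "(2::real) powr d = 2 ^ d" by (rule powr_realpow) simp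
    finally show ?thesis .
  qed
  have tI: "t j \<in> {t0..t0 + T}" for j
    using \<open>0 < T\<close> by (auto simp: t_def mult_le_cancel_left1 intro!: mult_nonneg_nonneg)
  have mono: "E j y \<le> E j x" if "x \<in> {t0..t0+T}" "y \<in> {t0..t0+T}" "x \<le> y" for j x y
  proof (rule DERIV_nonpos_imp_nonincreasing[where f = "E j", OF that(3)])
    fix s assume "x \<le> s" "s \<le> y"
    then have "s \<in> {t0..t0 + T}" using that by auto
    then show "\<exists>z. (E j has_real_derivative z) (at s) \<and> z \<le> 0" using der E'0 by blast
  qed
  \<comment> \<open>The exact solution of the recursion b(j+1) = A \<kappa>^(j+1) b(j)^2 with b(0) =
    M. The denominator is chosen so that the growing factors \<kappa>^(j+1) reproduce the same
    form.\<close>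
  have bnd: "E j (t j) \<le> (A * \<kappa>\<^sup>2 * M) ^ 2 ^ j / (A * \<kappa> ^ (j + 2))" for j
  proof (induction j)
    case 0
    then show ?case using M A \<kappa> by (simp add: t_def power2_eq_square)
  next
    case (Suc j)
    define m where "m = (A * \<kappa>\<^sup>2 * M) ^ 2 ^ j / (A * \<kappa> ^ (j + 2))"
    have m: "0 < m" using A \<kappa> \<open>0 < M\<close> unfolding m_def by (intro divide_pos_pos mult_pos_pos zero_less_power) auto
    have len: "t (Suc j) - t j = T / 2 ^ Suc j" by (simp add: t_def algebra_simps)
    have "0 < T / 2 ^ Suc j" using \<open>0 < T\<close> by (intro divide_pos_pos) auto
    then have lt: "t j < t (Suc j)" using len by linarith
    have sub: "s \<in> {t0..t0 + T}" if "s \<in> {t j..t (Suc j)}" for s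
      using that tI[of j] tI[of "Suc j"] by auto
    have "E (Suc j) (t (Suc j)) \<le> 2 * (d\<^sup>2 / (4 * (t (Suc j) - t j))) powr (d / 2) * m\<^sup>2"
    proof (rule nash_ode[where E' = "E' (Suc j)"])
      fix s r :: real assume s: "s \<in> {t j..t (Suc j)}" and r: "0 < r"
      have "E j s \<le> E j (t j)" using s by (intro mono tI sub[OF s]) auto
      also have "\<dots> \<le> m" unfolding m_def by (rule Suc.IH)
      finally have "E j s \<le> m" .
      then have "(E j s)\<^sup>2 \<le> m\<^sup>2" using E0[OF sub[OF s]] by (intro power_mono)
      then have "(E j s)\<^sup>2 / r ^ d \<le> m\<^sup>2 / r ^ d" using r by (intro divide_right_mono) auto
      then show "E (Suc j) s \<le> d * r\<^sup>2 / 4 * (- E' (Suc j) s) + m\<^sup>2 / r ^ d"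
        using nash[OF sub[OF s] r, of j] by linarith
    qed (use lt m \<open>0 < d\<close> der E0 E'0 sub in auto)
    also have "d\<^sup>2 / (4 * (t (Suc j) - t j)) = (d\<^sup>2 / (4 * T)) * 2 ^ Suc j"
      unfolding len using \<open>0 < T\<close> by (simp add: field_simps)
    also have "(\<dots>) powr (d / 2) = (d\<^sup>2 / (4 * T)) powr (d / 2) * (2 ^ Suc j) powr (d / 2)"
      by (rule powr_mult)
    also have "(2 ^ Suc j) powr (d / 2) = \<kappa> ^ Suc j"
    proof -
      have "(2 ^ Suc j) powr (d / 2) = (2 powr real (Suc j)) powr (d / 2)" by (simp only: powr_realpow zero_less_numeral)
      also have "\<dots> = 2 powr (real (Suc j) * (d / 2))" by (rule powr_powr)
      also have "\<dots> = \<kappa> ^ Suc j" unfolding \<kappa>_def by (rule powr_power[symmetric]) simp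
      finally show ?thesis .
    qed
    also have "2 * ((d\<^sup>2 / (4 * T)) powr (d / 2) * \<kappa> ^ Suc j) * m\<^sup>2 = A * \<kappa> ^ Suc j * m\<^sup>2"
      by (simp add: A_def)
    also have "\<dots> = (A * \<kappa>\<^sup>2 * M) ^ 2 ^ Suc j / (A * \<kappa> ^ (Suc j + 2))"
    proof -
      have "((A * \<kappa>\<^sup>2 * M) ^ 2 ^ j)\<^sup>2 = (A * \<kappa>\<^sup>2 * M) ^ 2 ^ Suc j" by (simp add: mult.commute flip: power_mult)
      moreover have "(A * \<kappa> ^ (j + 2))\<^sup>2 = (A * \<kappa> ^ Suc j) * (A * \<kappa> ^ (Suc j + 2))"
        by (simp add: power2_eq_square algebra_simps power_add power3_eq_cube)
      ultimately show ?thesis using A \<kappa> unfolding m_def power_divide by simp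
    qed
    finally show ?case .
  qed
  have "E j (t0 + T) \<le> E j (t j)" by (rule mono) (use tI[of j] \<open>0 < T\<close> in auto)
  also have "\<dots> \<le> (A * \<kappa>\<^sup>2 * M) ^ 2 ^ j / (A * \<kappa> ^ (j + 2))" by (rule bnd)
  also have "\<dots> \<le> (A * \<kappa>\<^sup>2 * M) ^ 2 ^ j / A"
    using A \<kappa> \<open>0 < M\<close> one_le_power[OF \<kappa>, of "j + 2"] by (intro divide_left_mono) auto
  finally show ?thesis unfolding \<kappa>2 .
qed

text \<open>If v exceeded some K > L on a ball of measure \<mu>, then K^(2^j) \<mu> <= L^(2^j) / A
  for all j, which is impossible since (L/K)^(2^j) tends to 0. The constant A disappears in the
  limit.\<close>

lemma sup_bound_of_power_integrals:
  fixes v :: "'a::euclidean_space \<Rightarrow> real"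
  assumes v: "continuous_on UNIV v" "\<And>x. 0 \<le> v x" "\<And>x. R \<le> norm x \<Longrightarrow> v x = 0"
    and "0 \<le> L" "0 < A" and int: "\<And>j::nat. (\<integral>x. v x ^ 2 ^ j \<partial>lborel) \<le> L ^ 2 ^ j / A"
  shows "v x \<le> L"
proof (rule ccontr)
  assume "\<not> v x \<le> L"
  define K where "K = (v x + L) / 2"
  have K: "L < K" "K < v x" using \<open>\<not> v x \<le> L\<close> by (auto simp: K_def)
  have "open {y. K < v y}" using v(1) by (intro open_Collect_less) auto
  then obtain e where e: "0 < e" "ball x e \<subseteq> {y. K < v y}"
    using K openE[of "{y. K < v y}" x] by auto
  define \<mu> where "\<mu> = measure lborel (ball x e)"
  have \<mu>: "0 < \<mu>" unfolding \<mu>_def using e(1) content_ball_pos by simp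
  have "K ^ 2 ^ j * \<mu> \<le> L ^ 2 ^ j / A" for j :: nat
  proof -
    have "K ^ 2 ^ j * \<mu> = (\<integral>y. K ^ 2 ^ j * indicator (ball x e) y \<partial>lborel)"
      by (simp add: \<mu>_def)
    also have "\<dots> \<le> (\<integral>y. v y ^ 2 ^ j \<partial>lborel)"
    proof (rule integral_mono)
      show "integrable lborel (\<lambda>y. v y ^ 2 ^ j)"
        by (rule integrable_continuous_compact_support[of _ R]) (auto intro!: continuous_intros v)
      show "integrable lborel (\<lambda>y. K ^ 2 ^ j * indicator (ball x e) y)"
        using emeasure_lborel_ball_finite by (intro integrable_mult_right integrable_real_indicator) auto
      show "K ^ 2 ^ j * indicator (ball x e) y \<le> v y ^ 2 ^ j" for y
        using e(2) K(1) \<open>0 \<le> L\<close> v(2)[of y]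
        by (auto simp: indicator_def intro!: power_mono less_imp_le)
    qed
    also have "\<dots> \<le> L ^ 2 ^ j / A" by (rule int)
    finally show ?thesis .
  qed
  then have *: "A * \<mu> \<le> (L / K) ^ 2 ^ j" for j :: nat
    using K \<open>0 \<le> L\<close> \<open>0 < A\<close> by (simp add: field_simps power_divide)
  have "(\<lambda>j. (L / K) ^ j) \<longlonglongrightarrow> 0" using K \<open>0 \<le> L\<close> by (intro LIMSEQ_power_zero) auto
  then obtain N where N: "(L / K) ^ n < A * \<mu>" if "n \<ge> N" for n
    using \<mu> \<open>0 < A\<close> order_tendstoD(2)[of _ 0 sequentially "A * \<mu>"] by (force simp: eventually_sequentially)
  have "N \<le> 2 ^ N" by (simp add: less_imp_le)
  from N[OF this] *[of N] show False by simp
qed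

section \<open>Subsolutions on balls\<close>

lemma C12_in_const: "C12_in T (U :: (real^'n) set) (\<lambda>_ _. c)"
proof -
  have "grad (\<lambda>_. c) = (\<lambda>_::real^'n. 0)" by (intro ext grad_eqI) simp
  moreover have "hessian (\<lambda>_. c) = (\<lambda>_::real^'n. 0)"
    unfolding hessian_def calculation
    by (intro ext, subst jacobian_eq[where F' = "\<lambda>_. 0"]) (auto simp: vec_eq_iff)
  ultimately show ?thesis by (simp add: C12_in_def)
qed

text \<open>Used with e = -1 for the time reversal of the supersolution and with e = 1 for
  restarting it at a later time.\<close>

lemma C12_in_time_affine:
  fixes U :: "(real^'n) set"
  assumes u: "C12_in T U u" and "e \<noteq> 0" and T': "\<And>s. s \<in> T' \<Longrightarrow> c + e * s \<in> T"
  shows "C12_in T' U (\<lambda>s. u (c + e * s))"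
    "s \<in> T' \<Longrightarrow> x \<in> U \<Longrightarrow> deriv (\<lambda>s. u (c + e * s) x) s = e * deriv (\<lambda>s. u s x) (c + e * s)"
proof -
  have d: "((\<lambda>s. u (c + e * s) x) has_real_derivative e * deriv (\<lambda>s. u s x) (c + e * s)) (at s)"
    if "s \<in> T'" "x \<in> U" for s x
  proof -
    have "((\<lambda>s. c + e * s) has_real_derivative e) (at s)" by (auto intro!: derivative_eq_intros)
    from DERIV_chain2[OF C12_inD(1)[OF u T'[OF that(1)] that(2)] this] show ?thesis by (simp add: mult.commute)
  qed
  have dd: "(\<lambda>s. u (c + e * s) x) differentiable (at s)" if "s \<in> T'" "x \<in> U" for s x
    using d[OF that] real_differentiable_def by blast
  show D: "deriv (\<lambda>s. u (c + e * s) x) s = e * deriv (\<lambda>s. u s x) (c + e * s)" if "s \<in> T'" "x \<in> U" for s x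
    using d[OF that] by (rule DERIV_imp_deriv)
  have c: "continuous_on (T' \<times> U) (\<lambda>p. f (c + e * fst p) (snd p))"
    if "continuous_on (T \<times> U) (\<lambda>p. f (fst p) (snd p))" for f :: "real \<Rightarrow> real^'n \<Rightarrow> 'c::topological_space"
  proof -
    have "continuous_on (T' \<times> U) (\<lambda>p. (\<lambda>p. f (fst p) (snd p)) (c + e * fst p, snd p))"
      by (rule continuous_on_compose2[OF that]) (auto intro!: continuous_intros T')
    then show ?thesis by simp
  qed
  have "continuous_on (T' \<times> U) (\<lambda>p. e * deriv (\<lambda>s. u s (snd p)) (c + e * fst p))"
    by (intro continuous_intros c[OF C12_in_continuous(2)[OF u]])
  then have "continuous_on (T' \<times> U) (\<lambda>p. deriv (\<lambda>s. u (c + e * s) (snd p)) (fst p))"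
    by (rule continuous_on_eq) (auto simp: D)
  then show "C12_in T' U (\<lambda>s. u (c + e * s))"
    using c[OF C12_in_continuous(1)[OF u]] c[OF C12_in_continuous(3)[OF u]] c[OF C12_in_continuous(4)[OF u]]
      C12_inD(2,3)[OF u T'] dd
    unfolding C12_in_def case_prod_unfold by auto
qed

lemma C2_on_diff_cmult:
  assumes f: "C2_on U f" and g: "C2_on U g" and "open U" "x \<in> U"
  shows "(\<lambda>z. f z - M * g z) differentiable (at x)" "grad (\<lambda>z. f z - M * g z) x = grad f x - M *\<^sub>R grad g x"
    "grad (\<lambda>z. f z - M * g z) differentiable (at x)"
    "hessian (\<lambda>z. f z - M * g z) x = hessian f x - M *\<^sub>R hessian g x"
proof -
  have df: "f differentiable (at z)" "g differentiable (at z)"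
    "grad f differentiable (at z)" "grad g differentiable (at z)" if "z \<in> U" for z
    using f g that by (auto simp: C2_on_def)
  have dM: "(\<lambda>z. M * g z) differentiable (at z)" if "z \<in> U" for z
    using df(2)[OF that] by (intro differentiable_mult) auto
  show "(\<lambda>z. f z - M * g z) differentiable (at x)"
    using df(1) dM \<open>x \<in> U\<close> by (intro differentiable_diff) auto
  have g: "grad (\<lambda>z. f z - M * g z) z = grad f z - M *\<^sub>R grad g z" if "z \<in> U" for z
    using df dM that by (simp add: grad_diff grad_cmult)
  then show "grad (\<lambda>z. f z - M * g z) x = grad f x - M *\<^sub>R grad g x" using \<open>x \<in> U\<close> by simp
  let ?D = "\<lambda>h. frechet_derivative (grad f) (at x) h - M *\<^sub>R frechet_derivative (grad g) (at x) h"
  have "((\<lambda>z. grad f z - M *\<^sub>R grad g z) has_derivative ?D) (at x)"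
    using df(3,4)[OF \<open>x \<in> U\<close>] unfolding frechet_derivative_works
    by (intro has_derivative_diff has_derivative_scaleR_right)
  then have D: "(grad (\<lambda>z. f z - M * g z) has_derivative ?D) (at x)"
    by (rule has_derivative_transform_within_open[OF _ \<open>open U\<close> \<open>x \<in> U\<close>]) (simp add: g)
  then show "grad (\<lambda>z. f z - M * g z) differentiable (at x)" by (auto simp: differentiable_def)
  show "hessian (\<lambda>z. f z - M * g z) x = hessian f x - M *\<^sub>R hessian g x"
    unfolding hessian_def jacobian_eq[OF D] by (simp add: jacobian_def matrix_def vec_eq_iff)
qed

text \<open>Supplies the regularity of u - M \<theta>, the difference between a solution and a
  multiple of a supersolution, which the comparison step treats as a subsolution.\<close>

lemma C12_in_diff_cmult:
  assumes u: "C12_in T U u" and v: "C12_in T U v" and "open U"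
  shows "C12_in T U (\<lambda>t x. u t x - M * v t x)"
    "t \<in> T \<Longrightarrow> x \<in> U \<Longrightarrow> deriv (\<lambda>s. u s x - M * v s x) t = deriv (\<lambda>s. u s x) t - M * deriv (\<lambda>s. v s x) t"
proof -
  have d: "((\<lambda>s. u s x - M * v s x) has_real_derivative deriv (\<lambda>s. u s x) t - M * deriv (\<lambda>s. v s x) t) (at t)"
    if "t \<in> T" "x \<in> U" for t x
    using C12_inD(1)[OF u that] C12_inD(1)[OF v that] by (intro DERIV_diff DERIV_cmult)
  have dd: "(\<lambda>s. u s x - M * v s x) differentiable (at t)" if "t \<in> T" "x \<in> U" for t x
    using d[OF that] real_differentiable_def by blast
  show D: "deriv (\<lambda>s. u s x - M * v s x) t = deriv (\<lambda>s. u s x) t - M * deriv (\<lambda>s. v s x) t"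
    if "t \<in> T" "x \<in> U" for t x
    using d[OF that] by (rule DERIV_imp_deriv)
  note S = C2_on_diff_cmult[OF C12_in_slice[OF u] C12_in_slice[OF v] \<open>open U\<close>]
  note cu = C12_in_continuous[OF u] and cv = C12_in_continuous[OF v]
  have "continuous_on (T \<times> U) (\<lambda>p. deriv (\<lambda>s. u s (snd p) - M * v s (snd p)) (fst p))"
    by (rule continuous_on_eq[OF continuous_on_diff[OF cu(2) continuous_on_mult_left[OF cv(2)]]]) (auto simp: D)
  moreover have "continuous_on (T \<times> U) (\<lambda>p. grad (\<lambda>x. u (fst p) x - M * v (fst p) x) (snd p))"
    by (rule continuous_on_eq[OF continuous_on_diff[OF cu(3) continuous_on_scaleR[OF continuous_on_const cv(3)]]])
       (auto simp: S)
  moreover have "continuous_on (T \<times> U) (\<lambda>p. hessian (\<lambda>x. u (fst p) x - M * v (fst p) x) (snd p))"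
    by (rule continuous_on_eq[OF continuous_on_diff[OF cu(4) continuous_on_scaleR[OF continuous_on_const cv(4)]]])
       (auto simp: S)
  moreover have "continuous_on (T \<times> U) (\<lambda>p. u (fst p) (snd p) - M * v (fst p) (snd p))"
    by (rule continuous_on_diff[OF cu(1) continuous_on_mult_left[OF cv(1)]])
  ultimately show "C12_in T U (\<lambda>t x. u t x - M * v t x)"
    unfolding C12_in_def case_prod_unfold using dd S by auto
qed

section \<open>Smoothing and weighted monotonicity for truncated subsolutions\<close>

context diffusion begin

lemma op_const: "op (\<lambda>_. c) x = - V x * c"
proof -
  have "grad (\<lambda>_. c) = (\<lambda>_::real^'n. 0)" by (intro ext grad_eqI) simp
  then have "flux (\<lambda>_. c) = (\<lambda>_. 0)" by (simp add: flux_def[abs_def])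
  then show ?thesis by (simp add: op_def divergence_def frechet_derivative_const)
qed

lemma op_diff_cmult:
  assumes f: "C2_on U f" and g: "C2_on U g" and "open U" "x \<in> U"
  shows "op (\<lambda>z. f z - M * g z) x = op f x - M * op g x"
proof -
  note S = C2_on_diff_cmult[OF assms]
  have d: "grad f differentiable (at x)" "grad g differentiable (at x)"
    using assms by (auto simp: C2_on_def)
  show ?thesis
    unfolding op_def divergence_flux[OF S(3)] divergence_flux[OF d(1)] divergence_flux[OF d(2)] S(2,4)
    by (simp add: sum_subtractf algebra_simps inner_diff_right sum_distrib_left)
qed

text \<open>Apply \<open>nash_iteration\<close> to the integrals of G(w)^(2^j), all with the
  constant weight 1, which is a supersolution because V >= 0. \<open>M\<close> is any positive bound
  for the initial mass, not the mass itself, so letting it tend to 0 will turn zero mass into a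
  pointwise statement.\<close>

lemma smoothing_bound:
  fixes w :: "real \<Rightarrow> real^'n \<Rightarrow> real"
  assumes cut: "cutoff \<delta> G G1 G2" and w: "C12_in {a<..<b} (ball 0 n) w"
    and sub: "\<And>t x. t \<in> {a<..<b} \<Longrightarrow> x \<in> ball 0 n \<Longrightarrow> deriv (\<lambda>s. w s x) t \<le> op (w t) x"
    and bdry: "\<And>t1 t2. a < t1 \<Longrightarrow> t1 \<le> t2 \<Longrightarrow> t2 < b \<Longrightarrow>
      \<exists>\<rho><n. \<forall>t\<in>{t1..t2}. \<forall>x\<in>ball 0 n. \<rho> \<le> norm x \<longrightarrow> w t x \<le> \<delta>"
    and T: "a < t0" "0 < T" "t0 + T < b" and x0: "x0 \<in> ball 0 n"
    and M: "0 < M" "(\<integral>x. (if x \<in> ball 0 n then G (w t0 x) else 0) \<partial>lborel) \<le> M"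
  shows "G (w (t0 + T) x0) \<le> 2 * ((real CARD('n))\<^sup>2 / (4 * T)) powr (CARD('n) / 2) * 2 ^ CARD('n) * M"
proof -
  let ?B = "ball 0 n :: (real^'n) set" and ?d = "CARD('n)"
  \<comment> \<open>Every power G^(2^j) is again a cutoff with the same \<delta>, so one boundary
    layer serves all j.\<close>
  have "\<exists>K1 K2. cutoff \<delta> (\<lambda>r. G r ^ 2 ^ j) K1 K2" for j :: nat
  proof (induction j)
    case 0
    then show ?case using cut by auto
  next
    case (Suc j)
    then obtain K1 K2 where "cutoff \<delta> (\<lambda>r. G r ^ 2 ^ j) K1 K2" by blast
    from cutoff_square[OF this] show ?case by (auto simp: mult.commute simp flip: power_mult)
  qed
  then obtain K1 K2 where K: "\<And>j. cutoff \<delta> (\<lambda>r. G r ^ 2 ^ j) (K1 j) (K2 j)" by metis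
  define v where "v = (\<lambda>(j::nat) s x. if x \<in> ?B then G (w s x) ^ 2 ^ j else 0)"
  define E where "E = (\<lambda>j s. \<integral>x. v j s x \<partial>lborel)"
  define P where "P = (\<lambda>j s x. if x \<in> ?B then (norm (K1 j (w s x) *\<^sub>R grad (w s) x))\<^sup>2 else 0)"
  have G0: "0 \<le> G r" for r using cutoffD(4)[OF cut] .
  have G'0: "G r = 0" if "r \<le> \<delta>" for r using cutoffD(8)[OF cut] that .
  have pw: "r ^ 2 ^ Suc j = (r ^ 2 ^ j)\<^sup>2" for r :: real and j
    by (simp add: mult.commute flip: power_mult)
  have v0: "0 \<le> v j s x" for j s x using G0 by (simp add: v_def)
  have vS: "v (Suc j) s x = (v j s x)\<^sup>2" for j s x
    by (simp add: v_def pw del: power_Suc)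
  have one: "C12_in {a<..<b} ?B (\<lambda>_ _. 1)" by (rule C12_in_const)
  have ball_bd: "\<exists>\<rho><n. \<forall>x\<in>?B. \<rho> \<le> norm x \<longrightarrow> w t x \<le> \<delta>" if "t \<in> {a<..<b}" for t
    using bdry[of t t] that by auto
  have vc: "continuous_on UNIV (v j s)" and v00: "\<And>x. n \<le> norm x \<Longrightarrow> v j s x = 0"
    if s: "s \<in> {a<..<b}" for j s
  proof -
    obtain \<rho> where \<rho>: "\<rho> < n" "\<And>x. x \<in> ?B \<Longrightarrow> \<rho> \<le> norm x \<Longrightarrow> w s x \<le> \<delta>" using ball_bd[OF s] by blast
    have "continuous_on ?B (\<lambda>x. G (w s x) ^ 2 ^ j)"
      using continuous_on_compose2[OF cutoff_continuous(1)[OF K] continuous_on_slice[OF C12_in_continuous(1)[OF w] s]] by auto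
    from continuous_on_zero_extension_space[OF this \<rho>(1)] \<rho>(2)
    show "continuous_on UNIV (v j s)" unfolding v_def using G'0 by auto
    show "v j s x = 0" if "n \<le> norm x" for x using that by (simp add: v_def)
  qed
  \<comment> \<open>For j = 0 only monotonicity is needed. For j = i + 1 the power is a square, and
    its dissipation is at least twice the integral \<open>P i\<close> of the squared gradient of
    G(w)^(2^i).\<close>
  have en: "\<exists>D. (E j has_real_derivative D) (at t) \<and> D \<le> 0 \<and>
     (\<forall>i. j = Suc i \<longrightarrow> D \<le> - 2 * (\<integral>x. P i t x \<partial>lborel))" if t: "t \<in> {a<..<b}" for j t
  proof -
    define Q where "Q = (\<lambda>H2 x. if x \<in> ?B then q x * 1 * H2 (w t x) * (norm (grad (w t) x))\<^sup>2 else 0)"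
    have "\<exists>D. ((\<lambda>s. \<integral>x. (if x \<in> ?B then H (w s x) * 1 else 0) \<partial>lborel) has_real_derivative D) (at t) \<and>
      D \<le> - (\<integral>x. Q H2 x \<partial>lborel)" if "cutoff \<delta> H H1 H2" for H H1 H2
      unfolding Q_def
      by (rule energy_derivative[OF that w one sub _ _ bdry t]) (use V_nonneg in \<open>auto simp: op_const\<close>)
    note en = this[unfolded mult_1_right]
    have Q0: "0 \<le> (\<integral>x. Q H2 x \<partial>lborel)" if "\<And>r. 0 \<le> H2 r" for H2
    proof (rule Bochner_Integration.integral_nonneg)
      fix x
      have "0 \<le> q x" using q_ge_1[of x] by simp
      then show "0 \<le> Q H2 x" using that by (auto simp: Q_def)
    qed
    show ?thesis
    proof (cases j)
      case 0
      from en[OF K[of j]] obtain D where D: "(E j has_real_derivative D) (at t)" "D \<le> - (\<integral>x. Q (K2 j) x \<partial>lborel)"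
        by (auto simp: E_def v_def)
      have "0 \<le> (\<integral>x. Q (K2 j) x \<partial>lborel)" by (rule Q0) (rule cutoffD(6)[OF K])
      then have "D \<le> 0" using D(2) by linarith
      then show ?thesis using D 0 by auto
    next
      case (Suc i)
      let ?H2 = "\<lambda>r. 2 * (K1 i r)\<^sup>2 + 2 * G r ^ 2 ^ i * K2 i r"
      from en[OF cutoff_square[OF K[of i]]] obtain D where D:
        "((\<lambda>s. \<integral>x. (if x \<in> ?B then (G (w s x) ^ 2 ^ i)\<^sup>2 else 0) \<partial>lborel) has_real_derivative D) (at t)"
        "D \<le> - (\<integral>x. Q ?H2 x \<partial>lborel)" by auto
      have E: "E j = (\<lambda>s. \<integral>x. (if x \<in> ?B then (G (w s x) ^ 2 ^ i)\<^sup>2 else 0) \<partial>lborel)"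
        by (simp only: E_def v_def Suc pw)
      obtain \<rho> where \<rho>: "\<rho> < n" "\<And>x. x \<in> ?B \<Longrightarrow> \<rho> \<le> norm x \<Longrightarrow> w t x \<le> \<delta>" using ball_bd[OF t] by blast
      note cw = continuous_on_slice[OF C12_in_continuous(1)[OF w] t]
        and cg = continuous_on_slice[OF C12_in_continuous(3)[OF w] t]
      have cK: "continuous_on ?B (\<lambda>x. H (w t x))" if "continuous_on UNIV H" for H :: "real \<Rightarrow> real"
        by (rule continuous_on_compose2[OF that cw]) auto
      note cK' = cutoff_continuous[OF K[of i], THEN cK]
      have QH: "continuous_on UNIV (Q ?H2)" unfolding Q_def
      proof (rule continuous_on_zero_extension_space[OF _ \<rho>(1)])
        show "continuous_on ?B (\<lambda>x. q x * 1 * ?H2 (w t x) * (norm (grad (w t) x))\<^sup>2)"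
          by (intro continuous_intros cK' cg q_cont)
        show "q x * 1 * ?H2 (w t x) * (norm (grad (w t) x))\<^sup>2 = 0" if "x \<in> ?B" "\<rho> \<le> norm x" for x
          using cutoffD(8-10)[OF K[of i] \<rho>(2)[OF that]] by simp
      qed
      have PH: "continuous_on UNIV (P i t)" unfolding P_def
      proof (rule continuous_on_zero_extension_space[OF _ \<rho>(1)])
        show "continuous_on ?B (\<lambda>x. (norm (K1 i (w t x) *\<^sub>R grad (w t) x))\<^sup>2)"
          by (intro continuous_intros cK' cg)
        show "(norm (K1 i (w t x) *\<^sub>R grad (w t) x))\<^sup>2 = 0" if "x \<in> ?B" "\<rho> \<le> norm x" for x
          using cutoffD(9)[OF K[of i] \<rho>(2)[OF that]] by simp
      qed
      have "2 * (\<integral>x. P i t x \<partial>lborel) = (\<integral>x. 2 * P i t x \<partial>lborel)" by simp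
      also have "\<dots> \<le> (\<integral>x. Q ?H2 x \<partial>lborel)"
      proof (rule integral_mono)
        show "integrable lborel (\<lambda>x. 2 * P i t x)"
          by (intro integrable_mult_right integrable_continuous_compact_support[OF PH, of n]) (simp add: P_def)
        show "integrable lborel (Q ?H2)"
          by (rule integrable_continuous_compact_support[OF QH, of n]) (simp add: Q_def)
        show "2 * P i t x \<le> Q ?H2 x" for x
        proof (cases "x \<in> ?B")
          case True
          \<comment> \<open>The term 2 G G2 of the squared cutoff is dropped and q is bounded below
            by 1.\<close>
          have "1 * (2 * (K1 i (w t x))\<^sup>2) \<le> q x * ?H2 (w t x)"
            using q_ge_1[of x] cutoffD(4,6)[OF K[of i]] by (intro mult_mono) auto
          then have "2 * (K1 i (w t x))\<^sup>2 * (norm (grad (w t) x))\<^sup>2 \<le> q x * ?H2 (w t x) * (norm (grad (w t) x))\<^sup>2"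
            by (intro mult_right_mono) auto
          then show ?thesis using True by (simp add: P_def Q_def power_mult_distrib)
        qed (simp add: P_def Q_def)
      qed
      finally have "D \<le> - 2 * (\<integral>x. P i t x \<partial>lborel)" using D(2) by linarith
      moreover have "0 \<le> (\<integral>x. P i t x \<partial>lborel)" by (rule Bochner_Integration.integral_nonneg) (simp add: P_def)
      ultimately show ?thesis using D(1) E Suc by auto
    qed
  qed
  define E' where "E' = (\<lambda>j t. deriv (E j) t)"
  have der: "(E j has_real_derivative E' j t) (at t)" "E' j t \<le> 0"
     "E' (Suc j) t \<le> - 2 * (\<integral>x. P j t x \<partial>lborel)" if "t \<in> {a<..<b}" for j t
    using en[OF that, of j] en[OF that, of "Suc j"] unfolding E'_def by (auto dest: DERIV_imp_deriv)
  have sI: "t \<in> {a<..<b}" if "t \<in> {t0..t0 + T}" for t using that T by auto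
  have nash: "E (Suc j) t \<le> ?d * r\<^sup>2 / 4 * (- E' (Suc j) t) + (E j t)\<^sup>2 / r ^ ?d"
    if t: "t \<in> {a<..<b}" and r: "0 < r" for j t and r :: real
  proof -
    obtain \<rho> where \<rho>: "\<rho> < n" "\<And>x. x \<in> ?B \<Longrightarrow> \<rho> \<le> norm x \<Longrightarrow> w t x \<le> \<delta>" using ball_bd[OF t] by blast
    note D = cutoffD[OF K[of j]]
    define Dv where "Dv = (\<lambda>x. if x \<in> ?B then K1 j (w t x) *\<^sub>R grad (w t) x else 0)"
    have dv: "(v j t has_derivative (\<lambda>h. Dv x \<bullet> h)) (at x)" for x
    proof (cases "x \<in> ?B")
      case True
      have dw: "w t differentiable (at x)" by (rule C12_inD(2)[OF w t True])
      have "((\<lambda>z. G (w t z) ^ 2 ^ j) has_derivative (\<lambda>h. Dv x \<bullet> h)) (at x)"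
        using has_derivative_grad[OF grad_scale_comp(1)[OF dw D(1)]] grad_scale_comp(2)[OF dw D(1)] True
        by (simp add: Dv_def)
      then show ?thesis
        by (rule has_derivative_transform_within_open[where s = ?B]) (use True in \<open>auto simp: v_def\<close>)
    next
      case False
      have "(v j t has_derivative (\<lambda>_. 0)) (at x)"
      proof (rule has_derivative_transform_within_open)
        show "open (- cball (0::real^'n) \<rho>)" by auto
        show "((\<lambda>_. 0) has_derivative (\<lambda>_. 0)) (at x)" by simp
        show "x \<in> - cball 0 \<rho>" using False \<rho>(1) by auto
        show "0 = v j t z" if "z \<in> - cball 0 \<rho>" for z
          using that \<rho>(2)[of z] G'0 by (auto simp: v_def)
      qed
      then show ?thesis using False by (simp add: Dv_def)
    qed
    have cD: "continuous_on UNIV Dv" unfolding Dv_def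
    proof (rule continuous_on_zero_extension_space[OF _ \<rho>(1)])
      note cw = continuous_on_slice[OF C12_in_continuous(1)[OF w] t]
      have "continuous_on ?B (\<lambda>x. K1 j (w t x))"
        by (rule continuous_on_compose2[OF cutoff_continuous(2)[OF K] cw]) auto
      then show "continuous_on ?B (\<lambda>x. K1 j (w t x) *\<^sub>R grad (w t) x)"
        by (intro continuous_intros continuous_on_slice[OF C12_in_continuous(3)[OF w] t])
      show "K1 j (w t x) *\<^sub>R grad (w t) x = 0" if "x \<in> ?B" "\<rho> \<le> norm x" for x
        using D(9)[OF \<rho>(2)[OF that]] by simp
    qed
    have "E (Suc j) t = (\<integral>x. (v j t x)\<^sup>2 \<partial>lborel)"
      unfolding E_def by (intro Bochner_Integration.integral_cong refl vS)
    also have "\<dots> \<le> ?d * r\<^sup>2 / 2 * (\<integral>x. (norm (Dv x))\<^sup>2 \<partial>lborel) + (E j t)\<^sup>2 / r ^ ?d"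
      using nash_inequality[OF dv cD v00[OF t] v0 r] by (simp add: E_def)
    also have "(\<lambda>x. (norm (Dv x))\<^sup>2) = P j t" by (auto simp: Dv_def P_def)
    \<comment> \<open>The factor 2 gained from squaring turns the d r^2 / 2 of Nash's inequality
      into the d r^2 / 4 expected by \<open>nash_iteration\<close>.\<close>
    also have "?d * r\<^sup>2 / 2 * (\<integral>x. P j t x \<partial>lborel) = ?d * r\<^sup>2 / 4 * (2 * (\<integral>x. P j t x \<partial>lborel))" by simp
    also have "\<dots> \<le> ?d * r\<^sup>2 / 4 * (- E' (Suc j) t)"
      using der(3)[OF t, of j] by (intro mult_left_mono) auto
    finally show ?thesis by simp
  qed
  let ?A = "2 * ((real ?d)\<^sup>2 / (4 * T)) powr (?d / 2)"
  have A: "0 < ?A" using T by simp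
  have fin: "E j (t0 + T) \<le> (?A * 2 ^ ?d * M) ^ 2 ^ j / ?A" for j
  proof (rule nash_iteration[OF T(2) _ M(1), of ?d E t0 E' j, simplified])
    show "E 0 t0 \<le> M" using M(2) unfolding E_def v_def power_0 power_one_right .
  qed (use der sI nash Bochner_Integration.integral_nonneg[OF v0] in \<open>auto simp: E_def\<close>)
  have tb: "t0 + T \<in> {a<..<b}" using T by auto
  have "v 0 (t0 + T) x0 \<le> ?A * 2 ^ ?d * M"
  proof (rule sup_bound_of_power_integrals[OF vc[OF tb] v0 v00[OF tb] _ A])
    have "v 0 s x ^ 2 ^ j = v j s x" for j s x by (simp add: v_def)
    then show "(\<integral>x. v 0 (t0 + T) x ^ 2 ^ j \<partial>lborel) \<le> (?A * 2 ^ ?d * M) ^ 2 ^ j / ?A" for j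
      using fin[of j] by (simp add: E_def)
  qed (use A M in auto)
  then show ?thesis using x0 by (simp add: v_def)
qed

text \<open>\<open>energy_derivative\<close> gives monotonicity in the open interval. The endpoints
  are reached by dominated convergence, since at time 0 a Dirichlet solution is continuous only
  pointwise in the open ball; the constant \<open>B\<close> on a ball of finite measure is the
  majorant.\<close>

lemma weighted_integral_mono:
  fixes w \<psi> :: "real \<Rightarrow> real^'n \<Rightarrow> real"
  assumes cut: "cutoff \<delta> G G1 G2"
    and w: "C12_in {a<..<b} (ball 0 n) w" and \<psi>: "C12_in {a<..<b} (ball 0 n) \<psi>"
    and sub: "\<And>t x. t \<in> {a<..<b} \<Longrightarrow> x \<in> ball 0 n \<Longrightarrow> deriv (\<lambda>s. w s x) t \<le> op (w t) x"
    and sup: "\<And>t x. t \<in> {a<..<b} \<Longrightarrow> x \<in> ball 0 n \<Longrightarrow> deriv (\<lambda>s. \<psi> s x) t + op (\<psi> t) x \<le> 0"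
    and nonneg: "\<And>t x. t \<in> {a<..<b} \<Longrightarrow> x \<in> ball 0 n \<Longrightarrow> 0 \<le> \<psi> t x"
    and bdry: "\<And>t1 t2. a < t1 \<Longrightarrow> t1 \<le> t2 \<Longrightarrow> t2 < b \<Longrightarrow>
      \<exists>\<rho><n. \<forall>t\<in>{t1..t2}. \<forall>x\<in>ball 0 n. \<rho> \<le> norm x \<longrightarrow> w t x \<le> \<delta>"
    and ab: "a < b"
    and wc: "\<And>x. x \<in> ball 0 n \<Longrightarrow> continuous_on {a..b} (\<lambda>s. w s x)"
    and \<psi>c: "\<And>x. x \<in> ball 0 n \<Longrightarrow> continuous_on {a..b} (\<lambda>s. \<psi> s x)"
    and bd: "\<And>t x. t \<in> {a<..<b} \<Longrightarrow> x \<in> ball 0 n \<Longrightarrow> G (w t x) * \<psi> t x \<le> B"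
  defines "F \<equiv> \<lambda>s x. if x \<in> ball 0 n then G (w s x) * \<psi> s x else 0"
  shows "integrable lborel (F a)" "(\<integral>x. F b x \<partial>lborel) \<le> (\<integral>x. F a x \<partial>lborel)"
proof -
  let ?B = "ball 0 n :: (real^'n) set"
  note D = cutoffD[OF cut]
  have anti: "(\<integral>x. F s' x \<partial>lborel) \<le> (\<integral>x. F s x \<partial>lborel)" if "a < s" "s \<le> s'" "s' < b" for s s'
  proof (rule DERIV_nonpos_imp_nonincreasing[where f = "\<lambda>s. \<integral>x. F s x \<partial>lborel", OF that(2)])
    fix t assume "s \<le> t" "t \<le> s'"
    then have t: "t \<in> {a<..<b}" using that by auto
    obtain D where D: "((\<lambda>s. \<integral>x. F s x \<partial>lborel) has_real_derivative D) (at t)"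
      "D \<le> - (\<integral>x. (if x \<in> ?B then q x * \<psi> t x * G2 (w t x) * (norm (grad (w t) x))\<^sup>2 else 0) \<partial>lborel)"
      unfolding F_def by (rule energy_derivative[OF cut w \<psi> sub sup nonneg bdry t])
    have "0 \<le> (\<integral>x. (if x \<in> ?B then q x * \<psi> t x * G2 (w t x) * (norm (grad (w t) x))\<^sup>2 else 0) \<partial>lborel)"
    proof (rule Bochner_Integration.integral_nonneg)
      fix x
      have "0 \<le> q x" using q_ge_1[of x] by simp
      then show "0 \<le> (if x \<in> ?B then q x * \<psi> t x * G2 (w t x) * (norm (grad (w t) x))\<^sup>2 else 0)"
        using nonneg[OF t] cutoffD(6)[OF cut] by simp
    qed
    then show "\<exists>y. ((\<lambda>s. \<integral>x. F s x \<partial>lborel) has_real_derivative y) (at t) \<and> y \<le> 0"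
      using D by (intro exI[of _ D]) auto
  qed
  have meas: "F s \<in> borel_measurable lborel" if s: "s \<in> {a<..<b}" for s
  proof -
    have "continuous_on ?B (\<lambda>x. G (w s x))"
      by (rule continuous_on_compose2[OF cutoff_continuous(1)[OF cut]
            continuous_on_slice[OF C12_in_continuous(1)[OF w] s]]) auto
    then have "continuous_on ?B (\<lambda>x. G (w s x) * \<psi> s x)"
      by (intro continuous_on_mult continuous_on_slice[OF C12_in_continuous(1)[OF \<psi>] s])
    then have "F s \<in> borel_measurable borel" unfolding F_def
      by (intro borel_measurable_continuous_on_if) auto
    then show ?thesis by simp
  qed
  define B' where "B' = max B 0"
  have iB: "integrable lborel (\<lambda>x. B' * indicator ?B x)"
    using emeasure_lborel_ball_finite by (intro integrable_mult_right integrable_real_indicator) auto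
  have lim: "integrable lborel (F c) \<and> (\<lambda>k. \<integral>x. F (\<sigma> k) x \<partial>lborel) \<longlonglongrightarrow> (\<integral>x. F c x \<partial>lborel)"
    if \<sigma>: "\<And>k. \<sigma> k \<in> {a<..<b}" "\<sigma> \<longlonglongrightarrow> c" and c: "c \<in> {a..b}" for \<sigma> :: "nat \<Rightarrow> real" and c
  proof -
    have pl: "(\<lambda>k. F (\<sigma> k) x) \<longlonglongrightarrow> F c x" for x
    proof (cases "x \<in> ?B")
      case True
      have "continuous_on {a..b} (\<lambda>s. G (w s x) * \<psi> s x)"
        using wc[OF True] \<psi>c[OF True]
        by (intro continuous_on_mult continuous_on_compose2[OF cutoff_continuous(1)[OF cut]]) auto
      then have "(\<lambda>k. G (w (\<sigma> k) x) * \<psi> (\<sigma> k) x) \<longlonglongrightarrow> G (w c x) * \<psi> c x"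
        by (rule continuous_on_tendsto_compose[OF _ \<sigma>(2) c]) (use \<sigma>(1) in \<open>auto intro!: always_eventually less_imp_le\<close>)
      then show ?thesis using True by (simp add: F_def)
    qed (simp add: F_def)
    have bound: "norm (F (\<sigma> k) x) \<le> B' * indicator ?B x" for k x
      using bd[OF \<sigma>(1), of x k] nonneg[OF \<sigma>(1), of x k] D(4) by (auto simp: F_def B'_def abs_mult)
    have mc: "F c \<in> borel_measurable lborel"
      by (rule borel_measurable_LIMSEQ_real[OF pl meas[OF \<sigma>(1)]])
    have ms: "(\<lambda>x. F (\<sigma> k) x) \<in> borel_measurable lborel" for k by (rule meas[OF \<sigma>(1)])
    have "integrable lborel (\<lambda>x. F c x)"
      by (rule integrable_dominated_convergence[where s = "\<lambda>k x. F (\<sigma> k) x", OF _ ms iB])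
        (use mc pl bound in auto)
    moreover have "(\<lambda>k. \<integral>x. F (\<sigma> k) x \<partial>lborel) \<longlonglongrightarrow> (\<integral>x. F c x \<partial>lborel)"
      by (rule integral_dominated_convergence[where s = "\<lambda>k x. F (\<sigma> k) x", OF _ ms iB])
        (use mc pl bound in auto)
    ultimately show ?thesis by simp
  qed
  \<comment> \<open>The offset 3 keeps \<sigma> below half the length, so that a + \<sigma> stays to
    the left of b - \<sigma>.\<close>
  define \<sigma> where "\<sigma> = (\<lambda>k::nat. (b - a) / real (k + 3))"
  have \<sigma>: "0 < \<sigma> k" "\<sigma> k < (b - a) / 2" for k
    unfolding \<sigma>_def using ab by (auto intro: divide_strict_left_mono simp del: less_divide_eq_numeral1)
  have \<sigma>0: "\<sigma> \<longlonglongrightarrow> 0" unfolding \<sigma>_def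
    by (intro tendsto_divide_0[OF tendsto_const] filterlim_at_top_imp_at_infinity
        filterlim_compose[OF filterlim_real_sequentially] filterlim_add_const_nat_at_top)
  have l1: "integrable lborel (F a) \<and> (\<lambda>k. \<integral>x. F (a + \<sigma> k) x \<partial>lborel) \<longlonglongrightarrow> (\<integral>x. F a x \<partial>lborel)"
  proof (rule lim)
    show "a + \<sigma> k \<in> {a<..<b}" for k using \<sigma>[of k] ab by (auto simp: field_simps)
    show "(\<lambda>k. a + \<sigma> k) \<longlonglongrightarrow> a" using tendsto_add[OF tendsto_const \<sigma>0, of a] by simp
  qed (use ab in auto)
  have l2: "integrable lborel (F b) \<and> (\<lambda>k. \<integral>x. F (b - \<sigma> k) x \<partial>lborel) \<longlonglongrightarrow> (\<integral>x. F b x \<partial>lborel)"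
  proof (rule lim)
    show "b - \<sigma> k \<in> {a<..<b}" for k using \<sigma>[of k] ab by (auto simp: field_simps)
    show "(\<lambda>k. b - \<sigma> k) \<longlonglongrightarrow> b" using tendsto_diff[OF tendsto_const \<sigma>0, of b] by simp
  qed (use ab in auto)
  show "integrable lborel (F a)" using l1 by simp
  show "(\<integral>x. F b x \<partial>lborel) \<le> (\<integral>x. F a x \<partial>lborel)"
  proof (rule LIMSEQ_le[OF conjunct2[OF l2] conjunct2[OF l1]])
    have "(\<integral>x. F (b - \<sigma> k) x \<partial>lborel) \<le> (\<integral>x. F (a + \<sigma> k) x \<partial>lborel)" for k
      using \<sigma>[of k] by (intro anti) (auto simp: field_simps)
    then show "\<exists>N. \<forall>k\<ge>N. (\<integral>x. F (b - \<sigma> k) x \<partial>lborel) \<le> (\<integral>x. F (a + \<sigma> k) x \<partial>lborel)" by blast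
  qed
qed

end

text \<open>For t >= t1 > 0 the corner is avoided, so u is uniformly continuous up to the sphere;
  comparing a point with its radial projection, where u is zero, gives the layer.\<close>

lemma dirichlet_solution_boundary_layer:
  assumes u: "dirichlet_solution A n f u" and "0 < t1" "0 < \<delta>" "1 \<le> n"
  shows "\<exists>\<rho><real n. \<forall>t\<in>{t1..t2}. \<forall>x\<in>ball 0 (real n). \<rho> \<le> norm x \<longrightarrow> u t x \<le> \<delta>"
proof -
  let ?K = "{t1..t2} \<times> cball (0::real^'n) (real n)"
  have "continuous_on ?K (\<lambda>(t, x). u t x)"
    using u \<open>0 < t1\<close> unfolding dirichlet_solution_def by (auto elim!: continuous_on_subset)
  moreover have "compact ?K" by (intro compact_Times) auto
  ultimately have "uniformly_continuous_on ?K (\<lambda>(t, x). u t x)"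
    by (rule compact_uniformly_continuous)
  then obtain \<eta> where \<eta>: "0 < \<eta>"
    "\<And>p p'. p \<in> ?K \<Longrightarrow> p' \<in> ?K \<Longrightarrow> dist p' p < \<eta> \<Longrightarrow> dist ((\<lambda>(t, x). u t x) p') ((\<lambda>(t, x). u t x) p) < \<delta>"
    using \<open>0 < \<delta>\<close> unfolding uniformly_continuous_on_def by metis
  \<comment> \<open>The 1/2 keeps x away from the origin, so that it can be projected radially;
    \<open>1 \<le> n\<close> keeps \<rho> below the radius.\<close>
  define \<rho> where "\<rho> = max (real n - \<eta> / 2) (1 / 2)"
  have \<rho>: "\<rho> < real n" using \<eta>(1) \<open>1 \<le> n\<close> by (auto simp: \<rho>_def)
  have "u t x \<le> \<delta>" if "t \<in> {t1..t2}" "x \<in> ball 0 (real n)" "\<rho> \<le> norm x" for t x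
  proof -
    define y where "y = (real n / norm x) *\<^sub>R x"
    have x: "0 < norm x" "norm x < real n" using that by (auto simp: \<rho>_def)
    have ny: "norm y = real n" using x by (simp add: y_def)
    have "y - x = (real n / norm x - 1) *\<^sub>R x" by (simp add: y_def algebra_simps)
    then have "dist y x = \<bar>real n / norm x - 1\<bar> * norm x" by (simp add: dist_norm)
    also have "\<dots> = real n - norm x" using x by (simp add: abs_if field_simps)
    also have "\<dots> < \<eta>" using that(3) \<eta>(1) by (auto simp: \<rho>_def)
    finally have "dist (t, y) (t, x) < \<eta>" by (simp add: dist_Pair_Pair)
    moreover have "u t y = 0" using u that(1) \<open>0 < t1\<close> ny by (auto simp: dirichlet_solution_def)
    ultimately show ?thesis using \<eta>(2)[of "(t, x)" "(t, y)"] that x ny by (auto simp: dist_real_def)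
  qed
  then show ?thesis using \<rho> by blast
qed

section \<open>Pointwise bound for Dirichlet solutions, uniform in the radius\<close>

context diffusion begin

lemma dirichlet_solution_deriv:
  assumes "dirichlet_solution op n f u" "0 < t" "x \<in> ball 0 (real n)"
  shows "deriv (\<lambda>s. u s x) t = op (u t) x"
  using assms unfolding dirichlet_solution_def by (auto intro: DERIV_imp_deriv)

text \<open>The time interval is split in three: the weighted \<open>L\<^sup>1\<close> bound, the \<open>L\<^sup>1\<close>--\<open>L\<^sup>\<infinity>\<close>
  smoothing, and the comparison with a multiple of the supersolution \<open>\<phi>\<close> use one third each.\<close>

lemma dirichlet_solution_bound:
  fixes \<phi> u :: "real \<Rightarrow> real^'n \<Rightarrow> real"
  assumes u: "dirichlet_solution op n f u" and n: "1 \<le> n"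
    and \<phi>: "C12_in {0<..<1} UNIV \<phi>"
    and \<phi>sup: "\<And>s x. s \<in> {0<..<1} \<Longrightarrow> op (\<phi> s) x \<le> deriv (\<lambda>s. \<phi> s x) s"
    and \<phi>0: "\<And>x. \<phi> 0 x = 1" and \<phi>nn: "\<And>s x. s \<in> {0..<1} \<Longrightarrow> 0 \<le> \<phi> s x"
    and \<phi>B: "\<And>s x. s \<in> {0..<1} \<Longrightarrow> \<phi> s x \<le> B" and \<phi>c: "\<And>x. continuous_on {0..<1} (\<lambda>s. \<phi> s x)"
    and f: "\<And>x. 0 \<le> f x" and t: "0 < t" "t < 1" and fi: "integrable lborel (\<lambda>y. f y * \<phi> (t / 3) y)"
    and x: "x \<in> ball 0 (real n)"
  shows "u t x \<le> 2 * ((real CARD('n))\<^sup>2 / (4 * (t / 3))) powr (CARD('n) / 2) * 2 ^ CARD('n)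
    * (\<integral>y. f y * \<phi> (t / 3) y \<partial>lborel) * \<phi> (t / 3) x"
proof -
  let ?B = "ball 0 (real n) :: (real^'n) set"
  define \<tau> where "\<tau> = t / 3"
  define C where "C = 2 * ((real CARD('n))\<^sup>2 / (4 * \<tau>)) powr (CARD('n) / 2) * 2 ^ CARD('n)"
  define N where "N = (\<integral>y. f y * \<phi> \<tau> y \<partial>lborel)"
  have \<tau>: "0 < \<tau>" "3 * \<tau> = t" "3 * \<tau> < 1" using t by (auto simp: \<tau>_def)
  have C0: "0 \<le> C" by (simp add: C_def)
  have N0: "0 \<le> N" unfolding N_def
    by (rule Bochner_Integration.integral_nonneg) (use f \<phi>nn \<tau> in auto)
  have uC: "C12_in {0<..} ?B u" using u by (simp add: dirichlet_solution_def C12_on_eq)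
  have "bounded ((\<lambda>(t, x). u t x) ` ({0<..} \<times> ?B))" using u by (simp add: dirichlet_solution_def)
  then obtain Bu where "\<forall>z\<in>(\<lambda>(t, x). u t x) ` ({0<..} \<times> ?B). norm z \<le> Bu"
    unfolding bounded_iff by blast
  then have Bu: "\<bar>u s y\<bar> \<le> Bu" if "0 < s" "y \<in> ?B" for s y
    using that by force
  have ucl: "continuous_on {0..} (\<lambda>s. u s y)" if "y \<in> ?B" for y
  proof -
    have c: "continuous_on ({0..} \<times> cball 0 (real n) - {0} \<times> sphere 0 (real n)) (\<lambda>(t, x). u t x)"
      using u by (simp add: dirichlet_solution_def)
    have "continuous_on {0..} (\<lambda>s. (\<lambda>(t, x). u t x) (s, y))"
      by (rule continuous_on_compose2[OF c]) (use that in \<open>auto intro!: continuous_intros\<close>)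
    then show ?thesis by simp
  qed
  \<comment> \<open>The \<delta> inside \<open>N + \<delta>\<close> provides the strictly positive
    mass bound of \<open>smoothing_bound\<close>; each 3 \<delta> is the gap between the cubic
    cutoff and the identity.\<close>
  have main: "u t x \<le> (C * (N + \<delta>) + 3 * \<delta>) * \<phi> \<tau> x + 3 * \<delta>" if \<delta>: "0 < \<delta>" for \<delta>
  proof -
    let ?G = "cubic_cutoff \<delta>"
    note cut = cutoff_cubic[OF \<delta>]
    have G0: "0 \<le> ?G r" for r by (rule cutoffD(4)[OF cut])
    have GB: "?G (u s y) \<le> Bu" if "0 < s" "y \<in> ?B" for s y
      using cubic_cutoff_bounds(1)[OF \<delta>, of "u s y"] Bu[OF that] by linarith
    have ub: "\<exists>\<rho><real n. \<forall>t\<in>{t1..t2}. \<forall>x\<in>?B. \<rho> \<le> norm x \<longrightarrow> u t x \<le> \<delta>" if "0 < t1" for t1 t2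
      by (rule dirichlet_solution_boundary_layer[OF u that \<delta> n])
    \<comment> \<open>Reversed time makes \<psi> a backward supersolution, equal to 1 at the end
      \<tau> and to \<phi>(\<tau>) at the start: the mass at time \<tau> is bounded by the datum
      weighted with \<phi>(\<tau>).\<close>
    define \<psi> where "\<psi> = (\<lambda>s. \<phi> (\<tau> + (- 1) * s))"
    have R: "\<tau> + (- 1) * s \<in> {0<..<1}" if "s \<in> {0<..<\<tau>}" for s using that \<tau> by auto
    have "C12_in {0<..<\<tau>} UNIV \<psi>"
      unfolding \<psi>_def by (rule C12_in_time_affine(1)[OF \<phi> _ R]) auto
    then have \<psi>1: "C12_in {0<..<\<tau>} ?B \<psi>" by (rule C12_in_subset) auto
    have u1: "C12_in {0<..<\<tau>} ?B u" by (rule C12_in_subset[OF uC]) auto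
    let ?F = "\<lambda>s y. if y \<in> ?B then ?G (u s y) * \<psi> s y else 0"
    have sub1: "deriv (\<lambda>s. u s y) s \<le> op (u s) y" if "s \<in> {0<..<\<tau>}" "y \<in> ?B" for s y
      using dirichlet_solution_deriv[OF u, of s y] that by simp
    have sup1: "deriv (\<lambda>s. \<psi> s y) s + op (\<psi> s) y \<le> 0" if s: "s \<in> {0<..<\<tau>}" for s y
    proof -
      have "deriv (\<lambda>s. \<psi> s y) s = - deriv (\<lambda>s. \<phi> s y) (\<tau> + (- 1) * s)"
        using C12_in_time_affine(2)[OF \<phi> _ R s, of y] by (simp add: \<psi>_def)
      then show ?thesis using \<phi>sup[OF R[OF s], of y] by (simp add: \<psi>_def)
    qed
    have nn1: "0 \<le> \<psi> s y" if s: "s \<in> {0<..<\<tau>}" for s y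
      using R[OF s] \<phi>nn[of "\<tau> + (- 1) * s" y] by (simp add: \<psi>_def)
    have bd1: "?G (u s y) * \<psi> s y \<le> Bu * B" if s: "s \<in> {0<..<\<tau>}" and y: "y \<in> ?B" for s y
      using R[OF s] GB[of s y] G0 \<phi>nn[of "\<tau> + (- 1) * s" y] \<phi>B[of "\<tau> + (- 1) * s" y] s y
        Bu[of s y] unfolding \<psi>_def by (intro mult_mono) auto
    have uc1: "continuous_on {0..\<tau>} (\<lambda>s. u s y)" if "y \<in> ?B" for y
      by (rule continuous_on_subset[OF ucl[OF that]]) auto
    have \<psi>c1: "continuous_on {0..\<tau>} (\<lambda>s. \<psi> s y)" for y unfolding \<psi>_def
      by (rule continuous_on_compose2[OF \<phi>c]) (use \<tau> in \<open>auto intro!: continuous_intros\<close>)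
    have "integrable lborel (?F 0)"
      by (rule weighted_integral_mono(1)[OF cut u1 \<psi>1 sub1 sup1 nn1 ub \<tau>(1) uc1 \<psi>c1 bd1])
    moreover have "(\<integral>y. ?F \<tau> y \<partial>lborel) \<le> (\<integral>y. ?F 0 y \<partial>lborel)"
      by (rule weighted_integral_mono(2)[OF cut u1 \<psi>1 sub1 sup1 nn1 ub \<tau>(1) uc1 \<psi>c1 bd1])
    ultimately have 1: "integrable lborel (?F 0) \<and> (\<integral>y. ?F \<tau> y \<partial>lborel) \<le> (\<integral>y. ?F 0 y \<partial>lborel)" ..
    have "(\<integral>y. (if y \<in> ?B then ?G (u \<tau> y) else 0) \<partial>lborel) = (\<integral>y. ?F \<tau> y \<partial>lborel)"
      by (rule Bochner_Integration.integral_cong) (auto simp: \<psi>_def \<phi>0)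
    also have "\<dots> \<le> (\<integral>y. ?F 0 y \<partial>lborel)" using 1 by blast
    also have "\<dots> \<le> (\<integral>y. f y * \<phi> \<tau> y \<partial>lborel)"
    proof (rule integral_mono)
      show "integrable lborel (\<lambda>y. f y * \<phi> \<tau> y)" using fi by (simp add: \<tau>_def)
      show "?F 0 y \<le> f y * \<phi> \<tau> y" for y
      proof (cases "y \<in> ?B")
        case True
        then have "u 0 y = f y" using u by (simp add: dirichlet_solution_def)
        moreover have "?G (f y) \<le> f y" using cubic_cutoff_bounds(1)[OF \<delta>, of "f y"] f[of y] by simp
        moreover have "0 \<le> \<phi> \<tau> y" using \<phi>nn \<tau> by auto
        ultimately show ?thesis using True by (simp add: \<psi>_def mult_right_mono)
      next
        case False
        then show ?thesis using f[of y] \<phi>nn[of \<tau> y] \<tau> by simp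
      qed
    qed (use 1 in blast)
    also have "\<dots> \<le> N + \<delta>" using \<delta> by (simp add: N_def)
    finally have I1: "(\<integral>y. (if y \<in> ?B then ?G (u \<tau> y) else 0) \<partial>lborel) \<le> N + \<delta>" .
    \<comment> \<open>A bound for u on the whole ball at time 2 \<tau>, hence the multiple of \<phi>
      with which u is compared afterwards.\<close>
    define M where "M = C * (N + \<delta>) + 3 * \<delta>"
    have M0: "0 \<le> M" using C0 N0 \<delta> by (simp add: M_def)
    have u2: "u (\<tau> + \<tau>) y \<le> M" if y: "y \<in> ?B" for y
    proof -
      have "?G (u (\<tau> + \<tau>) y) \<le> C * (N + \<delta>)" unfolding C_def
      proof (rule smoothing_bound[OF cut, where a = 0 and b = 1 and n = "real n"])
        show "C12_in {0<..<1} ?B u" by (rule C12_in_subset[OF uC]) auto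
        show "deriv (\<lambda>s. u s x) t \<le> op (u t) x" if "t \<in> {0<..<1}" "x \<in> ?B" for t x
          using dirichlet_solution_deriv[OF u, of t x] that by simp
      qed (use ub \<tau> y N0 \<delta> I1 in auto)
      then show ?thesis using cubic_cutoff_bounds(2)[OF \<delta>, of "u (\<tau> + \<tau>) y"] by (simp add: M_def)
    qed
    define a where "a = \<tau> + \<tau>"
    \<comment> \<open>The supersolution restarted at time 2 \<tau>, where it equals 1; at the final
      time 3 \<tau> it equals \<phi>(\<tau>), the decay factor in x.\<close>
    define \<theta> where "\<theta> = (\<lambda>s. \<phi> (- a + 1 * s))"
    have R2: "- a + 1 * s \<in> {0<..<1}" if "s \<in> {a<..<a + 1}" for s using that by auto
    have "C12_in {a<..<a + 1} UNIV \<theta>"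
      unfolding \<theta>_def by (rule C12_in_time_affine(1)[OF \<phi> _ R2]) auto
    then have \<theta>1: "C12_in {a<..<a + 1} ?B \<theta>" by (rule C12_in_subset) auto
    have a: "0 < a" "a + \<tau> = t" using \<tau> by (auto simp: a_def)
    have u3: "C12_in {a<..<a + 1} ?B u" by (rule C12_in_subset[OF uC]) (use a in auto)
    define w where "w = (\<lambda>s y. u s y - M * \<theta> s y)"
    note wC = C12_in_diff_cmult[where M = M, OF u3 \<theta>1 open_ball, folded w_def]
    have wsub: "deriv (\<lambda>s. w s y) s \<le> op (w s) y" if s: "s \<in> {a<..<a + 1}" and y: "y \<in> ?B" for s y
    proof -
      have "deriv (\<lambda>s. w s y) s = deriv (\<lambda>s. u s y) s - M * deriv (\<lambda>s. \<theta> s y) s"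
        using wC(2)[OF s y] by (simp add: w_def)
      also have "\<dots> = op (u s) y - M * deriv (\<lambda>s. \<phi> s y) (- a + 1 * s)"
        using C12_in_time_affine(2)[OF \<phi> _ R2 s, of y] dirichlet_solution_deriv[OF u, of s y] s y a
        by (simp add: \<theta>_def)
      also have "\<dots> \<le> op (u s) y - M * op (\<theta> s) y"
        using \<phi>sup[OF R2[OF s], of y] M0 by (simp add: \<theta>_def mult_left_mono)
      also have "\<dots> = op (w s) y"
        unfolding w_def
        by (rule op_diff_cmult[OF C12_in_slice[OF u3 s] C12_in_slice[OF \<theta>1 s] open_ball y, symmetric])
      finally show ?thesis .
    qed
    have wle: "w s y \<le> u s y" if "s \<in> {a..<a + 1}" for s y
      using \<phi>nn[of "- a + 1 * s" y] M0 that by (simp add: w_def \<theta>_def)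
    have wb: "\<exists>\<rho><real n. \<forall>t\<in>{t1..t2}. \<forall>x\<in>?B. \<rho> \<le> norm x \<longrightarrow> w t x \<le> \<delta>" if t12: "a < t1" "t2 < a + 1" for t1 t2
    proof -
      obtain \<rho> where \<rho>: "\<rho> < real n" "\<And>t x. t \<in> {t1..t2} \<Longrightarrow> x \<in> ?B \<Longrightarrow> \<rho> \<le> norm x \<Longrightarrow> u t x \<le> \<delta>"
        using ub[of t1 t2] t12 a by fastforce
      have "w t x \<le> \<delta>" if "t \<in> {t1..t2}" "x \<in> ?B" "\<rho> \<le> norm x" for t x
        using \<rho>(2)[OF that] wle[of t x] t12 that(1) by auto
      then show ?thesis using \<rho>(1) by blast
    qed
    \<comment> \<open>The last third is halved: monotonicity carries the vanishing mass of G(w) from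
      \<open>a\<close> to \<open>b\<close>, and the smoothing bound acts from \<open>b\<close> to
      \<open>t\<close>.\<close>
    define b where "b = a + \<tau> / 2"
    have b: "a < b" "b < a + 1" "b + \<tau> / 2 = t" "t < a + 1" using \<tau> a by (auto simp: b_def)
    let ?F2 = "\<lambda>s y. if y \<in> ?B then ?G (w s y) * 1 else 0"
    have "(\<integral>y. ?F2 b y \<partial>lborel) \<le> (\<integral>y. ?F2 a y \<partial>lborel)"
    proof (rule weighted_integral_mono[OF cut C12_in_subset[OF wC(1)] C12_in_const, where B = Bu])
      fix s y assume s: "s \<in> {a<..<b}" and y: "y \<in> ?B"
      then have s': "s \<in> {a<..<a + 1}" using b by auto
      show "deriv (\<lambda>s. w s y) s \<le> op (w s) y" by (rule wsub[OF s' y])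
      show "deriv (\<lambda>s. 1) s + op (\<lambda>x. 1) y \<le> 0" using V_nonneg by (simp add: op_const)
      have "?G (w s y) \<le> max 0 (w s y)" by (rule cubic_cutoff_bounds(1)[OF \<delta>])
      also have "\<dots> \<le> Bu" using wle[of s y] Bu[of s y] s' y a by auto
      finally show "?G (w s y) * 1 \<le> Bu" by simp
    next
      fix t1 t2 assume "a < t1" "t1 \<le> t2" "t2 < b"
      then show "\<exists>\<rho><real n. \<forall>t\<in>{t1..t2}. \<forall>x\<in>?B. \<rho> \<le> norm x \<longrightarrow> w t x \<le> \<delta>"
        using b by (intro wb) auto
    next
      fix y assume y: "y \<in> ?B"
      have "continuous_on {a..b} (\<lambda>s. \<theta> s y)" unfolding \<theta>_def
        by (rule continuous_on_compose2[OF \<phi>c]) (use b in \<open>auto intro!: continuous_intros\<close>)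
      moreover have "continuous_on {a..b} (\<lambda>s. u s y)"
        by (rule continuous_on_subset[OF ucl[OF y]]) (use a in auto)
      ultimately show "continuous_on {a..b} (\<lambda>s. w s y)" unfolding w_def
        by (intro continuous_on_diff continuous_on_mult_left)
    qed (use b in auto)
    \<comment> \<open>At time \<open>a\<close> the supersolution is 1, so w = u - M <= 0 and the
      cutoff annihilates it.\<close>
    also have "\<dots> = (\<integral>y. 0 \<partial>(lborel :: (real^'n) measure))"
    proof (rule Bochner_Integration.integral_cong[OF refl])
      fix y
      show "?F2 a y = 0"
      proof (cases "y \<in> ?B")
        case True
        then have "w a y \<le> \<delta>" using u2[OF True] \<delta> by (simp add: w_def \<theta>_def \<phi>0 flip: a_def)
        then show ?thesis by (simp add: cubic_cutoff_def)
      qed simp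
    qed
    also have "\<dots> = 0" by simp
    finally have I2: "(\<integral>y. (if y \<in> ?B then ?G (w b y) else 0) \<partial>lborel) \<le> 0"
      unfolding mult_1_right .
    define C' where "C' = 2 * ((real CARD('n))\<^sup>2 / (4 * (\<tau> / 2))) powr (CARD('n) / 2) * 2 ^ CARD('n)"
    have C': "0 \<le> C'" by (simp add: C'_def)
    \<comment> \<open>Zero mass is bounded by every e > 0, so the smoothing bound forces G(w) to
      vanish at the final time.\<close>
    have "?G (w (b + \<tau> / 2) x) \<le> C' * e" if "0 < e" for e
      unfolding C'_def
      by (rule smoothing_bound[OF cut wC(1) wsub wb]) (use that I2 b \<tau> x in auto)
    then have *: "?G (w t x) \<le> C' * e" if "0 < e" for e using that b by simp
    have "?G (w t x) \<le> 0"
    proof (rule field_le_epsilon)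
      fix e :: real assume "0 < e"
      then have "?G (w t x) \<le> C' * (e / (C' + 1))" using C' by (intro *) (auto intro!: divide_pos_pos add_nonneg_pos)
      also have "\<dots> \<le> e" using C' \<open>0 < e\<close> by (simp add: field_simps)
      finally show "?G (w t x) \<le> 0 + e" by simp
    qed
    then have "w t x \<le> 3 * \<delta>" using cubic_cutoff_bounds(2)[OF \<delta>, of "w t x"] by simp
    moreover have "- a + 1 * t = \<tau>" using a by simp
    ultimately show ?thesis by (simp add: w_def \<theta>_def M_def)
  qed
  have p0: "0 \<le> \<phi> \<tau> x" using \<phi>nn \<tau> by simp
  have "u t x \<le> C * N * \<phi> \<tau> x"
  proof (rule field_le_epsilon)
    fix e :: real assume e: "0 < e"
    \<comment> \<open>K is the coefficient of \<delta> in \<open>main\<close>, so that \<delta> = e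
      / K costs exactly e.\<close>
    define K where "K = (C + 3) * \<phi> \<tau> x + 3"
    have K: "0 < K" using C0 p0 by (simp add: K_def add_nonneg_pos)
    have "u t x \<le> (C * (N + e / K) + 3 * (e / K)) * \<phi> \<tau> x + 3 * (e / K)"
      using e K by (intro main) simp
    also have "\<dots> = C * N * \<phi> \<tau> x + (e / K) * K" by (simp add: K_def algebra_simps add_divide_distrib)
    also have "(e / K) * K = e" using K by simp
    finally show "u t x \<le> C * N * \<phi> \<tau> x + e" .
  qed
  then show ?thesis by (simp add: C_def N_def \<tau>_def)
qed

end

section \<open>Coefficients and supersolution\<close>

text \<open>Away from the origin the function is (x . x)^(m/2). At the origin, |y|^m <= |y|^2 for
  |y| <= 1 shows that the derivative is zero, in agreement with the formula, whose vector factor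
  vanishes there.\<close>

lemma norm_powr_has_derivative:
  fixes x :: "'a::real_inner"
  assumes "2 \<le> m"
  shows "((\<lambda>x. norm x powr m) has_derivative (\<lambda>h. (m * norm x powr (m - 2)) *\<^sub>R x \<bullet> h)) (at x)"
proof (cases "x = 0")
  case True
  have "((\<lambda>x::'a. norm x powr m) has_derivative (\<lambda>_. 0)) (at 0)"
  proof (rule has_derivativeI_sandwich[where e = 1])
    show "((\<lambda>y::'a. norm y) \<longlongrightarrow> 0) (at 0)" using tendsto_norm_zero[OF tendsto_ident_at] .
    fix y :: 'a assume "y \<noteq> 0" "dist y 0 < 1"
    then have y: "0 < norm y" "norm y \<le> 1" by auto
    have "norm y powr m \<le> norm y powr 2" using y assms by (intro powr_mono') auto
    then show "norm (norm y powr m - norm (0::'a) powr m - 0) / norm (y - 0) \<le> norm y"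
      using y by (simp add: power2_eq_square divide_simps)
  qed (auto intro: bounded_linear_zero)
  then show ?thesis using True by simp
next
  case False
  have n: "(z \<bullet> z) powr a = norm z powr (2 * a)" for z :: 'a and a
    by (simp add: power2_norm_eq_inner[symmetric] powr_powr flip: powr_numeral)
  have pos: "0 < x \<bullet> x" using False by simp
  have "((\<lambda>z. z \<bullet> z) has_derivative (\<lambda>h. x \<bullet> h + h \<bullet> x)) (at x)"
    by (rule has_derivative_inner[OF has_derivative_ident has_derivative_ident])
  moreover have "((\<lambda>r. r powr (m / 2)) has_derivative (\<lambda>h. h * (m / 2 * (x \<bullet> x) powr (m / 2 - 1)))) (at (x \<bullet> x))"
    using has_real_derivative_powr[OF pos, of "m / 2"] unfolding has_field_derivative_def
    by (rule has_derivative_eq_rhs) auto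
  ultimately have "((\<lambda>z. (z \<bullet> z) powr (m / 2)) has_derivative
      (\<lambda>h. (x \<bullet> h + h \<bullet> x) * (m / 2 * (x \<bullet> x) powr (m / 2 - 1)))) (at x)"
    by (rule has_derivative_compose)
  then have "((\<lambda>z. norm z powr m) has_derivative
      (\<lambda>h. (x \<bullet> h + h \<bullet> x) * (m / 2 * norm x powr (m - 2)))) (at x)"
    unfolding n by (simp add: right_diff_distrib)
  then show ?thesis
    by (rule has_derivative_eq_rhs) (auto simp: inner_commute algebra_simps)
qed

lemma continuous_on_norm_powr_scaleR:
  assumes "2 \<le> m"
  shows "continuous_on UNIV (\<lambda>x::'a::real_normed_vector. (norm x powr (m - 2)) *\<^sub>R x)"
proof (cases "m = 2")
  \<comment> \<open>For m = 2 the scalar factor is discontinuous at the origin, since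
    \<open>0 powr 0\<close> is 0, but the vector \<open>x\<close> hides the jump and the product is
    the identity.\<close>
  case True
  show ?thesis by (rule continuous_on_eq[OF continuous_on_id]) (auto simp: True)
next
  case False
  then show ?thesis using assms
    by (intro continuous_on_scaleR continuous_on_powr' continuous_intros) auto
qed

lemma diffusion_exp_powr:
  assumes "2 \<le> m" "0 < s"
  shows "diffusion (\<lambda>x::real^'n. exp (norm x powr m)) (\<lambda>x. exp (norm x powr s))"
    "grad (\<lambda>x::real^'n. exp (norm x powr m)) x = (exp (norm x powr m) * (m * norm x powr (m - 2))) *\<^sub>R x"
proof -
  have d: "((\<lambda>x::real^'n. exp (norm x powr m)) has_derivative
      (\<lambda>h. ((exp (norm x powr m) * (m * norm x powr (m - 2))) *\<^sub>R x) \<bullet> h)) (at x)" for x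
    using has_derivative_exp[OF norm_powr_has_derivative[OF assms(1), of x]]
    by (rule has_derivative_eq_rhs) auto
  have g: "grad (\<lambda>x::real^'n. exp (norm x powr m)) x = (exp (norm x powr m) * (m * norm x powr (m - 2))) *\<^sub>R x" for x
    by (rule grad_eqI[OF d])
  show "grad (\<lambda>x::real^'n. exp (norm x powr m)) x = (exp (norm x powr m) * (m * norm x powr (m - 2))) *\<^sub>R x"
    by (rule g)
  have c: "continuous_on UNIV (\<lambda>x::real^'n. exp (norm x powr r))" if "0 < r" for r
    using that by (intro continuous_on_exp continuous_on_powr' continuous_intros) auto
  have "continuous_on UNIV (\<lambda>x::real^'n. (exp (norm x powr m) * m) *\<^sub>R ((norm x powr (m - 2)) *\<^sub>R x))"
    using assms by (intro continuous_on_scaleR continuous_on_norm_powr_scaleR continuous_on_mult c continuous_on_const) auto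
  then have "continuous_on UNIV (grad (\<lambda>x::real^'n. exp (norm x powr m)))"
    by (rule continuous_on_eq) (simp add: g mult_ac)
  then show "diffusion (\<lambda>x::real^'n. exp (norm x powr m)) (\<lambda>x. exp (norm x powr s))"
    using d c[OF assms(2)] by (intro diffusion.intro) (auto simp: differentiable_def)
qed

text \<open>Radial functions are written in x . x rather than in |x| to stay smooth at the origin.
  The profile is differentiable for r > -1, an open set containing all values of x . x, so two-sided
  derivatives exist at r = 0.\<close>

lemma radial_C2:
  fixes x :: "real^'n"
  assumes g: "\<And>r. -1 < r \<Longrightarrow> (g has_real_derivative g1 r) (at r)"
    and g1: "\<And>r. -1 < r \<Longrightarrow> (g1 has_real_derivative g2 r) (at r)"
  shows "(\<lambda>z. g (z \<bullet> z)) differentiable (at x)"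
    "grad (\<lambda>z. g (z \<bullet> z)) x = (2 * g1 (x \<bullet> x)) *\<^sub>R x"
    "grad (\<lambda>z. g (z \<bullet> z)) differentiable (at x)"
    "hessian (\<lambda>z. g (z \<bullet> z)) x
      = (\<chi> i j. 4 * g2 (x \<bullet> x) * x $ i * x $ j + 2 * g1 (x \<bullet> x) * axis j 1 $ i)"
proof -
  have i: "((\<lambda>z::real^'n. z \<bullet> z) has_derivative (\<lambda>h. (2 *\<^sub>R x) \<bullet> h)) (at x)" for x
    by (rule has_derivative_eq_rhs[OF has_derivative_inner[OF has_derivative_ident has_derivative_ident]])
       (auto simp: inner_commute)
  have p: "-1 < z \<bullet> z" for z :: "real^'n" using inner_ge_zero[of z] by linarith
  have di: "(\<lambda>z::real^'n. z \<bullet> z) differentiable (at x)" and gi: "grad (\<lambda>z::real^'n. z \<bullet> z) x = 2 *\<^sub>R x" for x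
    using i grad_eqI[OF i] by (auto simp: differentiable_def)
  show "(\<lambda>z. g (z \<bullet> z)) differentiable (at x)"
    using grad_scale_comp(1)[OF di g[OF p]] .
  have G: "grad (\<lambda>z::real^'n. g (z \<bullet> z)) = (\<lambda>x. (2 * g1 (x \<bullet> x)) *\<^sub>R x)"
    using grad_scale_comp(2)[OF di g[OF p]] by (intro ext) (simp add: gi mult.commute)
  then show "grad (\<lambda>z. g (z \<bullet> z)) x = (2 * g1 (x \<bullet> x)) *\<^sub>R x" by simp
  have d1: "(\<lambda>z. 2 * g1 (z \<bullet> z)) differentiable (at x)"
    using grad_scale_comp(1)[OF di g1[OF p]] by (intro differentiable_mult) auto
  have g1': "grad (\<lambda>z. 2 * g1 (z \<bullet> z)) x = (4 * g2 (x \<bullet> x)) *\<^sub>R x"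
    using grad_cmult[OF grad_scale_comp(1)[OF di g1[OF p]], of 2 x] grad_scale_comp(2)[OF di g1[OF p], of x]
    by (simp add: gi)
  note D = has_derivative_scaleR_grad[OF d1 differentiable_ident]
  then show "grad (\<lambda>z. g (z \<bullet> z)) differentiable (at x)" unfolding G by (auto simp: differentiable_def)
  show "hessian (\<lambda>z. g (z \<bullet> z)) x
      = (\<chi> i j. 4 * g2 (x \<bullet> x) * x $ i * x $ j + 2 * g1 (x \<bullet> x) * axis j 1 $ i)"
    unfolding hessian_def G jacobian_eq[OF D] g1'
    by (simp add: vec_eq_iff frechet_derivative_ident inner_axis)
qed

text \<open>Beyond \<open>r0\<close> one has r^(b-a) >= A + C and r^a >= 1, hence r^b >= A r^a + C;
  the factor C is at most exp C. Up to \<open>r0\<close> the left side is bounded by its value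
  there, which serves as K.\<close>

lemma exp_powr_dominates:
  fixes a b A C :: real
  assumes "0 < a" "a < b" "0 \<le> A" "0 \<le> C"
  shows "\<exists>K\<ge>0. \<forall>r\<ge>0. C * exp (A * r powr a) \<le> exp (r powr b) + K"
proof -
  define r0 where "r0 = max 1 ((A + C) powr (1 / (b - a)))"
  have "C * exp (A * r powr a) \<le> exp (r powr b) + C * exp (A * r0 powr a)" if "0 \<le> r" for r
  proof (cases "r \<le> r0")
    case True
    then have "r powr a \<le> r0 powr a" using that assms(1) by (intro powr_mono2) auto
    then have "C * exp (A * r powr a) \<le> C * exp (A * r0 powr a)"
      using assms by (intro mult_left_mono) (auto intro: mult_left_mono)
    then show ?thesis by (simp add: add_increasing)
  next
    case False
    then have r: "1 \<le> r" "(A + C) powr (1 / (b - a)) \<le> r" by (auto simp: r0_def)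
    have ra: "1 \<le> r powr a" using r(1) assms(1) by (simp add: ge_one_powr_ge_zero)
    have "A + C = ((A + C) powr (1 / (b - a))) powr (b - a)"
      using assms by (simp add: powr_powr)
    also have "\<dots> \<le> r powr (b - a)" using r assms by (intro powr_mono2) auto
    finally have "(A + C) * r powr a \<le> r powr (b - a) * r powr a" by (intro mult_right_mono) auto
    also have "\<dots> = r powr b" by (simp flip: powr_add)
    finally have "A * r powr a + C * r powr a \<le> r powr b" by (simp add: algebra_simps)
    moreover have "C * 1 \<le> C * r powr a" using ra assms by (intro mult_left_mono) auto
    ultimately have "exp (C + A * r powr a) \<le> exp (r powr b)" by simp
    moreover have "C \<le> exp C" using exp_ge_add_one_self[of C] by linarith
    then have "C * exp (A * r powr a) \<le> exp C * exp (A * r powr a)" by (intro mult_right_mono) auto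
    moreover have "0 \<le> C * exp (A * r0 powr a)" using assms by simp
    ultimately show ?thesis unfolding exp_add by linarith
  qed
  moreover have "0 \<le> C * exp (A * r0 powr a)" using assms by simp
  ultimately show ?thesis by blast
qed

text \<open>The first summand is the only unfavourable part of the diffusion applied to phi, the
  second comes from its time derivative. Both are at most a constant times exp(A r^\<sigma>), which
  exp(r^s) dominates since \<sigma> < s.\<close>

lemma supersolution_inequality:
  fixes m s \<sigma> :: real
  assumes "2 \<le> m" "m < \<sigma>" "\<sigma> < s" "0 \<le> a" "0 \<le> b"
  shows "\<exists>K\<ge>0. \<forall>r\<ge>0. a * exp (r powr m) * ((1 + r\<^sup>2) powr (\<sigma> / 2 - 1) * exp ((1 + r\<^sup>2) powr (\<sigma> / 2)) * r)\<^sup>2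
    + b * exp ((1 + r\<^sup>2) powr (\<sigma> / 2)) \<le> exp (r powr s) + K"
proof -
  \<comment> \<open>The exponent to control is r^m + 3 Y with r^m <= 1 + r^\<sigma> and Y <=
    2^(\<sigma>/2) (1 + r^\<sigma>): two copies of Y come from the squared exponential and one from
    Y^2 <= 2 exp Y.\<close>
  define A where "A = 1 + 3 * 2 powr (\<sigma> / 2)"
  have A: "0 \<le> A" by (simp add: A_def)
  obtain K where K: "0 \<le> K" "\<And>r. 0 \<le> r \<Longrightarrow> (2 * a + b) * exp A * exp (A * r powr \<sigma>) \<le> exp (r powr s) + K"
    using exp_powr_dominates[of \<sigma> s A "(2 * a + b) * exp A"] assms A by auto
  have "a * exp (r powr m) * ((1 + r\<^sup>2) powr (\<sigma> / 2 - 1) * exp ((1 + r\<^sup>2) powr (\<sigma> / 2)) * r)\<^sup>2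
    + b * exp ((1 + r\<^sup>2) powr (\<sigma> / 2)) \<le> (2 * a + b) * exp A * exp (A * r powr \<sigma>)" if r: "0 \<le> r" for r
  proof -
    define Y where "Y = (1 + r\<^sup>2) powr (\<sigma> / 2)"
    have Y0: "0 \<le> Y" by (simp add: Y_def)
    have one: "1 \<le> 1 + r\<^sup>2" by simp
    have "((1 + r\<^sup>2) powr (\<sigma> / 2 - 1) * r)\<^sup>2 \<le> Y\<^sup>2"
    proof (rule power_mono)
      have "r \<le> 1 + r\<^sup>2" using sum_squares_bound[of r 1] r by (simp add: power2_eq_square)
      then have "(1 + r\<^sup>2) powr (\<sigma> / 2 - 1) * r \<le> (1 + r\<^sup>2) powr (\<sigma> / 2 - 1) * (1 + r\<^sup>2) powr 1"
        using one by (intro mult_left_mono) auto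
      also have "\<dots> = Y" unfolding Y_def powr_add[symmetric] by simp
      finally show "(1 + r\<^sup>2) powr (\<sigma> / 2 - 1) * r \<le> Y" .
    qed (use r in auto)
    also have "Y\<^sup>2 \<le> 2 * exp Y"
      using exp_lower_Taylor_quadratic[OF Y0] Y0 by (simp add: power2_eq_square)
    finally have 1: "((1 + r\<^sup>2) powr (\<sigma> / 2 - 1) * r)\<^sup>2 \<le> 2 * exp Y" .
    have rm: "r powr m \<le> 1 + r powr \<sigma>"
    proof (cases "r \<le> 1")
      case True
      then have "r powr m \<le> 1" using r assms by (intro powr_le1) auto
      then show ?thesis by (simp add: add_increasing2)
    next
      case False
      then have "r powr m \<le> r powr \<sigma>" using assms by (intro powr_mono) auto
      then show ?thesis by simp
    qed
    have Y: "Y \<le> 2 powr (\<sigma> / 2) * (1 + r powr \<sigma>)"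
    proof (cases "r \<le> 1")
      case True
      then have "r\<^sup>2 \<le> 1" using r by (simp add: power_le_one)
      then have "Y \<le> 2 powr (\<sigma> / 2)" unfolding Y_def using assms by (intro powr_mono2) auto
      also have "\<dots> \<le> 2 powr (\<sigma> / 2) * (1 + r powr \<sigma>)" by (simp add: mult_le_cancel_left1)
      finally show ?thesis .
    next
      case False
      then have "1 \<le> r\<^sup>2" by (simp add: one_le_power)
      then have "Y \<le> (2 * r\<^sup>2) powr (\<sigma> / 2)" unfolding Y_def using assms by (intro powr_mono2) auto
      also have "\<dots> = 2 powr (\<sigma> / 2) * (r powr 2) powr (\<sigma> / 2)" using r by (simp add: powr_mult)
      also have "(r powr 2) powr (\<sigma> / 2) = r powr \<sigma>" unfolding powr_powr by simp
      also have "2 powr (\<sigma> / 2) * r powr \<sigma> \<le> 2 powr (\<sigma> / 2) * (1 + r powr \<sigma>)" by (intro mult_left_mono) auto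
      finally show ?thesis .
    qed
    have ex: "r powr m + 3 * Y \<le> A + A * r powr \<sigma>"
      using rm Y unfolding A_def by (simp add: algebra_simps)
    have "exp (r powr m) * ((1 + r\<^sup>2) powr (\<sigma> / 2 - 1) * exp Y * r)\<^sup>2
        = exp (r powr m) * ((1 + r\<^sup>2) powr (\<sigma> / 2 - 1) * r)\<^sup>2 * (exp Y)\<^sup>2"
      by (simp add: power_mult_distrib)
    also have "\<dots> \<le> exp (r powr m) * (2 * exp Y) * (exp Y)\<^sup>2"
      using 1 by (intro mult_right_mono mult_left_mono) auto
    also have "\<dots> = 2 * exp (r powr m + 3 * Y)"
      by (simp add: exp_add power2_eq_square exp_double[symmetric] flip: exp_add)
    finally have 2: "exp (r powr m) * ((1 + r\<^sup>2) powr (\<sigma> / 2 - 1) * exp Y * r)\<^sup>2 \<le> 2 * exp (r powr m + 3 * Y)" .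
    have 3: "exp Y \<le> exp (r powr m + 3 * Y)" using Y0 by simp
    have "a * (exp (r powr m) * ((1 + r\<^sup>2) powr (\<sigma> / 2 - 1) * exp Y * r)\<^sup>2) + b * exp Y
        \<le> a * (2 * exp (r powr m + 3 * Y)) + b * exp (r powr m + 3 * Y)"
      using 2 3 assms by (intro add_mono mult_left_mono) auto
    also have "\<dots> = (2 * a + b) * exp (r powr m + 3 * Y)" by (simp add: algebra_simps)
    also have "\<dots> \<le> (2 * a + b) * exp (A + A * r powr \<sigma>)"
      using ex assms by (intro mult_left_mono) auto
    finally show ?thesis by (simp add: Y_def exp_add mult_ac)
  qed
  then show ?thesis using K by (intro exI[of _ K]) (auto intro: order_trans)
qed

section \<open>The explicit supersolution and its comparison with the claimed decay\<close>

definition exp_weight :: "real \<Rightarrow> real \<Rightarrow> real" where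
  "exp_weight \<sigma> r = exp ((1 + r) powr (\<sigma> / 2))"

definition exp_weight1 :: "real \<Rightarrow> real \<Rightarrow> real" where
  "exp_weight1 \<sigma> r = exp_weight \<sigma> r * (\<sigma> / 2 * (1 + r) powr (\<sigma> / 2 - 1))"

definition exp_weight2 :: "real \<Rightarrow> real \<Rightarrow> real" where
  "exp_weight2 \<sigma> r = exp_weight1 \<sigma> r * (\<sigma> / 2 * (1 + r) powr (\<sigma> / 2 - 1))
    + exp_weight \<sigma> r * (\<sigma> / 2 * ((\<sigma> / 2 - 1) * (1 + r) powr (\<sigma> / 2 - 1 - 1)))"

lemma exp_weight_derivatives:
  assumes "-1 < r"
  shows "(exp_weight \<sigma> has_real_derivative exp_weight1 \<sigma> r) (at r)"
    "(exp_weight1 \<sigma> has_real_derivative exp_weight2 \<sigma> r) (at r)"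
proof -
  have p: "((\<lambda>r. (1 + r) powr a) has_real_derivative a * (1 + r) powr (a - 1)) (at r)" for a
  proof -
    have "((\<lambda>r. 1 + r) has_real_derivative 1) (at r)" by (auto intro!: derivative_eq_intros)
    from DERIV_chain2[OF has_real_derivative_powr[of "1 + r" a] this] show ?thesis using assms by simp
  qed
  show 1: "(exp_weight \<sigma> has_real_derivative exp_weight1 \<sigma> r) (at r)"
    unfolding exp_weight_def[abs_def] exp_weight1_def by (rule DERIV_chain2[OF DERIV_exp p])
  have "exp_weight1 \<sigma> = (\<lambda>r. exp_weight \<sigma> r * (\<sigma> / 2 * (1 + r) powr (\<sigma> / 2 - 1)))"
    by (auto simp: exp_weight1_def)
  then show "(exp_weight1 \<sigma> has_real_derivative exp_weight2 \<sigma> r) (at r)"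
    using DERIV_mult[OF 1 DERIV_cmult[OF p, of "\<sigma> / 2" "\<sigma> / 2 - 1"]]
    by (simp add: exp_weight2_def mult.commute add.commute)
qed

lemma exp_weight_nonneg:
  assumes "2 \<le> \<sigma>"
  shows "0 < exp_weight \<sigma> r" "0 \<le> exp_weight1 \<sigma> r" "0 \<le> exp_weight2 \<sigma> r"
  using assms by (auto simp: exp_weight_def exp_weight1_def exp_weight2_def)

text \<open>The function phi with a free rate \<open>\<eta>\<close>. At t = 0 it is 1 because
  \<open>0 powr \<alpha>\<close> is 0, and the weight takes |x|^2 as its argument to be smooth at
  the origin.\<close>

definition barrier :: "real \<Rightarrow> real \<Rightarrow> real \<Rightarrow> real \<Rightarrow> real \<Rightarrow> real^'n \<Rightarrow> real" where
  "barrier K \<eta> \<alpha> \<sigma> t x = exp (K * t - \<eta> * t powr \<alpha> * exp_weight \<sigma> (x \<bullet> x))"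

lemma barrier_derivatives:
  fixes x :: "real^'n" and K \<eta> \<alpha> \<sigma> t :: real
  defines "c \<equiv> \<lambda>t. \<eta> * t powr \<alpha>" and "b \<equiv> barrier K \<eta> \<alpha> \<sigma>"
  shows "0 < t \<Longrightarrow> ((\<lambda>s. b s x) has_real_derivative
      (K - \<eta> * (\<alpha> * t powr (\<alpha> - 1)) * exp_weight \<sigma> (x \<bullet> x)) * b t x) (at t)"
    and "b t differentiable (at x)"
    and "grad (b t) x = (- 2 * c t * exp_weight1 \<sigma> (x \<bullet> x) * b t x) *\<^sub>R x"
    and "grad (b t) differentiable (at x)"
    and "hessian (b t) x = (\<chi> i j. 4 * ((c t * exp_weight1 \<sigma> (x \<bullet> x))\<^sup>2 - c t * exp_weight2 \<sigma> (x \<bullet> x))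
      * b t x * x $ i * x $ j - 2 * c t * exp_weight1 \<sigma> (x \<bullet> x) * b t x * axis j 1 $ i)"
proof -
  let ?E = "exp_weight \<sigma>" and ?E1 = "exp_weight1 \<sigma>" and ?E2 = "exp_weight2 \<sigma>"
  show "((\<lambda>s. b s x) has_real_derivative (K - \<eta> * (\<alpha> * t powr (\<alpha> - 1)) * ?E (x \<bullet> x)) * b t x) (at t)"
    if "0 < t"
  proof -
    have "((\<lambda>s. K * s - \<eta> * s powr \<alpha> * ?E (x \<bullet> x)) has_real_derivative
        K - \<eta> * (\<alpha> * t powr (\<alpha> - 1)) * ?E (x \<bullet> x)) (at t)"
      by (intro DERIV_diff DERIV_cmult_Id DERIV_cmult_right DERIV_cmult has_real_derivative_powr that)
    from DERIV_chain2[OF DERIV_exp this] show ?thesis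
      unfolding b_def barrier_def by (simp add: mult.commute)
  qed
  define g where "g = (\<lambda>r. exp (K * t - c t * ?E r))"
  have g: "(g has_real_derivative - (c t * ?E1 r) * g r) (at r)" if "-1 < r" for r
  proof -
    have "((\<lambda>r. K * t - c t * ?E r) has_real_derivative 0 - c t * ?E1 r) (at r)"
      by (intro DERIV_diff DERIV_const DERIV_cmult exp_weight_derivatives that)
    from DERIV_chain2[OF DERIV_exp this] show ?thesis unfolding g_def by (simp add: mult.commute)
  qed
  have g1: "((\<lambda>r. - (c t * ?E1 r) * g r) has_real_derivative ((c t * ?E1 r)\<^sup>2 - c t * ?E2 r) * g r) (at r)"
    if "-1 < r" for r
  proof -
    have "((\<lambda>r. - (c t * ?E1 r)) has_real_derivative - (c t * ?E2 r)) (at r)"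
      by (intro DERIV_minus DERIV_cmult exp_weight_derivatives that)
    from DERIV_mult[OF this g[OF that]] show ?thesis
      by (rule DERIV_cong) (simp add: power2_eq_square algebra_simps)
  qed
  have b: "b t = (\<lambda>z. g (z \<bullet> z))" by (auto simp: b_def barrier_def g_def c_def)
  note R = radial_C2[OF g g1, of x]
  show "b t differentiable (at x)" "grad (b t) differentiable (at x)"
    unfolding b using R(1,3) by auto
  show "grad (b t) x = (- 2 * c t * ?E1 (x \<bullet> x) * b t x) *\<^sub>R x"
    unfolding b by (subst radial_C2(2), erule g, erule g1) simp
  show "hessian (b t) x = (\<chi> i j. 4 * ((c t * ?E1 (x \<bullet> x))\<^sup>2 - c t * ?E2 (x \<bullet> x))
      * b t x * x $ i * x $ j - 2 * c t * ?E1 (x \<bullet> x) * b t x * axis j 1 $ i)"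
    unfolding b by (subst radial_C2(4), erule g, erule g1) (simp add: vec_eq_iff)
qed

lemma barrier_C12: "C12_in {0<..<1} UNIV (barrier K \<eta> \<alpha> \<sigma> :: real \<Rightarrow> real^'n \<Rightarrow> real)"
proof -
  let ?b = "barrier K \<eta> \<alpha> \<sigma> :: real \<Rightarrow> real^'n \<Rightarrow> real"
  let ?S = "{0<..<1::real} \<times> (UNIV :: (real^'n) set)"
  note D = barrier_derivatives[where K = K and \<eta> = \<eta> and \<alpha> = \<alpha> and \<sigma> = \<sigma>]
  have pw: "continuous_on ?S (\<lambda>p. fst p powr a)" for a
    by (rule continuous_on_powr) (auto intro!: continuous_intros)
  have cr: "continuous_on ?S (\<lambda>p. h (snd p \<bullet> snd p))"
    if "\<And>r. -1 < r \<Longrightarrow> isCont h r" for h :: "real \<Rightarrow> real"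
  proof -
    have "continuous_on {0..} h" using that by (intro continuous_at_imp_continuous_on) auto
    then show ?thesis by (rule continuous_on_compose2) (auto intro!: continuous_intros)
  qed
  have p: "((\<lambda>r. (1 + r) powr a) has_real_derivative a * (1 + r) powr (a - 1)) (at r)" if "-1 < r" for r a
  proof -
    have "((\<lambda>r. 1 + r) has_real_derivative 1) (at r)" by (auto intro!: derivative_eq_intros)
    from DERIV_chain2[OF has_real_derivative_powr[of "1 + r" a] this] show ?thesis using that by simp
  qed
  have E: "isCont (exp_weight \<sigma>) r" "isCont (exp_weight1 \<sigma>) r" "isCont (exp_weight2 \<sigma>) r" if "-1 < r" for r
  proof -
    note d = exp_weight_derivatives[OF that, of \<sigma>, THEN DERIV_isCont]
    have q: "isCont (\<lambda>r. (1 + r) powr a) r" for a using p[OF that] DERIV_isCont by blast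
    show "isCont (exp_weight \<sigma>) r" "isCont (exp_weight1 \<sigma>) r" using d by auto
    show "isCont (exp_weight2 \<sigma>) r"
      unfolding exp_weight2_def[abs_def] by (intro continuous_intros d q)
  qed
  note ce = cr[OF E(1)] cr[OF E(2)] cr[OF E(3)]
  have cb: "continuous_on ?S (\<lambda>p. ?b (fst p) (snd p))"
    unfolding barrier_def by (intro continuous_intros pw ce)
  have cx: "continuous_on ?S (\<lambda>p. snd p)" by (intro continuous_intros)
  have "continuous_on ?S (\<lambda>p. (K - \<eta> * (\<alpha> * fst p powr (\<alpha> - 1)) * exp_weight \<sigma> (snd p \<bullet> snd p)) * ?b (fst p) (snd p))"
    by (intro continuous_intros pw ce cb)
  then have c1: "continuous_on ?S (\<lambda>p. deriv (\<lambda>s. ?b s (snd p)) (fst p))"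
    by (rule continuous_on_eq) (auto intro!: DERIV_imp_deriv[symmetric] D(1))
  have "continuous_on ?S (\<lambda>p. (- 2 * (\<eta> * fst p powr \<alpha>) * exp_weight1 \<sigma> (snd p \<bullet> snd p) * ?b (fst p) (snd p)) *\<^sub>R snd p)"
    by (intro continuous_intros pw ce cb)
  then have c2: "continuous_on ?S (\<lambda>p. grad (?b (fst p)) (snd p))"
    by (rule continuous_on_eq) (simp add: D(3))
  have "continuous_on ?S (\<lambda>p. \<chi> i j. 4 * ((\<eta> * fst p powr \<alpha> * exp_weight1 \<sigma> (snd p \<bullet> snd p))\<^sup>2
      - \<eta> * fst p powr \<alpha> * exp_weight2 \<sigma> (snd p \<bullet> snd p)) * ?b (fst p) (snd p) * snd p $ i * snd p $ j
      - 2 * (\<eta> * fst p powr \<alpha>) * exp_weight1 \<sigma> (snd p \<bullet> snd p) * ?b (fst p) (snd p) * axis j 1 $ i)"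
    by (intro continuous_intros pw ce cb)
  then have c3: "continuous_on ?S (\<lambda>p. hessian (?b (fst p)) (snd p))"
    by (rule continuous_on_eq) (simp add: D(5))
  have "(\<lambda>s. ?b s x) differentiable (at t)" if "0 < t" for t x
    using D(1)[OF that] real_differentiable_def by blast
  then show ?thesis
    unfolding C12_in_def case_prod_unfold using cb c1 c2 c3 D(2,4) by auto
qed

text \<open>After division by the positive barrier, the term with grad q, the term with the second
  derivative of the weight and the term proportional to the dimension are all nonpositive. Only 4 q
  (c E1)^2 |x|^2 competes with V; t < 1 bounds c by \<eta>, and \<alpha> >= 1 bounds t^(\<alpha> -
  1) by 1.\<close>

lemma barrier_supersolution:
  fixes x :: "real^'n" and K \<eta> \<alpha> \<sigma> m s t :: real
  assumes "2 \<le> m" "2 \<le> \<sigma>" "0 < s" "0 \<le> \<eta>" "1 \<le> \<alpha>" and t: "t \<in> {0<..<1}"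
    and K: "\<And>r. 0 \<le> r \<Longrightarrow> (\<eta> * \<sigma>)\<^sup>2 * exp (r powr m)
      * ((1 + r\<^sup>2) powr (\<sigma> / 2 - 1) * exp ((1 + r\<^sup>2) powr (\<sigma> / 2)) * r)\<^sup>2
      + \<eta> * \<alpha> * exp ((1 + r\<^sup>2) powr (\<sigma> / 2)) \<le> exp (r powr s) + K"
  defines "b \<equiv> barrier K \<eta> \<alpha> \<sigma>"
  shows "diffusion.op (\<lambda>x. exp (norm x powr m)) (\<lambda>x. exp (norm x powr s)) (b t) x \<le> deriv (\<lambda>s. b s x) t"
proof -
  interpret diffusion "\<lambda>x::real^'n. exp (norm x powr m)" "\<lambda>x. exp (norm x powr s)"
    using assms by (intro diffusion_exp_powr) auto
  note D = barrier_derivatives[where t = t and K = K and \<eta> = \<eta> and \<alpha> = \<alpha> and \<sigma> = \<sigma> and x = x, folded b_def]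
  define c where "c = \<eta> * t powr \<alpha>"
  define r where "r = norm x"
  define E where "E = exp_weight \<sigma> (x \<bullet> x)"
  define E1 where "E1 = exp_weight1 \<sigma> (x \<bullet> x)"
  define E2 where "E2 = exp_weight2 \<sigma> (x \<bullet> x)"
  define q where "q = exp (r powr m)"
  have b: "0 < b t x" by (simp add: b_def barrier_def)
  have E: "0 < E" "0 \<le> E1" "0 \<le> E2" using exp_weight_nonneg[OF assms(2)] by (auto simp: E_def E1_def E2_def)
  have xr: "x \<bullet> x = r\<^sup>2" by (simp add: r_def power2_norm_eq_inner)
  have r: "0 \<le> r" and q: "0 < q" by (auto simp: r_def q_def)
  have "t powr \<alpha> \<le> 1" using t assms by (intro powr_le1) auto
  then have c: "0 \<le> c" "c \<le> \<eta>" using assms by (auto simp: c_def mult_left_le)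
  have tr_aux: "(\<Sum>i\<in>UNIV. A * x $ i * x $ i - B * axis i 1 $ i) = A * (x \<bullet> x) - B * CARD('n)" for A B
    by (simp add: sum_subtractf inner_vec_def sum_distrib_left mult.assoc)
  have "(\<Sum>i\<in>UNIV. hessian (b t) x $ i $ i)
      = 4 * ((c * E1)\<^sup>2 - c * E2) * b t x * (x \<bullet> x) - 2 * c * E1 * b t x * CARD('n)"
    unfolding D(5) c_def[symmetric] E1_def[symmetric] E2_def[symmetric]
    using tr_aux[of "4 * ((c * E1)\<^sup>2 - c * E2) * b t x" "2 * c * E1 * b t x"] by simp
  also have "\<dots> \<le> 4 * ((c * E1)\<^sup>2) * b t x * r\<^sup>2"
  proof -
    have "0 \<le> 4 * (c * E2) * b t x * r\<^sup>2" using c E b by (intro mult_nonneg_nonneg) auto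
    moreover have "0 \<le> 2 * c * E1 * b t x * CARD('n)" using c E b by (intro mult_nonneg_nonneg) auto
    ultimately show ?thesis unfolding xr by (simp add: algebra_simps)
  qed
  finally have tr: "(\<Sum>i\<in>UNIV. hessian (b t) x $ i $ i) \<le> 4 * ((c * E1)\<^sup>2) * b t x * r\<^sup>2" .
  have g: "grad (\<lambda>x::real^'n. exp (norm x powr m)) x \<bullet> grad (b t) x \<le> 0"
  proof -
    have "0 \<le> (q * (m * r powr (m - 2))) * (2 * c * E1 * b t x) * r\<^sup>2"
      using q c E b assms by (intro mult_nonneg_nonneg) auto
    then show ?thesis
      unfolding D(3) diffusion_exp_powr(2)[OF assms(1,3)] c_def[symmetric] E1_def[symmetric]
        r_def[symmetric] q_def[symmetric] by (simp add: xr mult_ac)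
  qed
  have "op (b t) x \<le> q * (4 * ((c * E1)\<^sup>2) * b t x * r\<^sup>2) - exp (r powr s) * b t x"
    unfolding op_def divergence_flux[OF D(4)] r_def[symmetric] q_def[symmetric]
    using mult_left_mono[OF tr less_imp_le[OF q]] g by linarith
  also have "\<dots> = (q * (4 * (c * E1)\<^sup>2 * r\<^sup>2) - exp (r powr s)) * b t x" by (simp add: algebra_simps)
  also have "\<dots> \<le> (K - \<eta> * (\<alpha> * t powr (\<alpha> - 1)) * E) * b t x"
  proof (rule mult_right_mono)
    have "q * (4 * (c * E1)\<^sup>2 * r\<^sup>2) \<le> q * (4 * (\<eta> * E1)\<^sup>2 * r\<^sup>2)"
      using q c E by (intro mult_left_mono mult_right_mono power_mono) auto
    \<comment> \<open>The derivative of the weight carries \<sigma>/2, whose square cancels the 4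
      and leaves the (\<eta> \<sigma>)^2 of the hypothesis \<open>K\<close>.\<close>
    also have "\<dots> = (\<eta> * \<sigma>)\<^sup>2 * exp (r powr m)
      * ((1 + r\<^sup>2) powr (\<sigma> / 2 - 1) * exp ((1 + r\<^sup>2) powr (\<sigma> / 2)) * r)\<^sup>2"
      unfolding E1_def exp_weight1_def exp_weight_def xr q_def by (simp add: power_mult_distrib power_divide)
    also have "\<dots> \<le> exp (r powr s) + K - \<eta> * \<alpha> * E"
      using K[OF r] by (simp add: E_def exp_weight_def xr)
    finally have 1: "q * (4 * (c * E1)\<^sup>2 * r\<^sup>2) \<le> exp (r powr s) + K - \<eta> * \<alpha> * E" .
    have "t powr (\<alpha> - 1) \<le> 1" using t assms by (intro powr_le1) auto
    then have "(\<eta> * \<alpha> * E) * t powr (\<alpha> - 1) \<le> \<eta> * \<alpha> * E"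
      using assms E by (intro mult_left_le) auto
    then have "\<eta> * (\<alpha> * t powr (\<alpha> - 1)) * E \<le> \<eta> * \<alpha> * E" by (simp add: mult_ac)
    then show "q * (4 * (c * E1)\<^sup>2 * r\<^sup>2) - exp (r powr s) \<le> K - \<eta> * (\<alpha> * t powr (\<alpha> - 1)) * E"
      using 1 by linarith
  qed (use b in auto)
  also have "\<dots> = deriv (\<lambda>s. b s x) t"
    using DERIV_imp_deriv[OF D(1)] t by (simp add: E_def)
  finally show ?thesis .
qed

lemma barrier_bounds:
  assumes "0 \<le> K" "0 \<le> \<eta>" "0 < \<alpha>"
  shows "barrier K \<eta> \<alpha> \<sigma> 0 x = 1" "0 \<le> barrier K \<eta> \<alpha> \<sigma> t x"
    "t \<in> {0..<1} \<Longrightarrow> barrier K \<eta> \<alpha> \<sigma> t x \<le> exp K"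
    "continuous_on {0..<1} (\<lambda>t. barrier K \<eta> \<alpha> \<sigma> t x)" "continuous_on UNIV (barrier K \<eta> \<alpha> \<sigma> t)"
proof -
  show "barrier K \<eta> \<alpha> \<sigma> 0 x = 1" using assms by (simp add: barrier_def)
  show "0 \<le> barrier K \<eta> \<alpha> \<sigma> t x" by (simp add: barrier_def)
  show "barrier K \<eta> \<alpha> \<sigma> t x \<le> exp K" if "t \<in> {0..<1}"
  proof -
    have "K * t \<le> K" using that assms by (intro mult_left_le) auto
    moreover have "0 \<le> \<eta> * t powr \<alpha> * exp_weight \<sigma> (x \<bullet> x)"
      using assms by (intro mult_nonneg_nonneg) (auto simp: exp_weight_def)
    ultimately show ?thesis by (simp add: barrier_def)
  qed
  show "continuous_on {0..<1} (\<lambda>t. barrier K \<eta> \<alpha> \<sigma> t x)"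
    unfolding barrier_def using assms
    by (intro continuous_intros continuous_on_powr') auto
  show "continuous_on UNIV (barrier K \<eta> \<alpha> \<sigma> t)"
    using barrier_derivatives(2) differentiable_imp_continuous_within
    by (intro continuous_at_imp_continuous_on) blast
qed

text \<open>For |x| >= 1 the smoothed norm is |x| = r and the integral is at most r
  exp(r^\<beta>/2), below exp(2 + 2 r^m) since \<beta> <= m; the weight absorbs this because m <
  \<sigma>. In the unit ball the smoothed norm is bounded by compactness.\<close>

lemma integral_exp_powr_le_exp_weight:
  fixes nrm :: "real^'n \<Rightarrow> real"
  assumes "smoothed_norm nrm" "0 < \<beta>" "\<beta> \<le> m" "2 \<le> m" "m < \<sigma>" "0 < \<epsilon>"
  shows "\<exists>C\<ge>0. \<forall>x. \<epsilon> * integral {0..nrm x} (\<lambda>\<tau>. exp (\<tau> powr \<beta> / 2)) \<le> exp_weight \<sigma> (x \<bullet> x) + C"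
proof -
  let ?I = "\<lambda>\<rho>. integral {0..\<rho>} (\<lambda>\<tau>. exp (\<tau> powr \<beta> / 2))"
  have I: "?I \<rho> \<le> \<rho> * exp (\<rho> powr \<beta> / 2)" if "0 \<le> \<rho>" for \<rho>
  proof -
    have "?I \<rho> \<le> integral {0..\<rho>} (\<lambda>_. exp (\<rho> powr \<beta> / 2))"
    proof (rule integral_le)
      show "(\<lambda>\<tau>. exp (\<tau> powr \<beta> / 2)) integrable_on {0..\<rho>}"
        using assms(2) by (intro integrable_continuous_interval continuous_intros continuous_on_powr') auto
      show "exp (\<tau> powr \<beta> / 2) \<le> exp (\<rho> powr \<beta> / 2)" if "\<tau> \<in> {0..\<rho>}" for \<tau>
        using that assms(2) by (auto intro!: powr_mono2)
    qed auto
    then show ?thesis using that by simp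
  qed
  have "continuous_on (cball 0 1) nrm"
    using assms(1) differentiable_imp_continuous_within unfolding smoothed_norm_def C2_on_def
    by (intro continuous_at_imp_continuous_on) blast
  then have "bounded (nrm ` cball 0 1)" by (intro compact_imp_bounded compact_continuous_image) auto
  then obtain R where "\<forall>z\<in>nrm ` cball 0 1. norm z \<le> R" unfolding bounded_iff by blast
  then have R: "\<bar>nrm x\<bar> \<le> R" if "norm x \<le> 1" for x using that by auto
  have R0: "0 \<le> R" using R[of 0] by simp
  obtain K where K: "0 \<le> K" "\<And>r. 0 \<le> r \<Longrightarrow> \<epsilon> * exp 2 * exp (2 * r powr m) \<le> exp (r powr \<sigma>) + K"
    using exp_powr_dominates[of m \<sigma> 2 "\<epsilon> * exp 2"] assms by auto
  define C where "C = K + \<epsilon> * (R * exp (R powr \<beta> / 2))"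
  have C: "0 \<le> \<epsilon> * (R * exp (R powr \<beta> / 2))" using assms(6) R0 by simp
  have "\<epsilon> * ?I (nrm x) \<le> exp_weight \<sigma> (x \<bullet> x) + C" for x
  proof (cases "1 \<le> norm x")
    case True
    define r where "r = norm x"
    have r: "1 \<le> r" "nrm x = r" using True assms(1) by (auto simp: r_def smoothed_norm_def)
    have "?I r \<le> r * exp (r powr \<beta> / 2)" using r by (intro I) auto
    also have "\<dots> \<le> exp r * exp (r powr \<beta> / 2)"
    proof (rule mult_right_mono)
      show "r \<le> exp r" using exp_ge_add_one_self[of r] by linarith
    qed simp
    also have "\<dots> \<le> exp (2 + 2 * r powr m)"
    proof -
      have "r powr 1 \<le> r powr m" by (rule powr_mono) (use r(1) assms(4) in auto)
      moreover have "r powr \<beta> \<le> r powr m" by (rule powr_mono) (use r(1) assms(3) in auto)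
      moreover have "r powr 1 = r" using r by simp
      moreover have "0 \<le> r powr m" by simp
      ultimately have "r + r powr \<beta> / 2 \<le> 2 + 2 * r powr m" by linarith
      then show ?thesis by (simp flip: exp_add)
    qed
    finally have "\<epsilon> * ?I r \<le> \<epsilon> * exp (2 + 2 * r powr m)" using assms(6) by simp
    also have "\<dots> = \<epsilon> * exp 2 * exp (2 * r powr m)" by (simp add: exp_add)
    also have "\<dots> \<le> exp (r powr \<sigma>) + K" using r by (intro K) auto
    also have "exp (r powr \<sigma>) \<le> exp_weight \<sigma> (x \<bullet> x)"
    proof -
      have "r powr \<sigma> = (r powr 2) powr (\<sigma> / 2)" unfolding powr_powr by simp
      also have "\<dots> \<le> (1 + x \<bullet> x) powr (\<sigma> / 2)"
        using r assms by (intro powr_mono2) (auto simp: r_def power2_norm_eq_inner)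
      finally show ?thesis by (simp add: exp_weight_def)
    qed
    finally show ?thesis using r C by (simp add: C_def)
  next
    case False
    then have x: "0 \<le> nrm x" "nrm x \<le> R" using R[of x] assms(1) by (auto simp: smoothed_norm_def)
    have "?I (nrm x) \<le> nrm x * exp (nrm x powr \<beta> / 2)" by (rule I[OF x(1)])
    also have "\<dots> \<le> R * exp (R powr \<beta> / 2)"
      using x assms(2) R0 by (intro mult_mono) (auto intro!: powr_mono2)
    finally have "\<epsilon> * ?I (nrm x) \<le> \<epsilon> * (R * exp (R powr \<beta> / 2))" using assms(6) by simp
    moreover have "0 < exp_weight \<sigma> (x \<bullet> x)" by (simp add: exp_weight_def)
    ultimately show ?thesis using K(1) unfolding C_def by linarith
  qed
  then show ?thesis using C K(1) by (intro exI[of _ C]) (auto simp: C_def)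
qed

section \<open>The kernel estimate\<close>

lemma nonneg_eq_0_of_integral_nonpos:
  fixes v :: "'a::euclidean_space \<Rightarrow> real"
  assumes v: "continuous_on UNIV v" "\<And>x. 0 \<le> v x" and int: "integrable lborel v" "(\<integral>x. v x \<partial>lborel) \<le> 0"
  shows "v x = 0"
proof (rule ccontr)
  assume "v x \<noteq> 0"
  define K where "K = v x / 2"
  have K: "0 < K" "K < v x" using v(2)[of x] \<open>v x \<noteq> 0\<close> by (auto simp: K_def)
  have "open {y. K < v y}" using v(1) by (intro open_Collect_less) auto
  then obtain e where e: "0 < e" "ball x e \<subseteq> {y. K < v y}"
    using K openE[of "{y. K < v y}" x] by auto
  have "0 < K * measure lborel (ball x e)" using e(1) K content_ball_pos by simp
  also have "\<dots> = (\<integral>y. K * indicator (ball x e) y \<partial>lborel)" by simp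
  also have "\<dots> \<le> (\<integral>y. v y \<partial>lborel)"
  proof (rule integral_mono)
    show "integrable lborel (\<lambda>y. K * indicator (ball x e) y)"
      using emeasure_lborel_ball_finite by (intro integrable_mult_right integrable_real_indicator) auto
    show "K * indicator (ball x e) y \<le> v y" for y
      using e(2) v(2)[of y] by (auto simp: indicator_def)
  qed (rule int(1))
  finally show False using int(2) by simp
qed

text \<open>Testing against bumps turns an integrated bound into a pointwise one, by continuity.\<close>

lemma pointwise_le_of_integrals:
  fixes g h :: "'a::euclidean_space \<Rightarrow> real"
  assumes g: "continuous_on UNIV g" and h: "continuous_on UNIV h"
    and le: "\<And>f R. continuous_on UNIV f \<Longrightarrow> (\<And>x. 0 \<le> f x) \<Longrightarrow> (\<And>x. R \<le> norm x \<Longrightarrow> f x = 0) \<Longrightarrow>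
      (\<integral>x. g x * f x \<partial>lborel) \<le> (\<integral>x. h x * f x \<partial>lborel)"
  shows "g x \<le> h x"
proof (rule ccontr)
  assume "\<not> g x \<le> h x"
  have "open {y. h y < g y}" using g h by (intro open_Collect_less) auto
  then obtain e where e: "0 < e" "ball x e \<subseteq> {y. h y < g y}"
    using \<open>\<not> g x \<le> h x\<close> openE[of "{y. h y < g y}" x] by auto
  define f where "f = (\<lambda>y. max 0 (1 - dist y x / e))"
  have f: "continuous_on UNIV f" "0 \<le> f y" "norm x + e \<le> norm y \<Longrightarrow> f y = 0" for y
  proof -
    show "continuous_on UNIV f" unfolding f_def using e(1) by (intro continuous_intros) auto
    assume "norm x + e \<le> norm y"
    then have "e \<le> dist y x" using norm_triangle_ineq2[of y x] by (simp add: dist_norm)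
    then show "f y = 0" using e(1) by (simp add: f_def)
  qed (simp add: f_def)
  have fb: "f y = 0" if "y \<notin> ball x e" for y using that e(1) by (simp add: f_def dist_commute)
  have i: "integrable lborel (\<lambda>y. k y * f y)" if "continuous_on UNIV k" for k :: "'a \<Rightarrow> real"
    by (rule integrable_continuous_compact_support[of _ "norm x + e"])
       (auto intro!: continuous_on_mult that f)
  have "(g x - h x) * f x = 0"
  proof (rule nonneg_eq_0_of_integral_nonpos[where v = "\<lambda>y. (g y - h y) * f y"])
    show "continuous_on UNIV (\<lambda>y. (g y - h y) * f y)" by (intro continuous_intros g h f)
    show "0 \<le> (g y - h y) * f y" for y
      using e(2) f(2)[of y] fb[of y] by (cases "y \<in> ball x e") (auto intro!: mult_nonneg_nonneg)
    show "integrable lborel (\<lambda>y. (g y - h y) * f y)" by (intro i continuous_intros g h)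
    have "(\<integral>y. (g y - h y) * f y \<partial>lborel) = (\<integral>y. g y * f y \<partial>lborel) - (\<integral>y. h y * f y \<partial>lborel)"
      using i[OF g] i[OF h] by (simp add: left_diff_distrib)
    then show "(\<integral>y. (g y - h y) * f y \<partial>lborel) \<le> 0"
      using le[OF f(1) f(2), of "norm x + e"] f(3) by simp
  qed
  then show False using \<open>\<not> g x \<le> h x\<close> e(1) by (simp add: f_def)
qed

text \<open>The bound for Dirichlet solutions is the same on all balls that contain x, so it
  survives the limit defining the semigroup. Both sides are then integrals against the same
  nonnegative datum f, and bumps around y give the pointwise inequality.\<close>

lemma (in diffusion) kernel_bound:
  fixes \<phi> :: "real \<Rightarrow> real^'n \<Rightarrow> real"
  assumes p: "integral_kernel op p"
    and \<phi>: "C12_in {0<..<1} UNIV \<phi>"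
    and \<phi>sup: "\<And>s x. s \<in> {0<..<1} \<Longrightarrow> op (\<phi> s) x \<le> deriv (\<lambda>s. \<phi> s x) s"
    and \<phi>0: "\<And>x. \<phi> 0 x = 1" and \<phi>nn: "\<And>s x. s \<in> {0..<1} \<Longrightarrow> 0 \<le> \<phi> s x"
    and \<phi>B: "\<And>s x. s \<in> {0..<1} \<Longrightarrow> \<phi> s x \<le> B" and \<phi>c: "\<And>x. continuous_on {0..<1} (\<lambda>s. \<phi> s x)"
    and t: "0 < t" "t < 1"
  shows "p t x y \<le> 2 * ((real CARD('n))\<^sup>2 / (4 * (t / 3))) powr (CARD('n) / 2) * 2 ^ CARD('n)
    * \<phi> (t / 3) x * \<phi> (t / 3) y"
proof -
  define C where "C = 2 * ((real CARD('n))\<^sup>2 / (4 * (t / 3))) powr (CARD('n) / 2) * 2 ^ CARD('n)"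
  have \<phi>cont: "continuous_on UNIV (\<phi> (t / 3))"
    by (rule continuous_on_slice[OF C12_in_continuous(1)[OF \<phi>]]) (use t in auto)
  obtain S where S: "minimal_semigroup op S"
    "\<And>f. f \<in> bcontfun \<Longrightarrow> has_bochner_integral lborel (\<lambda>y. p t x y * f y) (S t f x)"
    using p t by (auto simp: integral_kernel_def)
  have "p t x y \<le> C * \<phi> (t / 3) x * \<phi> (t / 3) y"
  proof (rule pointwise_le_of_integrals[where g = "p t x" and h = "\<lambda>y. C * \<phi> (t / 3) x * \<phi> (t / 3) y"])
    show "continuous_on UNIV (p t x)" using p t by (simp add: integral_kernel_def)
    show "continuous_on UNIV (\<lambda>y. C * \<phi> (t / 3) x * \<phi> (t / 3) y)" by (intro continuous_intros \<phi>cont)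
    fix f :: "real^'n \<Rightarrow> real" and R
    assume f: "continuous_on UNIV f" "\<And>x. 0 \<le> f x" "\<And>x. R \<le> norm x \<Longrightarrow> f x = 0"
    obtain b where "\<And>x. \<bar>f x\<bar> \<le> b"
      by (rule bounded_continuous_compact_support[OF f(1), of R]) (auto intro: f(3))
    then have fb: "f \<in> bcontfun" using f(1) by (intro bcontfun_normI[of f b]) auto
    obtain u where u: "\<And>n. 1 \<le> n \<Longrightarrow> dirichlet_solution op n f (u n)" "(\<lambda>n. u n t x) \<longlonglongrightarrow> S t f x"
      using S(1) fb t unfolding minimal_semigroup_def by blast
    have fi: "integrable lborel (\<lambda>y. f y * \<phi> (t / 3) y)"
      by (rule integrable_continuous_compact_support[of _ R]) (auto intro!: continuous_on_mult f \<phi>cont)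
    have "S t f x \<le> C * (\<integral>y. f y * \<phi> (t / 3) y \<partial>lborel) * \<phi> (t / 3) x"
    proof (rule LIMSEQ_le_const2[OF u(2)], intro exI allI impI)
      fix n :: nat assume n: "nat \<lceil>norm x\<rceil> + 1 \<le> n"
      then have "norm x < real n" by linarith
      then show "u n t x \<le> C * (\<integral>y. f y * \<phi> (t / 3) y \<partial>lborel) * \<phi> (t / 3) x"
        unfolding C_def using n
        by (intro dirichlet_solution_bound[OF u(1) _ \<phi> \<phi>sup \<phi>0 \<phi>nn \<phi>B \<phi>c f(2) t fi]) auto
    qed
    moreover have "(\<integral>y. p t x y * f y \<partial>lborel) = S t f x"
      using S(2)[OF fb] by (rule has_bochner_integral_integral_eq)
    moreover have "C * (\<integral>y. f y * \<phi> (t / 3) y \<partial>lborel) * \<phi> (t / 3) x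
        = (\<integral>y. C * \<phi> (t / 3) x * \<phi> (t / 3) y * f y \<partial>lborel)"
    proof -
      have "(\<integral>y. C * \<phi> (t / 3) x * \<phi> (t / 3) y * f y \<partial>lborel)
          = (\<integral>y. (C * \<phi> (t / 3) x) * (f y * \<phi> (t / 3) y) \<partial>lborel)"
        by (intro Bochner_Integration.integral_cong) (auto simp: mult_ac)
      also have "\<dots> = (C * \<phi> (t / 3) x) * (\<integral>y. f y * \<phi> (t / 3) y \<partial>lborel)"
        by (rule Bochner_Integration.integral_mult_right_zero)
      also have "\<dots> = C * (\<integral>y. f y * \<phi> (t / 3) y \<partial>lborel) * \<phi> (t / 3) x" by (simp only: mult_ac)
      finally show ?thesis by (rule sym)
    qed
    ultimately show "(\<integral>y. p t x y * f y \<partial>lborel) \<le> (\<integral>y. C * \<phi> (t / 3) x * \<phi> (t / 3) y * f y \<partial>lborel)"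
      by simp
  qed
  then show ?thesis by (simp add: C_def)
qed

theorem theorem4p5:
  fixes m s \<beta> \<epsilon> \<alpha> k :: real
    and Q :: "real^'n \<Rightarrow> real^'n^'n"
    and V :: "real^'n \<Rightarrow> real"
    and p :: "real \<Rightarrow> real^'n \<Rightarrow> real^'n \<Rightarrow> real"
    and nrm :: "real^'n \<Rightarrow> real"
  assumes "2 \<le> m" and "m < s"
    and Q: "\<And>x. Q x = exp (norm x powr m) *\<^sub>R mat 1"
    and V: "\<And>x. V x = exp (norm x powr s)"
    and p: "integral_kernel (elliptic_op Q V) p"
    and nrm: "smoothed_norm nrm"
    and "m / 2 + 1 \<le> \<beta>" and "\<beta> \<le> m"
    and "0 < \<epsilon>"
    and "(2 * \<beta> + m - 2) / (2 * m) < \<alpha>"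
    and "real CARD('n) + 2 < k"
  shows "\<exists>C>0. \<forall>t\<in>{0<..<1}. \<forall>x y.
    p t x y \<le> C * t powr (1 - k / 2) * exp (C * k * t powr (- \<alpha>))
      * exp (- (\<epsilon> / 2) * t powr \<alpha> * integral {0..nrm x} (\<lambda>\<tau>. exp (\<tau> powr \<beta> / 2)))
      * exp (- (\<epsilon> / 2) * t powr \<alpha> * integral {0..nrm y} (\<lambda>\<tau>. exp (\<tau> powr \<beta> / 2)))"
proof -
  let ?q = "\<lambda>x::real^'n. exp (norm x powr m)" and ?d = "CARD('n)"
  interpret diffusion ?q V
    using diffusion_exp_powr(1)[of m s] assms(1,2) unfolding V[abs_def] by simp
  have op: "elliptic_op Q V = op"
    unfolding elliptic_op_def[abs_def] op_def[abs_def] flux_def[abs_def] Q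
    by (simp add: scaleR_matrix_vector_assoc[symmetric])
  \<comment> \<open>This is where \<open>m / 2 + 1 \<le> \<beta>\<close> enters: it makes the
    threshold for \<alpha> at least 1.\<close>
  have "2 * m \<le> 2 * \<beta> + m - 2" using assms(7) by linarith
  then have "1 \<le> (2 * \<beta> + m - 2) / (2 * m)" using assms(1) by (simp add: pos_le_divide_eq)
  then have \<alpha>: "1 \<le> \<alpha>" using assms(10) by linarith
  \<comment> \<open>Any exponent strictly between m and s would do: above m to dominate the
    integrals in the claim, below s to be dominated by V.\<close>
  define \<sigma> where "\<sigma> = (m + s) / 2"
  have \<sigma>: "m < \<sigma>" "\<sigma> < s" "2 \<le> \<sigma>" using assms(1,2) by (auto simp: \<sigma>_def)
  \<comment> \<open>Compensates for evaluating the barrier at t/3: \<eta> (t/3)^\<alpha> is exactly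
    t^\<alpha>.\<close>
  define \<eta> where "\<eta> = 3 powr \<alpha>"
  have \<eta>: "0 < \<eta>" by (simp add: \<eta>_def)
  obtain K where K: "0 \<le> K" and Kr: "\<And>r. 0 \<le> r \<Longrightarrow> (\<eta> * \<sigma>)\<^sup>2 * exp (r powr m)
      * ((1 + r\<^sup>2) powr (\<sigma> / 2 - 1) * exp ((1 + r\<^sup>2) powr (\<sigma> / 2)) * r)\<^sup>2
      + \<eta> * \<alpha> * exp ((1 + r\<^sup>2) powr (\<sigma> / 2)) \<le> exp (r powr s) + K"
    using supersolution_inequality[of m \<sigma> s "(\<eta> * \<sigma>)\<^sup>2" "\<eta> * \<alpha>"] assms(1) \<sigma> \<eta> \<alpha> by auto
  let ?I = "\<lambda>x. integral {0..nrm x} (\<lambda>\<tau>. exp (\<tau> powr \<beta> / 2))"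
  obtain C1 where C1: "0 \<le> C1" "\<And>x. \<epsilon> / 2 * ?I x \<le> exp_weight \<sigma> (x \<bullet> x) + C1"
    using integral_exp_powr_le_exp_weight[OF nrm, of \<beta> m \<sigma> "\<epsilon> / 2"] assms(1,7,8,9) \<sigma> by auto
  let ?\<phi> = "barrier K \<eta> \<alpha> \<sigma> :: real \<Rightarrow> real^'n \<Rightarrow> real"
  have \<alpha>0: "0 < \<alpha>" using \<alpha> by simp
  note bb = barrier_bounds[OF K less_imp_le[OF \<eta>] \<alpha>0]
  have sup: "op (?\<phi> t) x \<le> deriv (\<lambda>t. ?\<phi> t x) t" if "t \<in> {0<..<1}" for t x
    using barrier_supersolution[OF assms(1) \<sigma>(3) _ less_imp_le[OF \<eta>] \<alpha> that Kr, of x] assms(1,2)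
    unfolding V[abs_def] by simp
  have \<phi>: "?\<phi> (t / 3) x \<le> exp (K + C1) * exp (- (\<epsilon> / 2) * t powr \<alpha> * ?I x)" if t: "t \<in> {0<..<1}" for t x
  proof -
    have "\<eta> * (t / 3) powr \<alpha> = t powr \<alpha>" by (simp add: \<eta>_def powr_divide)
    moreover have "t powr \<alpha> * (\<epsilon> / 2 * ?I x) \<le> t powr \<alpha> * (exp_weight \<sigma> (x \<bullet> x) + C1)"
      by (intro mult_left_mono C1) simp
    moreover have "t powr \<alpha> * C1 \<le> C1" using t \<alpha> C1(1) by (intro mult_left_le_one_le) (auto intro!: powr_le1)
    moreover have "K * (t / 3) \<le> K" using t K by (intro mult_left_le) auto
    ultimately have "K * (t / 3) - \<eta> * (t / 3) powr \<alpha> * exp_weight \<sigma> (x \<bullet> x)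
        \<le> (K + C1) + (- (\<epsilon> / 2) * t powr \<alpha> * ?I x)" by (simp add: algebra_simps)
    then show ?thesis unfolding barrier_def by (simp flip: exp_add)
  qed
  define C2 where "C2 = 2 * ((real ?d)\<^sup>2 * 3 / 4) powr (?d / 2) * 2 ^ ?d"
  have C2: "0 < C2" by (simp add: C2_def)
  define C where "C = C2 * exp (K + C1) * exp (K + C1)"
  have C: "0 < C" using C2 by (simp add: C_def)
  have "p t x y \<le> C * t powr (1 - k / 2) * exp (C * k * t powr (- \<alpha>))
      * exp (- (\<epsilon> / 2) * t powr \<alpha> * ?I x) * exp (- (\<epsilon> / 2) * t powr \<alpha> * ?I y)"
    if t: "t \<in> {0<..<1}" for t x y
  proof -
    let ?e = "\<lambda>x. exp (- (\<epsilon> / 2) * t powr \<alpha> * ?I x)"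
    have t': "0 < t" "t < 1" using t by auto
    have "(real ?d)\<^sup>2 / (4 * (t / 3)) = ((real ?d)\<^sup>2 * 3 / 4) * inverse t" using t' by (simp add: field_simps)
    then have "((real ?d)\<^sup>2 / (4 * (t / 3))) powr (?d / 2) = ((real ?d)\<^sup>2 * 3 / 4) powr (?d / 2) * t powr (- (?d / 2))"
      by (simp only: powr_mult inverse_powr powr_minus)
    \<comment> \<open>k > d + 2 gives 1 - k/2 < -d/2, and powers of t < 1 decrease in the
      exponent.\<close>
    moreover have "t powr (- (?d / 2)) \<le> t powr (1 - k / 2)"
      using assms(11) t' by (intro powr_mono') auto
    ultimately have c: "2 * ((real ?d)\<^sup>2 / (4 * (t / 3))) powr (?d / 2) * 2 ^ ?d \<le> C2 * t powr (1 - k / 2)"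
      unfolding C2_def by (simp add: mult_left_mono)
    have "p t x y \<le> 2 * ((real ?d)\<^sup>2 / (4 * (t / 3))) powr (?d / 2) * 2 ^ ?d * ?\<phi> (t / 3) x * ?\<phi> (t / 3) y"
      by (rule kernel_bound[OF p[unfolded op] barrier_C12 sup bb(1) bb(2) bb(3) bb(4) t'])
    also have "\<dots> \<le> (C2 * t powr (1 - k / 2)) * (exp (K + C1) * ?e x) * (exp (K + C1) * ?e y)"
      using C2 by (intro mult_mono[OF mult_mono[OF c \<phi>[OF t]] \<phi>[OF t]] mult_nonneg_nonneg bb(2)) auto
    also have "\<dots> = C * t powr (1 - k / 2) * 1 * ?e x * ?e y" by (simp add: C_def mult_ac)
    also have "\<dots> \<le> C * t powr (1 - k / 2) * exp (C * k * t powr (- \<alpha>)) * ?e x * ?e y"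
    \<comment> \<open>The singular exponential of the claim is inserted as a factor that is at least
      1, since C and k are positive.\<close>
    proof (intro mult_right_mono mult_left_mono)
      have "0 < k" using assms(11) by linarith
      then show "1 \<le> exp (C * k * t powr (- \<alpha>))" using C by simp
    qed (use C in auto)
    finally show ?thesis .
  qed
  then show ?thesis using C by blast
qed

end
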